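(* For every $\varepsilon>0$, there is an algorithm that solves \textsc{RedBluePolynomial} instances in dimension $d$ with $n=r+b$ points in total, each with value at most an integer $v\ge0$, in $2^{O(d)}n^{1+\varepsilon}\sqrt{v}$ time on a log-RAM.
   Context: For $x,y\in\mathbb{R}^d$, write $x<y$ if every coordinate of $y$ is strictly greater than the corresponding coordinate of $x$. \textsc{RedBluePolynomial}: the input is $r$ red points $R_1,\dots,R_r$ and $b$ blue points $B_1,\dots,B_b$ in $\mathbb{R}^d$, with associated non-negative integer values $r_1,\dots,r_r$ and $b_1,\dots,b_b$ respectively; the output is the list of (exponent, coefficient) pairs of the non-zero coefficients of the polynomial $\sum_{(p,q):R_p<B_q}x^{r_p+b_q}$. A log-RAM is a word RAM that additionally supports constant-time arithmetic operations (including multiplication, integer division and modulo) on words of $O(\log n)$ bits.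
   Formalization: In the time bound, n and v are replaced by max(1,n) and max(1,v), because for v=0 (or n=0) the literal bound would be zero steps; for n,v≥1 the bound is as stated. *)

theory Defs
  imports Complex_Main "HOL-Computational_Algebra.Polynomial"
begin

unbundle bit_operations_syntax

text \<open>
  A log-RAM with word length \<open>w\<close>: registers and memory cells hold words, that is, natural
  numbers below \<open>2 ^ w\<close>, and addresses are words.  Every instruction takes one time step.
  Real input coordinates do not fit into words; they form a separate read-only array that can be
  accessed only through comparisons of two of its entries, whose indices are held in registers.
\<close>

datatype binop =
    OpAdd | OpSub | OpMul | OpDiv | OpMod
  | OpAnd | OpOr | OpXor | OpShl | OpShr

fun eval_binop :: "nat \<Rightarrow> binop \<Rightarrow> nat \<Rightarrow> nat \<Rightarrow> nat" where
  "eval_binop w OpAdd x y = (x + y) mod 2 ^ w"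
| "eval_binop w OpSub x y = nat ((int x - int y) mod 2 ^ w)"
| "eval_binop w OpMul x y = (x * y) mod 2 ^ w"
| "eval_binop w OpDiv x y = x div y"
| "eval_binop w OpMod x y = x mod y"
| "eval_binop w OpAnd x y = x AND y"
| "eval_binop w OpOr  x y = x OR y"
| "eval_binop w OpXor x y = x XOR y"
| "eval_binop w OpShl x y = push_bit y x mod 2 ^ w"
| "eval_binop w OpShr x y = drop_bit y x"

text \<open>
  The operands \<open>i\<close>, \<open>j\<close>, \<open>k\<close> are register numbers and \<open>l\<close> is a
  position in the program.
\<close>

datatype instr =
    LoadConst nat nat          \<comment> \<open>\<open>LoadConst i c\<close>: register \<open>i\<close> := \<open>c\<close>\<close>
  | BinOp binop nat nat nat    \<comment> \<open>\<open>BinOp f i j k\<close>: register \<open>i\<close> := \<open>f\<close> (register \<open>j\<close>) (register \<open>k\<close>)\<close>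
  | Load nat nat               \<comment> \<open>\<open>Load i j\<close>: register \<open>i\<close> := memory at address register \<open>j\<close>\<close>
  | Store nat nat              \<comment> \<open>\<open>Store i j\<close>: memory at address register \<open>i\<close> := register \<open>j\<close>\<close>
  | Jump nat                   \<comment> \<open>\<open>Jump l\<close>\<close>
  | JumpLess nat nat nat       \<comment> \<open>\<open>JumpLess i j l\<close>: jump to \<open>l\<close> if register \<open>i\<close> < register \<open>j\<close>\<close>
  | JumpRealLess nat nat nat   \<comment> \<open>the same for the real inputs with indices register \<open>i\<close> and register \<open>j\<close>\<close>

type_synonym program = "instr list"

record ram_state =
  pc  :: nat
  reg :: "nat \<Rightarrow> nat"
  mem :: "nat \<Rightarrow> nat"

fun exec_instr :: "nat \<Rightarrow> (nat \<Rightarrow> real) \<Rightarrow> instr \<Rightarrow> ram_state \<Rightarrow> ram_state" where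
  "exec_instr w X (LoadConst i c) s =
     s\<lparr>pc := pc s + 1, reg := (reg s)(i := c mod 2 ^ w)\<rparr>"
| "exec_instr w X (BinOp f i j k) s =
     s\<lparr>pc := pc s + 1, reg := (reg s)(i := eval_binop w f (reg s j) (reg s k))\<rparr>"
| "exec_instr w X (Load i j) s =
     s\<lparr>pc := pc s + 1, reg := (reg s)(i := mem s (reg s j))\<rparr>"
| "exec_instr w X (Store i j) s =
     s\<lparr>pc := pc s + 1, mem := (mem s)(reg s i := reg s j)\<rparr>"
| "exec_instr w X (Jump l) s = s\<lparr>pc := l\<rparr>"
| "exec_instr w X (JumpLess i j l) s =
     s\<lparr>pc := (if reg s i < reg s j then l else pc s + 1)\<rparr>"
| "exec_instr w X (JumpRealLess i j l) s =
     s\<lparr>pc := (if X (reg s i) < X (reg s j) then l else pc s + 1)\<rparr>"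

text \<open>
  \<open>runs_to w X P s t s'\<close>: started in \<open>s\<close>, the program \<open>P\<close> halts in \<open>s'\<close>
  after exactly \<open>t\<close> instructions.  It halts when the program counter leaves the program.
\<close>

inductive runs_to ::
  "nat \<Rightarrow> (nat \<Rightarrow> real) \<Rightarrow> program \<Rightarrow> ram_state \<Rightarrow> nat \<Rightarrow> ram_state \<Rightarrow> bool"
  for w :: nat and X :: "nat \<Rightarrow> real" and P :: program where
  halt: "pc s \<ge> length P \<Longrightarrow> runs_to w X P s 0 s"
| step: "pc s < length P \<Longrightarrow> runs_to w X P (exec_instr w X (P ! pc s) s) t s' \<Longrightarrow>
         runs_to w X P s (Suc t) s'"

text \<open>
  A point of dimension \<open>d\<close> with its value is a pair of a coordinate list of length \<open>d\<close>
  and a natural number.  Points may be repeated.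
\<close>

type_synonym valued_point = "real list \<times> nat"

definition valued_points :: "nat \<Rightarrow> nat \<Rightarrow> valued_point list \<Rightarrow> bool" where
  "valued_points d v ps \<longleftrightarrow> (\<forall>(x, a) \<in> set ps. length x = d \<and> a \<le> v)"

definition point_less :: "real list \<Rightarrow> real list \<Rightarrow> bool" where
  "point_less x y \<longleftrightarrow> list_all2 (<) x y"

definition red_blue_poly :: "valued_point list \<Rightarrow> valued_point list \<Rightarrow> nat poly" where
  "red_blue_poly R B =
     (\<Sum>(p, q) \<in> {(p, q). p < length R \<and> q < length B \<and> point_less (fst (R ! p)) (fst (B ! q))}.
        monom 1 (snd (R ! p) + snd (B ! q)))"

text \<open>
  The input: the dimension and the numbers of red and blue points in registers 0, 1, 2, the values
  in memory from address 0 on (red points first), and the coordinates, point by point in the same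
  order, in the real array.  Everything else is 0.
\<close>

definition red_blue_init :: "nat \<Rightarrow> valued_point list \<Rightarrow> valued_point list \<Rightarrow> ram_state" where
  "red_blue_init d R B =
     \<lparr>pc = 0,
      reg = (\<lambda>_. 0)(0 := d, 1 := length R, 2 := length B),
      mem = (\<lambda>i. if i < length (R @ B) then snd ((R @ B) ! i) else 0)\<rparr>"

definition red_blue_coords :: "valued_point list \<Rightarrow> valued_point list \<Rightarrow> nat \<Rightarrow> real" where
  "red_blue_coords R B i =
     (let xs = concat (map fst (R @ B)) in if i < length xs then xs ! i else 0)"

text \<open>
  The output is a list of pairs in consecutive memory cells; register 0 holds its address and
  register 1 the number of pairs.
\<close>

definition output_pairs :: "ram_state \<Rightarrow> (nat \<times> nat) list" where
  "output_pairs s =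
     map (\<lambda>i. (mem s (reg s 0 + 2 * i), mem s (reg s 0 + 2 * i + 1))) [0..<reg s 1]"

definition lists_nonzero_coeffs :: "(nat \<times> nat) list \<Rightarrow> nat poly \<Rightarrow> bool" where
  "lists_nonzero_coeffs L f \<longleftrightarrow>
     distinct L \<and> set L = {(e, coeff f e) | e. coeff f e \<noteq> 0}"

definition solves_red_blue_within ::
  "nat \<Rightarrow> program \<Rightarrow> nat \<Rightarrow> valued_point list \<Rightarrow> valued_point list \<Rightarrow> real \<Rightarrow> bool" where
  "solves_red_blue_within w P d R B T \<longleftrightarrow>
     (\<exists>t s. runs_to w (red_blue_coords R B) P (red_blue_init d R B) t s \<and>
            lists_nonzero_coeffs (output_pairs s) (red_blue_poly R B) \<and>
            real t \<le> T)"

end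

theory Submission
  imports Defs "HOL-Library.Multiset"
begin

text \<open>
  Divide and conquer over the coordinates.  A group of points is sorted by the current coordinate
  and halved; a dominating pair lies within one half, or its red point is in the lower and its blue
  point in the upper half, and the latter pairs form a group for the next coordinate.  When no
  coordinate is left, every red point of a group of size \<open>m\<close> is paired with every blue one, either
  directly, in time \<open>m\<^sup>2\<close> if \<open>m\<^sup>2 \<le> v\<close>, or by polynomial multiplication in time
  \<open>v powr (1 + \<delta>)\<close>; both are at most \<open>m powr (1 + \<epsilon>) * sqrt v\<close>.  With
  \<open>pot i m = H * g ^ (d - i) * m powr (1 + \<epsilon>) * sqrt v\<close> as the budget of a group, the two halves
  take only the fraction \<open>(3 / 4) powr \<epsilon>\<close> of the budget, so for large \<open>g\<close> the rest pays for sorting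
  and for the group of the next coordinate.

  Multiplication is Toom-Cook with \<open>r\<close> parts on all digit positions at once: exponents are written in
  base \<open>r\<close>, the resulting polynomials in \<open>L\<close> variables are evaluated on the grid \<open>{0..<2 * r - 1} ^ L\<close>,
  multiplied pointwise and interpolated.  Interpolation is scaled to an integer matrix with
  denominator \<open>D\<close>, so all arithmetic can be done modulo \<open>2 ^ w\<close> and one exact division by \<open>D ^ L\<close>
  gives the coefficients.
\<close>

section \<open>A structured language compiled to the log-RAM\<close>

text \<open>The program depends on \<open>\<epsilon>\<close> only: \<open>r\<close>, the matrix of
  powers and its scaled inverse are constants of the code. \<open>r\<close> is so large that
  \<open>2 * r <= r powr (1 + \<delta>)\<close> for \<open>\<delta> = \<epsilon> / 4\<close>; the
  grid then has at most \<open>q * v powr (1 + \<delta>)\<close> points, and the number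
  \<open>L\<close> of digits costs another \<open>v powr \<delta>\<close>. This slack makes
  Toom-Cook affordable, which evaluates at small integers instead of roots of unity. Its denominator
  \<open>D\<close> may be even, hence not invertible modulo \<open>2 ^ w\<close>; dividing once at
  the end only needs \<open>D ^ L\<close> times a coefficient to fit into a word, and
  \<open>D ^ L\<close> is polynomial in \<open>v\<close>.

  An array indexed by exponents has about \<open>2 * v\<close> cells, too many to be scanned or
  cleared within the budget. Zero-initialised memory makes clearing unnecessary, and a list of the
  exponents met so far replaces the scan.

  The machine has no recursion. Subproblems lie on an explicit stack, and the recurrence for the
  time becomes a potential of the stack: the sum of \<open>pot\<close> over its tasks pays for all
  iterations of one loop.\<close>

datatype var =
    Dim | Reds | Blues | Pts | MaxV | Len | Pow | Grid | Scale | Cnt | Gtop | Stop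
  | CurI | CurM | J | Wd | K | LA | LB | Mid | Hi | Fl | Half | Cr | Pt
  | PA | PB | EE | CC | Z | Y | U | Ax | Ie | St

text \<open>Even registers from 4 on. Registers 0 to 2 carry the input on entry, 0 and 1 the output
  on exit, and the odd ones from 3 on are left to the code generator.\<close>

primrec vreg :: "var \<Rightarrow> nat" where
  "vreg Dim = 4" | "vreg Reds = 6" | "vreg Blues = 8" | "vreg Pts = 10" | "vreg MaxV = 12"
| "vreg Len = 14" | "vreg Pow = 16" | "vreg Grid = 18" | "vreg Scale = 20" | "vreg Cnt = 22"
| "vreg Gtop = 24" | "vreg Stop = 26" | "vreg CurI = 28" | "vreg CurM = 30" | "vreg J = 32"
| "vreg Wd = 34" | "vreg K = 36" | "vreg LA = 38" | "vreg LB = 40" | "vreg Mid = 42"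
| "vreg Hi = 44" | "vreg Fl = 46" | "vreg Half = 48" | "vreg Cr = 50" | "vreg Pt = 52"
| "vreg PA = 54" | "vreg PB = 56" | "vreg EE = 58" | "vreg CC = 60" | "vreg Z = 62"
| "vreg Y = 64" | "vreg U = 66" | "vreg Ax = 68" | "vreg Ie = 70" | "vreg St = 72"

datatype arr = AG | ATI | ATM | AS | AT | AF | AH | ACC | LST | FW | BW

primrec anum :: "arr \<Rightarrow> nat" where
  "anum AG = 0" | "anum ATI = 1" | "anum ATM = 2" | "anum AS = 3" | "anum AT = 4"
| "anum AF = 5" | "anum AH = 6" | "anum ACC = 7" | "anum LST = 8" | "anum FW = 9" | "anum BW = 10"

text \<open>\<open>MPlus\<close>, \<open>MMinus\<close> and \<open>MTimes\<close> compile to the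
  same instructions as \<open>Plus\<close>, \<open>Minus\<close> and \<open>Times\<close>. The
  difference lies in the semantics: the plain versions carry the obligation that nothing overflows,
  the modular ones compute residues modulo \<open>2 ^ w\<close>.\<close>

datatype aop = Plus | Minus | Times | Div | Mod | MPlus | MMinus | MTimes

datatype exp = Num nat | Var var | Arr arr exp | Raw exp | Op aop exp exp

datatype com =
    Skip
  | Assign var exp              (\<open>_ ::= _\<close> [1000, 61] 61)
  | Store arr exp exp           (\<open>_[_] ::= _\<close> [1000, 0, 61] 61)
  | Out exp exp
  | Seq com com                 (infixr \<open>;;\<close> 60)
  | IfLess exp exp com com
  | IfReal exp exp com com
  | While exp exp com

abbreviation plus_exp (infixl \<open>\<oplus>\<close> 65) where "a \<oplus> b \<equiv> Op Plus a b"
abbreviation minus_exp (infixl \<open>\<ominus>\<close> 65) where "a \<ominus> b \<equiv> Op Minus a b"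
abbreviation times_exp (infixl \<open>\<otimes>\<close> 70) where "a \<otimes> b \<equiv> Op Times a b"

record st =
  vs :: "var \<Rightarrow> nat"
  ar :: "arr \<Rightarrow> nat \<Rightarrow> nat"
  rw :: "nat \<Rightarrow> nat"

abbreviation set_var :: "st \<Rightarrow> var \<Rightarrow> nat \<Rightarrow> st" where
  "set_var s x k \<equiv> s\<lparr>vs := (vs s)(x := k)\<rparr>"

primrec writes_var :: "com \<Rightarrow> var \<Rightarrow> bool" where
  "writes_var Skip x = False"
| "writes_var (Assign y e) x = (x = y)"
| "writes_var (Store a e f) x = False"
| "writes_var (Out e f) x = False"
| "writes_var (Seq c1 c2) x = (writes_var c1 x \<or> writes_var c2 x)"
| "writes_var (IfLess e f c1 c2) x = (writes_var c1 x \<or> writes_var c2 x)"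
| "writes_var (IfReal e f c1 c2) x = (writes_var c1 x \<or> writes_var c2 x)"
| "writes_var (While e f c) x = writes_var c x"

primrec writes_arr :: "com \<Rightarrow> arr \<Rightarrow> bool" where
  "writes_arr Skip x = False"
| "writes_arr (Assign y e) x = False"
| "writes_arr (Store a e f) x = (x = a)"
| "writes_arr (Out e f) x = False"
| "writes_arr (Seq c1 c2) x = (writes_arr c1 x \<or> writes_arr c2 x)"
| "writes_arr (IfLess e f c1 c2) x = (writes_arr c1 x \<or> writes_arr c2 x)"
| "writes_arr (IfReal e f c1 c2) x = (writes_arr c1 x \<or> writes_arr c2 x)"
| "writes_arr (While e f c) x = writes_arr c x"

primrec writes_raw :: "com \<Rightarrow> bool" where
  "writes_raw Skip = False"
| "writes_raw (Assign y e) = False"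
| "writes_raw (Store a e f) = False"
| "writes_raw (Out e f) = True"
| "writes_raw (Seq c1 c2) = (writes_raw c1 \<or> writes_raw c2)"
| "writes_raw (IfLess e f c1 c2) = (writes_raw c1 \<or> writes_raw c2)"
| "writes_raw (IfReal e f c1 c2) = (writes_raw c1 \<or> writes_raw c2)"
| "writes_raw (While e f c) = writes_raw c"

text \<open>The frame of a command, read off from its text. \<open>wp_mono\<close> supplies it
  together with every postcondition, so specifications state only what changes.\<close>

definition unchanged :: "com \<Rightarrow> st \<Rightarrow> st \<Rightarrow> bool" where
  "unchanged c s s' \<longleftrightarrow>
     (\<forall>x. \<not> writes_var c x \<longrightarrow> vs s' x = vs s x) \<and>
     (\<forall>a. \<not> writes_arr c a \<longrightarrow> ar s' a = ar s a) \<and>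
     (\<not> writes_raw c \<longrightarrow> rw s' = rw s)"

lemma unchanged_var: "unchanged c s s' \<Longrightarrow> \<not> writes_var c x \<Longrightarrow> vs s' x = vs s x"
  by (auto simp: unchanged_def)

lemma unchanged_refl: "unchanged c s s"
  by (simp add: unchanged_def)

lemma unchanged_trans: "unchanged c s s' \<Longrightarrow> unchanged c s' s'' \<Longrightarrow> unchanged c s s''"
  by (simp add: unchanged_def)

text \<open>Array \<open>a\<close> is interleaved with the other arrays above address \<open>base\<close>; below \<open>base\<close> lie the
  input values and the output.  Temporaries live in odd registers, and register 1 holds \<open>base\<close>.\<close>

definition treg :: "nat \<Rightarrow> nat" where "treg j = 2 * j + 3"

primrec binop_of :: "aop \<Rightarrow> binop" where
  "binop_of Plus = OpAdd" | "binop_of Minus = OpSub" | "binop_of Times = OpMul"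
| "binop_of Div = OpDiv" | "binop_of Mod = OpMod"
| "binop_of MPlus = OpAdd" | "binop_of MMinus = OpSub" | "binop_of MTimes = OpMul"

text \<open>The temporaries form an operand stack: the value ends in \<open>treg j\<close>, and only
  temporaries from \<open>j\<close> upwards are overwritten. OR of a register with itself serves as
  a move.\<close>

primrec cexp :: "exp \<Rightarrow> nat \<Rightarrow> instr list" where
  "cexp (Num c) j = [LoadConst (treg j) c]"
| "cexp (Var x) j = [BinOp OpOr (treg j) (vreg x) (vreg x)]"
| "cexp (Arr a e) j = cexp e j @
     [LoadConst (treg (j + 1)) 16, BinOp OpMul (treg j) (treg j) (treg (j + 1)),
      LoadConst (treg (j + 1)) (anum a), BinOp OpAdd (treg j) (treg j) (treg (j + 1)),
      BinOp OpAdd (treg j) (treg j) 1, instr.Load (treg j) (treg j)]"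
| "cexp (Raw e) j = cexp e j @ [instr.Load (treg j) (treg j)]"
| "cexp (Op f a b) j = cexp a j @ cexp b (j + 1) @ [BinOp (binop_of f) (treg j) (treg j) (treg (j + 1))]"

text \<open>The code for a failed test comes first, because the conditional jump falls through to
  it. Jump targets are absolute, hence code is a function of its position \<open>p\<close>.\<close>

definition branch ::
  "(nat \<Rightarrow> instr) \<Rightarrow> instr list \<Rightarrow> (nat \<Rightarrow> instr list) \<Rightarrow> (nat \<Rightarrow> instr list) \<Rightarrow> nat \<Rightarrow> instr list" where
  "branch i t k1 k2 p =
     (let p2 = p + length t + 1; x2 = k2 p2; p1 = p2 + length x2 + 1; x1 = k1 p1
      in t @ [i p1] @ x2 @ [Jump (p1 + length x1)] @ x1)"

primrec ccom :: "com \<Rightarrow> nat \<Rightarrow> instr list" where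
  "ccom Skip p = []"
| "ccom (Assign x e) p = cexp e 0 @ [BinOp OpOr (vreg x) (treg 0) (treg 0)]"
| "ccom (Store a e f) p = cexp e 0 @ cexp f 1 @
     [LoadConst (treg 2) 16, BinOp OpMul (treg 0) (treg 0) (treg 2),
      LoadConst (treg 2) (anum a), BinOp OpAdd (treg 0) (treg 0) (treg 2),
      BinOp OpAdd (treg 0) (treg 0) 1, instr.Store (treg 0) (treg 1)]"
| "ccom (Out e f) p = cexp e 0 @ cexp f 1 @ [instr.Store (treg 0) (treg 1)]"
| "ccom (Seq c1 c2) p = ccom c1 p @ ccom c2 (p + length (ccom c1 p))"
| "ccom (IfLess e f c1 c2) p =
     branch (JumpLess (treg 0) (treg 1)) (cexp e 0 @ cexp f 1) (ccom c1) (ccom c2) p"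
| "ccom (IfReal e f c1 c2) p =
     branch (JumpRealLess (treg 0) (treg 1)) (cexp e 0 @ cexp f 1) (ccom c1) (ccom c2) p"
| "ccom (While e f c) p =
     (let t = cexp e 0 @ cexp f 1; p1 = p + length t + 2; k = ccom c p1
      in t @ [JumpLess (treg 0) (treg 1) p1] @ [Jump (p1 + length k + 1)] @ k @ [Jump p])"

text \<open>The list \<open>l\<close> yields a left inverse of \<open>vreg\<close>, which avoids a
  case distinction over all pairs of variables.\<close>

lemma vreg_inj [simp]: "vreg x = vreg y \<longleftrightarrow> x = y"
proof -
  define l where "l = [Dim, Reds, Blues, Pts, MaxV, Len, Pow, Grid, Scale, Cnt, Gtop, Stop,
    CurI, CurM, J, Wd, K, LA, LB, Mid, Hi, Fl, Half, Cr, Pt, PA, PB, EE, CC, Z, Y, U, Ax, Ie, St]"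
  have "l ! (vreg z div 2 - 2) = z" for z
    by (cases z; simp add: l_def)
  then show ?thesis by metis
qed

lemma vreg_even [simp]: "even (vreg x)" and vreg_ge: "vreg x \<ge> 4"
  by (cases x; simp)+

lemma treg_odd [simp]: "odd (treg j)"
  by (simp add: treg_def)

lemma treg_inj [simp]: "treg i = treg j \<longleftrightarrow> i = j"
  by (simp add: treg_def)

lemma vreg_neq_treg [simp]: "vreg x \<noteq> treg j" "treg j \<noteq> vreg x"
  by (metis vreg_even treg_odd)+

lemma reg_one_neq [simp]: "vreg x \<noteq> Suc 0" "treg j \<noteq> Suc 0" "Suc 0 \<noteq> vreg x" "Suc 0 \<noteq> treg j"
  using vreg_ge[of x] by (auto simp: treg_def)

lemma anum_less: "anum a < 16"
  by (cases a) auto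

lemma anum_inj [simp]: "anum a = anum b \<longleftrightarrow> a = b"
  by (cases a; cases b; simp)

lemma addr_inj: "16 * i + anum a = 16 * j + anum b \<longleftrightarrow> i = j \<and> a = b"
proof -
  have "(16 * i + anum a) div 16 = i" "(16 * i + anum a) mod 16 = anum a" for i a
    using anum_less[of a] by auto
  then show ?thesis by (metis anum_inj)
qed

text \<open>\<open>runs_to\<close> describes complete runs only. A stretch of \<open>k\<close> steps
  is expressed through its effect on every completion, which makes stretches composable without a
  second inductive definition.\<close>

definition reach ::
  "nat \<Rightarrow> (nat \<Rightarrow> real) \<Rightarrow> program \<Rightarrow> ram_state \<Rightarrow> nat \<Rightarrow> ram_state \<Rightarrow> bool" where
  "reach w X P s k s' \<longleftrightarrow> (\<forall>t s''. runs_to w X P s' t s'' \<longrightarrow> runs_to w X P s (k + t) s'')"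

lemma reach_refl: "reach w X P s 0 s"
  by (simp add: reach_def)

lemma reach_trans: "reach w X P s k s' \<Longrightarrow> reach w X P s' l s'' \<Longrightarrow> reach w X P s (k + l) s''"
  by (auto simp: reach_def add.assoc)

section \<open>Placing code in a program and running straight-line code\<close>

definition code_at :: "program \<Rightarrow> nat \<Rightarrow> instr list \<Rightarrow> bool" where
  "code_at P p c \<longleftrightarrow> (\<exists>a b. P = a @ c @ b \<and> length a = p)"

lemma code_at_append: "code_at P p (c @ e) \<longleftrightarrow> code_at P p c \<and> code_at P (p + length c) e"
proof
  assume "code_at P p (c @ e)"
  then obtain a b where ab: "P = a @ (c @ e) @ b" "length a = p"
    by (auto simp: code_at_def)
  have "P = a @ c @ (e @ b)" "P = (a @ c) @ e @ b" "length (a @ c) = p + length c"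
    using ab by auto
  then show "code_at P p c \<and> code_at P (p + length c) e"
    using ab(2) unfolding code_at_def by blast
next
  assume "code_at P p c \<and> code_at P (p + length c) e"
  then obtain a b a' b' where ab: "P = a @ c @ b" "length a = p"
    and ab': "P = a' @ e @ b'" "length a' = p + length c"
    unfolding code_at_def by blast
  have "a' = take (p + length c) P" using ab' by simp
  also have "\<dots> = a @ c" using ab by simp
  finally show "code_at P p (c @ e)"
    using ab ab' unfolding code_at_def by (metis append.assoc)
qed

lemma code_at_Cons: "code_at P p (i # c) \<longleftrightarrow> code_at P p [i] \<and> code_at P (Suc p) c"
  using code_at_append[of P p "[i]" c] by simp

lemma reach_step:
  assumes "code_at P (pc s) [i]"
  shows "reach w X P s 1 (exec_instr w X i s)"
proof -
  have "pc s < length P" "P ! pc s = i"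
    using assms by (auto simp: code_at_def nth_append)
  then show ?thesis
    using runs_to.step[of s P w X] by (auto simp: reach_def)
qed

primrec straight :: "instr \<Rightarrow> bool" where
  "straight (LoadConst i c) = True"
| "straight (BinOp f i j k) = True"
| "straight (instr.Load i j) = True"
| "straight (instr.Store i j) = True"
| "straight (Jump l) = False"
| "straight (JumpLess i j l) = False"
| "straight (JumpRealLess i j l) = False"

lemma straight_pc: "straight i \<Longrightarrow> pc (exec_instr w X i s) = Suc (pc s)"
  by (cases i) auto

lemma reach_straight:
  assumes "code_at P (pc s) c" "\<forall>i\<in>set c. straight i"
  shows "reach w X P s (length c) (fold (exec_instr w X) c s) \<and>
         pc (fold (exec_instr w X) c s) = pc s + length c"
  using assms
proof (induction c arbitrary: s)
  case Nil
  then show ?case by (simp add: reach_refl)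
next
  case (Cons i c)
  have c1: "code_at P (pc s) [i]" and c2: "code_at P (Suc (pc s)) c"
    using Cons.prems(1) by (auto simp: code_at_Cons[of P "pc s" i c])
  have p: "pc (exec_instr w X i s) = Suc (pc s)" using Cons.prems(2) straight_pc by simp
  have r: "reach w X P (exec_instr w X i s) (length c) (fold (exec_instr w X) c (exec_instr w X i s)) \<and>
         pc (fold (exec_instr w X) c (exec_instr w X i s)) = pc (exec_instr w X i s) + length c"
    using Cons.IH[of "exec_instr w X i s"] Cons.prems(2) c2 p by simp
  from reach_trans[OF reach_step[OF c1, of w X] conjunct1[OF r]] r p show ?case by simp
qed

lemma straight_cexp: "i \<in> set (cexp e j) \<Longrightarrow> straight i"
  by (induction e arbitrary: j) auto

text \<open>\<open>M\<close> bounds array indices and the results of checked arithmetic. Sixteen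
  cells are reserved per index, of which the arrays use eleven; the assumption makes every address
  computed for an array a word.\<close>

locale ram =
  fixes w :: nat and X :: "nat \<Rightarrow> real" and M base :: nat
  assumes base_le: "base + 16 * M + 16 \<le> 2 ^ w"
begin

section \<open>Semantics of the structured language and correctness of its compilation\<close>

primrec aopv :: "aop \<Rightarrow> nat \<Rightarrow> nat \<Rightarrow> nat" where
  "aopv Plus x y = x + y" | "aopv Minus x y = x - y" | "aopv Times x y = x * y"
| "aopv Div x y = x div y" | "aopv Mod x y = x mod y"
| "aopv MPlus x y = (x + y) mod 2 ^ w"
| "aopv MMinus x y = nat ((int x - int y) mod 2 ^ w)"
| "aopv MTimes x y = (x * y) mod 2 ^ w"

primrec aopok :: "aop \<Rightarrow> nat \<Rightarrow> nat \<Rightarrow> bool" where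
  "aopok Plus x y = (x + y < M)" | "aopok Minus x y = (y \<le> x \<and> x < M)"
| "aopok Times x y = (x * y < M)" | "aopok Div x y = True" | "aopok Mod x y = True"
| "aopok MPlus x y = True" | "aopok MMinus x y = True" | "aopok MTimes x y = True"

primrec ev :: "exp \<Rightarrow> st \<Rightarrow> nat" where
  "ev (Num c) s = c"
| "ev (Var x) s = vs s x"
| "ev (Arr a e) s = ar s a (ev e s)"
| "ev (Raw e) s = rw s (ev e s)"
| "ev (Op f a b) s = aopv f (ev a s) (ev b s)"

primrec chk :: "exp \<Rightarrow> st \<Rightarrow> bool" where
  "chk (Num c) s = (c < M)"
| "chk (Var x) s = True"
| "chk (Arr a e) s = (chk e s \<and> ev e s < M)"
| "chk (Raw e) s = (chk e s \<and> ev e s < base)"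
| "chk (Op f a b) s = (chk a s \<and> chk b s \<and> aopok f (ev a s) (ev b s))"

text \<open>Unlike the machine, the semantics gets stuck when a non-modular operation or an address
  exceeds \<open>M\<close>; this keeps all other arithmetic free of remainders.  One tick per statement is
  counted.\<close>

inductive big :: "com \<Rightarrow> st \<Rightarrow> nat \<Rightarrow> st \<Rightarrow> bool" where
  Skip: "big Skip s 0 s"
| Assign: "chk e s \<Longrightarrow> big (Assign x e) s 1 (s\<lparr>vs := (vs s)(x := ev e s)\<rparr>)"
| Store: "chk e s \<Longrightarrow> chk f s \<Longrightarrow> ev e s < M \<Longrightarrow>
    big (Store a e f) s 1 (s\<lparr>ar := (ar s)(a := (ar s a)(ev e s := ev f s))\<rparr>)"
| Out: "chk e s \<Longrightarrow> chk f s \<Longrightarrow> ev e s < base \<Longrightarrow>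
    big (Out e f) s 1 (s\<lparr>rw := (rw s)(ev e s := ev f s)\<rparr>)"
| Seq: "big c1 s t s' \<Longrightarrow> big c2 s' t' s'' \<Longrightarrow> big (Seq c1 c2) s (t + t') s''"
| IfT: "chk e s \<Longrightarrow> chk f s \<Longrightarrow> ev e s < ev f s \<Longrightarrow> big c1 s t s' \<Longrightarrow>
    big (IfLess e f c1 c2) s (Suc t) s'"
| IfF: "chk e s \<Longrightarrow> chk f s \<Longrightarrow> \<not> ev e s < ev f s \<Longrightarrow> big c2 s t s' \<Longrightarrow>
    big (IfLess e f c1 c2) s (Suc t) s'"
| RealT: "chk e s \<Longrightarrow> chk f s \<Longrightarrow> X (ev e s) < X (ev f s) \<Longrightarrow> big c1 s t s' \<Longrightarrow>
    big (IfReal e f c1 c2) s (Suc t) s'"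
| RealF: "chk e s \<Longrightarrow> chk f s \<Longrightarrow> \<not> X (ev e s) < X (ev f s) \<Longrightarrow> big c2 s t s' \<Longrightarrow>
    big (IfReal e f c1 c2) s (Suc t) s'"
| WhileF: "chk e s \<Longrightarrow> chk f s \<Longrightarrow> \<not> ev e s < ev f s \<Longrightarrow> big (While e f c) s 1 s"
| WhileT: "chk e s \<Longrightarrow> chk f s \<Longrightarrow> ev e s < ev f s \<Longrightarrow> big c s t s' \<Longrightarrow>
    big (While e f c) s' t' s'' \<Longrightarrow> big (While e f c) s (Suc (t + t')) s''"

inductive_cases SkipE: "big Skip s t s'"
inductive_cases AssignE: "big (Assign x e) s t s'"
inductive_cases StoreE: "big (Store x e f) s t s'"
inductive_cases OutE: "big (Out e f) s t s'"
inductive_cases SeqE: "big (Seq c1 c2) s t s'"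
inductive_cases IfE: "big (IfLess e f c1 c2) s t s'"
inductive_cases RealE: "big (IfReal e f c1 c2) s t s'"

lemma big_unchanged: "big c s t s' \<Longrightarrow> unchanged c s s'"
  by (induction rule: big.induct) (auto simp: unchanged_def)

text \<open>Array entries from index \<open>M\<close> on have no counterpart in memory; the checks
  of \<open>big\<close> keep programs from touching them.\<close>

definition rel :: "st \<Rightarrow> ram_state \<Rightarrow> bool" where
  "rel s r \<longleftrightarrow> (\<forall>x. reg r (vreg x) = vs s x) \<and> reg r 1 = base \<and>
     (\<forall>a. \<forall>i<M. mem r (base + (16 * i + anum a)) = ar s a i) \<and> (\<forall>i<base. mem r i = rw s i)"

lemma addr_less: "i < M \<Longrightarrow> base + (16 * i + anum a) < 2 ^ w"
  using anum_less[of a] base_le by linarith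

lemma M_less: "x < M \<Longrightarrow> x < 2 ^ w"
  using base_le by linarith

lemma aop_correct: "aopok f x y \<Longrightarrow> eval_binop w (binop_of f) x y = aopv f x y"
proof (cases f)
  case Minus
  assume "aopok f x y"
  then have a: "y \<le> x" "x < 2 ^ w" using Minus M_less by auto
  then have "(int x - int y) mod 2 ^ w = int (x - y)"
    by (metis int_ops(6) less_imp_diff_less mod_less of_nat_diff of_nat_mod of_nat_numeral of_nat_power)
  then show ?thesis using Minus by simp
qed (auto simp: M_less)

text \<open>The middle conjunct carries the induction through \<open>Op\<close>: the left operand
  waits in \<open>treg j\<close> while the right one is computed from \<open>treg (j + 1)\<close>
  upwards.\<close>

lemma cexp_correct:
  assumes "rel s r" "chk e s"
  shows "reg (fold (exec_instr w X) (cexp e j) r) (treg j) = ev e s \<and>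
    (\<forall>y. (\<forall>i\<ge>j. y \<noteq> treg i) \<longrightarrow> reg (fold (exec_instr w X) (cexp e j) r) y = reg r y) \<and>
    mem (fold (exec_instr w X) (cexp e j) r) = mem r"
  using assms
proof (induction e arbitrary: j r)
  case (Num c)
  then show ?case by (auto simp: M_less)
next
  case (Var x)
  then show ?case by (auto simp: rel_def)
next
  case (Arr a e)
  define r' where "r' = fold (exec_instr w X) (cexp e j) r"
  have r': "reg r' (treg j) = ev e s" "\<And>y. \<forall>i\<ge>j. y \<noteq> treg i \<Longrightarrow> reg r' y = reg r y" "mem r' = mem r"
    using Arr.IH[OF Arr.prems(1), of j] Arr.prems(2) by (auto simp: r'_def)
  have lt: "ev e s < M" using Arr.prems by simp
  have b: "reg r' (Suc 0) = base" using r'(2)[of 1] Arr.prems by (simp add: rel_def)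
  have l: "base + (16 * ev e s + anum a) < 2 ^ w" by (rule addr_less[OF lt])
  have m: "mem r (base + (16 * ev e s + anum a)) = ar s a (ev e s)"
    using Arr.prems lt by (simp add: rel_def)
  have c: "(16::nat) < 2 ^ w" "anum a < 2 ^ w"
    using base_le anum_less[of a] lt by linarith+
  have md: "16 mod 2 ^ w = (16::nat)" "anum a mod 2 ^ w = anum a" 
     "(ev e s * 16) mod 2 ^ w = ev e s * 16" "(anum a + ev e s * 16) mod 2 ^ w = anum a + ev e s * 16" 
     "(base + (anum a + ev e s * 16)) mod 2 ^ w = base + (anum a + ev e s * 16)"
    using c l by (intro mod_less; linarith)+
  show ?case
    using m by (auto simp: r'(1,3) b md r'_def[symmetric] ac_simps intro: r'(2))
next
  case (Raw e)
  define r' where "r' = fold (exec_instr w X) (cexp e j) r"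
  have r': "reg r' (treg j) = ev e s" "\<And>y. \<forall>i\<ge>j. y \<noteq> treg i \<Longrightarrow> reg r' y = reg r y" "mem r' = mem r"
    using Raw.IH[OF Raw.prems(1), of j] Raw.prems(2) by (auto simp: r'_def)
  have "mem r (ev e s) = rw s (ev e s)" using Raw.prems by (simp add: rel_def)
  then show ?case
    by (auto simp: r'(1,3) r'_def[symmetric] intro: r'(2))
next
  case (Op f e1 e2)
  define r' where "r' = fold (exec_instr w X) (cexp e1 j) r"
  have r': "reg r' (treg j) = ev e1 s" "\<And>y. \<forall>i\<ge>j. y \<noteq> treg i \<Longrightarrow> reg r' y = reg r y" "mem r' = mem r"
    using Op.IH(1)[OF Op.prems(1), of j] Op.prems(2) by (auto simp: r'_def)
  have rl: "rel s r'"
    using Op.prems(1) r'(2) by (auto simp: rel_def r'(3))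
  define q where "q = fold (exec_instr w X) (cexp e2 (j + 1)) r'"
  have q: "reg q (treg (j + 1)) = ev e2 s" "\<And>y. \<forall>i\<ge>j + 1. y \<noteq> treg i \<Longrightarrow> reg q y = reg r' y" "mem q = mem r'"
    using Op.IH(2)[OF rl, of "j + 1"] Op.prems(2) by (auto simp: q_def)
  have q1: "reg q (treg j) = ev e1 s" using q(2)[of "treg j"] r'(1) by simp
  have ok: "eval_binop w (binop_of f) (ev e1 s) (ev e2 s) = aopv f (ev e1 s) (ev e2 s)"
    using Op.prems(2) aop_correct by simp
  have "fold (exec_instr w X) (cexp (Op f e1 e2) j) r =
    q\<lparr>pc := pc q + 1, reg := (reg q)(treg j := aopv f (ev e1 s) (ev e2 s))\<rparr>"
    using q(1) q1 by (simp add: r'_def[symmetric] q_def[symmetric] ok del: One_nat_def)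
  then show ?case
    using q r' by auto
qed

lemma rel_temp:
  assumes "rel s r" "\<And>y. (\<forall>i. y \<noteq> treg i) \<Longrightarrow> reg r' y = reg r y" "mem r' = mem r"
  shows "rel s r'"
  using assms by (auto simp: rel_def)

lemma cexp2:
  assumes "rel s r" "chk e s" "chk f s" "code_at P (pc r) (cexp e 0 @ cexp f 1)"
  obtains r' where "reach w X P r (length (cexp e 0 @ cexp f 1)) r'" "rel s r'"
    "pc r' = pc r + length (cexp e 0 @ cexp f 1)"
    "reg r' (treg 0) = ev e s" "reg r' (treg 1) = ev f s"
proof -
  define q where "q = fold (exec_instr w X) (cexp e 0) r"
  have q: "reg q (treg 0) = ev e s" "\<And>y. (\<forall>i. y \<noteq> treg i) \<Longrightarrow> reg q y = reg r y" "mem q = mem r"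
    using cexp_correct[OF assms(1,2), of 0] by (auto simp: q_def)
  have rq: "rel s q" using rel_temp[OF assms(1) q(2,3)] .
  define r' where "r' = fold (exec_instr w X) (cexp f 1) q"
  have r': "reg r' (treg 1) = ev f s" "\<And>y. (\<forall>i\<ge>1. y \<noteq> treg i) \<Longrightarrow> reg r' y = reg q y" "mem r' = mem q"
    using cexp_correct[OF rq assms(3), of 1] by (auto simp: r'_def)
  have "rel s r'" by (rule rel_temp[OF rq _ r'(3)]) (rule r'(2), simp)
  moreover have "r' = fold (exec_instr w X) (cexp e 0 @ cexp f 1) r"
    by (simp add: r'_def q_def)
  moreover have "reg r' (treg 0) = ev e s" using r'(2)[of "treg 0"] q(1) by simp
  ultimately show ?thesis
    using reach_straight[OF assms(4), of w X] straight_cexp that[of r'] r'(1) by auto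
qed

lemma reach_jump:
  "code_at P (pc r) [Jump l] \<Longrightarrow> reach w X P r 1 (r\<lparr>pc := l\<rparr>)"
  using reach_step[of P r "Jump l" w X] by simp

lemma rel_pc [simp]: "rel s (r\<lparr>pc := l\<rparr>) = rel s r"
  by (simp add: rel_def)

text \<open>One proof for both conditionals: \<open>i\<close> abstracts the jump instruction and
  \<open>b\<close> the outcome of its test. The extra tick of a conditional pays for its test and
  its jumps, which are part of the code and so at most \<open>N\<close> instructions.\<close>

lemma branch_correct:
  assumes rel: "rel s r" and chk: "chk e s" "chk f s"
    and at: "code_at P (pc r) (branch i (cexp e 0 @ cexp f 1) k1 k2 (pc r))"
    and N: "length (branch i (cexp e 0 @ cexp f 1) k1 k2 (pc r)) \<le> N"
    and i: "\<And>q l. reg q (treg 0) = ev e s \<Longrightarrow> reg q (treg 1) = ev f s \<Longrightarrow>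
      exec_instr w X (i l) q = q\<lparr>pc := if b then l else pc q + 1\<rparr>"
    and IH: "\<And>q. rel s q \<Longrightarrow> code_at P (pc q) ((if b then k1 else k2) (pc q)) \<Longrightarrow>
      length ((if b then k1 else k2) (pc q)) \<le> N \<Longrightarrow>
      \<exists>k q'. reach w X P q k q' \<and> rel s' q' \<and> pc q' = pc q + length ((if b then k1 else k2) (pc q)) \<and> k \<le> N * t"
  shows "\<exists>k r'. reach w X P r k r' \<and> rel s' r' \<and>
    pc r' = pc r + length (branch i (cexp e 0 @ cexp f 1) k1 k2 (pc r)) \<and> k \<le> N * Suc t"
proof -
  let ?t = "cexp e 0 @ cexp f 1" let ?p2 = "pc r + length ?t + 1" let ?x2 = "k2 ?p2"
  let ?p1 = "?p2 + length ?x2 + 1" let ?x1 = "k1 ?p1"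
  have cc: "branch i ?t k1 k2 (pc r) = ?t @ [i ?p1] @ ?x2 @ [Jump (?p1 + length ?x1)] @ ?x1"
    by (simp add: branch_def Let_def)
  have c: "code_at P (pc r) ?t" "code_at P (pc r + length ?t) [i ?p1]" "code_at P ?p2 ?x2"
     "code_at P (?p2 + length ?x2) [Jump (?p1 + length ?x1)]" "code_at P ?p1 ?x1"
    using at unfolding cc
    by (simp_all add: code_at_append add.assoc code_at_Cons[of _ _ _ "_ @ _"] code_at_Cons[of _ _ _ "k1 _"])
  obtain q where q: "reach w X P r (length ?t) q" "rel s q" "pc q = pc r + length ?t"
    "reg q (treg 0) = ev e s" "reg q (treg 1) = ev f s"
    by (rule cexp2[OF rel chk c(1)])
  have len: "length ?t + 1 + 1 \<le> N" "length ?x1 \<le> N" "length ?x2 \<le> N" using N unfolding cc by simp_all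
  have st: "reach w X P q 1 (q\<lparr>pc := if b then ?p1 else ?p2\<rparr>)"
  proof -
    have "exec_instr w X (i ?p1) q = q\<lparr>pc := if b then ?p1 else ?p2\<rparr>"
      using i[OF q(4,5), of ?p1] q(3) by simp
    moreover have "reach w X P q 1 (exec_instr w X (i ?p1) q)"
      by (rule reach_step, unfold q(3), rule c(2))
    ultimately show ?thesis by (simp only:)
  qed
  show ?thesis
  proof (cases b)
    case True
    obtain k q' where q': "reach w X P (q\<lparr>pc := ?p1\<rparr>) k q'" "rel s' q'" "pc q' = ?p1 + length ?x1" "k \<le> N * t"
      using IH[of "q\<lparr>pc := ?p1\<rparr>"] q(2) c(5) len True by auto
    have st': "reach w X P q 1 (q\<lparr>pc := ?p1\<rparr>)" using st True by simp
    show ?thesis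
      using reach_trans[OF reach_trans[OF q(1) st'] q'(1)] q'(2,3,4) len unfolding cc
      by (intro exI[of _ "length ?t + 1 + k"] exI[of _ q']) simp
  next
    case False
    obtain k q' where q': "reach w X P (q\<lparr>pc := ?p2\<rparr>) k q'" "rel s' q'" "pc q' = ?p2 + length ?x2" "k \<le> N * t"
      using IH[of "q\<lparr>pc := ?p2\<rparr>"] q(2) c(3) len False by auto
    have jm: "reach w X P q' 1 (q'\<lparr>pc := ?p1 + length ?x1\<rparr>)"
      using reach_jump c(4) q'(3) by metis
    have st': "reach w X P q 1 (q\<lparr>pc := ?p2\<rparr>)" using st False by simp
    show ?thesis
      using reach_trans[OF reach_trans[OF reach_trans[OF q(1) st'] q'(1)] jm] q'(2,3,4) len unfolding cc
      by (intro exI[of _ "length ?t + 1 + k + 1"] exI[of _ "q'\<lparr>pc := ?p1 + length ?x1\<rparr>"]) simp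
  qed
qed

text \<open>The instructions that belong to a statement itself, outside its substatements, occur in
  the code once; they number at most \<open>N\<close>, and one tick pays for them. The slowdown is
  therefore a constant of the program.\<close>

lemma compile_correct:
  assumes "big c s t s'" "rel s r" "code_at P (pc r) (ccom c (pc r))"
    and "length (ccom c (pc r)) \<le> N"
  shows "\<exists>k r'. reach w X P r k r' \<and> rel s' r' \<and> pc r' = pc r + length (ccom c (pc r)) \<and> k \<le> N * t"
  using assms
proof (induction arbitrary: r rule: big.induct)
  case (Skip s)
  then show ?case using reach_refl by fastforce
next
  case (Assign e s x)
  define q where "q = fold (exec_instr w X) (cexp e 0) r"
  have q: "reg q (treg 0) = ev e s" "\<And>y. (\<forall>i. y \<noteq> treg i) \<Longrightarrow> reg q y = reg r y" "mem q = mem r"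
    using cexp_correct[OF Assign(2,1), of 0] by (auto simp: q_def)
  have rq: "rel s q" using rel_temp[OF Assign(2) q(2,3)] .
  have *: "fold (exec_instr w X) (ccom (Assign x e) (pc r)) r =
     q\<lparr>pc := pc q + 1, reg := (reg q)(vreg x := ev e s)\<rparr>"
    by (simp add: q_def[symmetric] q(1))
  have "rel (s\<lparr>vs := (vs s)(x := ev e s)\<rparr>) (fold (exec_instr w X) (ccom (Assign x e) (pc r)) r)"
    unfolding * using rq by (auto simp: rel_def)
  moreover have "\<forall>i\<in>set (ccom (Assign x e) (pc r)). straight i"
    using straight_cexp by auto
  ultimately show ?case
    using reach_straight[OF Assign(3), of w X] Assign(4) by (metis mult.right_neutral)
next
  case (Store e s f a)
  have c: "code_at P (pc r) (cexp e 0 @ cexp f 1)"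
    using Store.prems(2) by (simp add: code_at_append)
  obtain q where q: "reach w X P r (length (cexp e 0 @ cexp f 1)) q" "rel s q"
    "pc q = pc r + length (cexp e 0 @ cexp f 1)"
    "reg q (treg 0) = ev e s" "reg q (treg 1) = ev f s"
    by (rule cexp2[OF Store.prems(1) Store.hyps(1,2) c])
  define l where "l = [LoadConst (treg 2) 16, BinOp OpMul (treg 0) (treg 0) (treg 2),
      LoadConst (treg 2) (anum a), BinOp OpAdd (treg 0) (treg 0) (treg 2),
      BinOp OpAdd (treg 0) (treg 0) 1, instr.Store (treg 0) (treg 1)]"
  have len: "ccom (Store a e f) (pc r) = (cexp e 0 @ cexp f 1) @ l" by (simp add: l_def)
  have lt: "ev e s < M" by fact
  have b: "reg q (Suc 0) = base" using q(2) by (simp add: rel_def)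
  have l: "base + (16 * ev e s + anum a) < 2 ^ w" by (rule addr_less[OF lt])
  have c16: "(16::nat) < 2 ^ w" "anum a < 2 ^ w"
    using base_le anum_less[of a] lt by linarith+
  have md: "16 mod 2 ^ w = (16::nat)" "anum a mod 2 ^ w = anum a" 
     "(ev e s * 16) mod 2 ^ w = ev e s * 16" "(anum a + ev e s * 16) mod 2 ^ w = anum a + ev e s * 16" 
     "(base + (anum a + ev e s * 16)) mod 2 ^ w = base + (anum a + ev e s * 16)"
    using c16 l by (intro mod_less; linarith)+
  define r' where "r' = fold (exec_instr w X) l q"
  have rr: "reach w X P q (length l) r' \<and> pc r' = pc q + length l"
    unfolding r'_def using Store.prems(2) q(3) unfolding len code_at_append
    by (intro reach_straight) (auto simp: l_def)
  have m: "mem r' = (mem q)(base + (16 * ev e s + anum a) := ev f s)"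
    by (simp add: r'_def l_def q(4) q(5)[simplified] b md ac_simps)
  have rg: "reg r' y = reg q y" if "\<forall>i. y \<noteq> treg i" for y
    using that by (simp add: r'_def l_def)
  have "rel (s\<lparr>ar := (ar s)(a := (ar s a)(ev e s := ev f s))\<rparr>) r'"
    using q(2) rg by (auto simp: rel_def m addr_inj)
  then show ?case
    using reach_trans[OF q(1) conjunct1[OF rr]] rr q(3) Store.prems(3)
    unfolding len by (metis (no_types) add.assoc length_append mult.right_neutral)
next
  case (Out e s f)
  have c: "code_at P (pc r) (cexp e 0 @ cexp f 1)"
    using Out.prems(2) by (simp add: code_at_append)
  obtain q where q: "reach w X P r (length (cexp e 0 @ cexp f 1)) q" "rel s q"
    "pc q = pc r + length (cexp e 0 @ cexp f 1)"
    "reg q (treg 0) = ev e s" "reg q (treg 1) = ev f s"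
    by (rule cexp2[OF Out.prems(1) Out.hyps(1,2) c])
  have len: "ccom (Out e f) (pc r) = (cexp e 0 @ cexp f 1) @ [instr.Store (treg 0) (treg 1)]" by simp
  define r' where "r' = exec_instr w X (instr.Store (treg 0) (treg 1)) q"
  have rr: "reach w X P q 1 r'"
    unfolding r'_def using Out.prems(2) q(3) unfolding len code_at_append
    by (intro reach_step) auto
  have pcr: "pc r' = pc q + 1" by (simp add: r'_def)
  have "rel (s\<lparr>rw := (rw s)(ev e s := ev f s)\<rparr>) r'"
    using q(2) Out.hyps(3) q(4,5) by (auto simp: rel_def r'_def)
  then show ?case
    using reach_trans[OF q(1) rr] pcr q(3) Out.prems(3)
    unfolding len 
    by (intro exI[of _ "length (cexp e 0 @ cexp f 1) + 1"] exI[of _ r']) simp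
next
  case (Seq c1 s t s' c2 t' s'')
  have c: "code_at P (pc r) (ccom c1 (pc r))"
     "code_at P (pc r + length (ccom c1 (pc r))) (ccom c2 (pc r + length (ccom c1 (pc r))))"
    using Seq.prems(2) by (auto simp: code_at_append)
  obtain k q where q: "reach w X P r k q" "rel s' q" "pc q = pc r + length (ccom c1 (pc r))" "k \<le> N * t"
    using Seq.IH(1)[OF Seq.prems(1) c(1)] Seq.prems(3) by auto
  obtain k' q' where q': "reach w X P q k' q'" "rel s'' q'" "pc q' = pc q + length (ccom c2 (pc q))" "k' \<le> N * t'"
    using Seq.IH(2)[OF q(2)] c(2) q(3) Seq.prems(3) by auto
  show ?case
    using reach_trans[OF q(1) q'(1)] q'(2,3,4) q(3,4)
    by (intro exI[of _ "k + k'"] exI[of _ q']) (simp add: distrib_left)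
next
  case (IfT e s f c1 t s' c2)
  show ?case unfolding ccom.simps
    by (rule branch_correct[where b = True]) (use IfT in auto)
next
  case (IfF e s f c2 t s' c1)
  show ?case unfolding ccom.simps
    by (rule branch_correct[where b = False]) (use IfF in auto)
next
  case (RealT e s f c1 t s' c2)
  show ?case unfolding ccom.simps
    by (rule branch_correct[where b = True]) (use RealT in auto)
next
  case (RealF e s f c2 t s' c1)
  show ?case unfolding ccom.simps
    by (rule branch_correct[where b = False]) (use RealF in auto)
next
  case (WhileF e s f c)
  let ?t = "cexp e 0 @ cexp f 1" let ?p1 = "pc r + length ?t + 2" let ?k = "ccom c ?p1"
  have cc: "ccom (While e f c) (pc r) =
    ?t @ [JumpLess (treg 0) (treg 1) ?p1] @ [Jump (?p1 + length ?k + 1)] @ ?k @ [Jump (pc r)]"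
    by (simp add: Let_def)
  have c: "code_at P (pc r) ?t" "code_at P (pc r + length ?t) [JumpLess (treg 0) (treg 1) ?p1]"
     "code_at P (Suc (pc r + length ?t)) [Jump (?p1 + length ?k + 1)]"
    using WhileF.prems(2) unfolding cc
    by (simp_all add: code_at_append add.assoc code_at_Cons[of _ _ _ "_ @ _"] code_at_Cons[of _ _ _ "Jump _ # _"])
  obtain q where q: "reach w X P r (length ?t) q" "rel s q" "pc q = pc r + length ?t"
    "reg q (treg 0) = ev e s" "reg q (treg 1) = ev f s"
    by (rule cexp2[OF WhileF.prems(1) WhileF.hyps(1,2) c(1)])
  have st: "reach w X P q 1 (q\<lparr>pc := Suc (pc r + length ?t)\<rparr>)"
    using reach_step[of P q "JumpLess (treg 0) (treg 1) ?p1" w X] c(2) q(3) q(4) q(5)[simplified] WhileF.hyps(3)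
    by simp
  have jm: "reach w X P (q\<lparr>pc := Suc (pc r + length ?t)\<rparr>) 1 (q\<lparr>pc := ?p1 + length ?k + 1\<rparr>)"
    using reach_jump[of P "q\<lparr>pc := Suc (pc r + length ?t)\<rparr>" "?p1 + length ?k + 1"] c(3) by simp
  have "length ?t + 1 + 1 \<le> N" using WhileF.prems(3) unfolding cc by simp
  then show ?case
    using reach_trans[OF reach_trans[OF q(1) st] jm] q(2) unfolding cc
    by (intro exI[of _ "length ?t + 1 + 1"] exI[of _ "q\<lparr>pc := ?p1 + length ?k + 1\<rparr>"]) simp
next
  case (WhileT e s f c t s' t' s'')
  let ?t = "cexp e 0 @ cexp f 1" let ?p1 = "pc r + length ?t + 2" let ?k = "ccom c ?p1"
  have cc: "ccom (While e f c) (pc r) =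
    ?t @ [JumpLess (treg 0) (treg 1) ?p1] @ [Jump (?p1 + length ?k + 1)] @ ?k @ [Jump (pc r)]"
    by (simp add: Let_def)
  have c: "code_at P (pc r) ?t" "code_at P (pc r + length ?t) [JumpLess (treg 0) (treg 1) ?p1]"
     "code_at P ?p1 ?k" "code_at P (?p1 + length ?k) [Jump (pc r)]"
    using WhileT.prems(2) unfolding cc
    by (simp_all add: code_at_append add.assoc code_at_Cons[of _ _ _ "_ @ _"] code_at_Cons[of _ _ _ "Jump _ # _"])
  obtain q where q: "reach w X P r (length ?t) q" "rel s q" "pc q = pc r + length ?t"
    "reg q (treg 0) = ev e s" "reg q (treg 1) = ev f s"
    by (rule cexp2[OF WhileT.prems(1) WhileT.hyps(1,2) c(1)])
  have st: "reach w X P q 1 (q\<lparr>pc := ?p1\<rparr>)"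
    using reach_step[of P q "JumpLess (treg 0) (treg 1) ?p1" w X] c(2) q(3) q(4) q(5)[simplified] WhileT.hyps(3)
    by simp
  obtain k q' where q': "reach w X P (q\<lparr>pc := ?p1\<rparr>) k q'" "rel s' q'" "pc q' = ?p1 + length ?k" "k \<le> N * t"
    using WhileT.IH(1)[of "q\<lparr>pc := ?p1\<rparr>"] q(2) c(3) WhileT.prems(3) unfolding cc by auto
  have jm: "reach w X P q' 1 (q'\<lparr>pc := pc r\<rparr>)"
    using reach_jump c(4) q'(3) by metis
  obtain k' q'' where q'': "reach w X P (q'\<lparr>pc := pc r\<rparr>) k' q''" "rel s'' q''"
    "pc q'' = pc r + length (ccom (While e f c) (pc r))" "k' \<le> N * t'"
    using WhileT.IH(2)[of "q'\<lparr>pc := pc r\<rparr>"] q'(2) WhileT.prems(2,3) by auto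
  have "length ?t + 1 + 1 \<le> N" using WhileT.prems(3) unfolding cc by simp
  then have "length ?t + 1 + k + 1 + k' \<le> N * Suc (t + t')"
    using q'(4) q''(4) by (simp add: distrib_left)
  then show ?case
    using reach_trans[OF reach_trans[OF reach_trans[OF reach_trans[OF q(1) st] q'(1)] jm] q''(1)] q''(2,3)
    by blast
qed

end

section \<open>Merging\<close>

definition sorted_seg :: "(nat \<Rightarrow> nat \<Rightarrow> bool) \<Rightarrow> (nat \<Rightarrow> nat) \<Rightarrow> nat \<Rightarrow> nat \<Rightarrow> bool" where
  "sorted_seg le A l h \<longleftrightarrow> (\<forall>x y. l \<le> x \<longrightarrow> x < y \<longrightarrow> y < h \<longrightarrow> le (A x) (A y))"

text \<open>\<open>S\<close> is the input, \<open>T0\<close> the target at the start and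
  \<open>T\<close> the target now; \<open>a\<close> and \<open>b\<close> are the cursors of the two
  runs, \<open>k\<close> that of the output. The order condition between output and unread entries
  is what allows the smaller head to be appended.\<close>

definition merge_inv ::
  "(nat \<Rightarrow> nat \<Rightarrow> bool) \<Rightarrow> (nat \<Rightarrow> nat) \<Rightarrow> (nat \<Rightarrow> nat) \<Rightarrow> nat \<Rightarrow> nat \<Rightarrow> nat \<Rightarrow> nat \<Rightarrow> nat \<Rightarrow> nat \<Rightarrow> (nat \<Rightarrow> nat) \<Rightarrow> bool" where
  "merge_inv le S T0 lo mid hi a b k T \<longleftrightarrow>
     lo \<le> a \<and> a \<le> mid \<and> mid \<le> b \<and> b \<le> hi \<and> k + mid = a + b \<and>
     sorted_seg le T lo k \<and>
     mset (map T [lo..<k]) = mset (map S [lo..<a]) + mset (map S [mid..<b]) \<and>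
     (\<forall>x y. lo \<le> x \<longrightarrow> x < k \<longrightarrow> (a \<le> y \<and> y < mid \<or> b \<le> y \<and> y < hi) \<longrightarrow> le (T x) (S y)) \<and>
     (\<forall>x. x < lo \<or> hi \<le> x \<longrightarrow> T x = T0 x)"

lemma merge_inv_init: "lo \<le> mid \<Longrightarrow> mid \<le> hi \<Longrightarrow> merge_inv le S T lo mid hi lo mid lo T"
  by (auto simp: merge_inv_def sorted_seg_def)

lemma mset_upt_snoc: "l \<le> h \<Longrightarrow> mset (map A [l..<Suc h]) = mset (map A [l..<h]) + {#A h#}"
  by simp

lemma mset_upt_upd: "h \<le> x \<Longrightarrow> mset (map (A(x := y)) [l..<h]) = mset (map A [l..<h])"
  by (rule arg_cong[of _ _ mset], rule map_cong) auto

text \<open>The head of the left run precedes the rest of its own run by sortedness, and the rest of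
  the other run by transitivity through that run's head, which is compared only if it
  exists.\<close>

lemma merge_inv_left:
  assumes inv: "merge_inv le S T0 lo mid hi a b k T"
    and a: "a < mid" and ab: "b < hi \<Longrightarrow> le (S a) (S b)"
    and srt: "sorted_seg le S lo mid" "sorted_seg le S mid hi"
    and tr: "\<And>x y z. le x y \<Longrightarrow> le y z \<Longrightarrow> le x z"
  shows "merge_inv le S T0 lo mid hi (Suc a) b (Suc k) (T(k := S a))"
proof -
  have i: "lo \<le> a" "mid \<le> b" "b \<le> hi" "k + mid = a + b" "sorted_seg le T lo k"
     "mset (map T [lo..<k]) = mset (map S [lo..<a]) + mset (map S [mid..<b])"
     "\<And>x y. lo \<le> x \<Longrightarrow> x < k \<Longrightarrow> (a \<le> y \<and> y < mid \<or> b \<le> y \<and> y < hi) \<Longrightarrow> le (T x) (S y)"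
     "\<And>x. x < lo \<or> hi \<le> x \<Longrightarrow> T x = T0 x"
    using inv unfolding merge_inv_def by blast+
  have k: "lo \<le> k" "k < hi" using i a by auto
  have sa: "le (S a) (S y)" if "Suc a \<le> y \<and> y < mid \<or> b \<le> y \<and> y < hi" for y
  proof (cases "Suc a \<le> y \<and> y < mid")
    case True
    then show ?thesis using srt(1) i(1) by (auto simp: sorted_seg_def)
  next
    case False
    then have y: "b \<le> y" "y < hi" using that by auto
    show ?thesis
    proof (cases "y = b")
      case False
      then have "le (S b) (S y)" using srt(2) i(2) y by (auto simp: sorted_seg_def)
      then show ?thesis using tr ab y by (meson le_less_trans)
    qed (use ab y in auto)
  qed
  have "mset (map (T(k := S a)) [lo..<Suc k]) = mset (map S [lo..<Suc a]) + mset (map S [mid..<b])"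
    using k i(1,6) by (simp add: mset_upt_snoc mset_upt_upd del: upt_Suc mset_map mset_upt)
  moreover have "sorted_seg le (T(k := S a)) lo (Suc k)"
    using i(5) i(7)[of _ a] a by (auto simp: sorted_seg_def less_Suc_eq)
  moreover have "le ((T(k := S a)) x) (S y)"
    if "lo \<le> x" "x < Suc k" "(Suc a \<le> y \<and> y < mid \<or> b \<le> y \<and> y < hi)" for x y
    using that i(7)[of x y] sa[of y] by (cases "x = k") auto
  ultimately show ?thesis
    using i k a unfolding merge_inv_def by auto
qed

lemma merge_inv_right:
  assumes inv: "merge_inv le S T0 lo mid hi a b k T"
    and b: "b < hi" and ab: "a < mid \<Longrightarrow> le (S b) (S a)"
    and srt: "sorted_seg le S lo mid" "sorted_seg le S mid hi"
    and tr: "\<And>x y z. le x y \<Longrightarrow> le y z \<Longrightarrow> le x z"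
  shows "merge_inv le S T0 lo mid hi a (Suc b) (Suc k) (T(k := S b))"
proof -
  have i: "lo \<le> a" "mid \<le> b" "a \<le> mid" "k + mid = a + b" "sorted_seg le T lo k"
     "mset (map T [lo..<k]) = mset (map S [lo..<a]) + mset (map S [mid..<b])"
     "\<And>x y. lo \<le> x \<Longrightarrow> x < k \<Longrightarrow> (a \<le> y \<and> y < mid \<or> b \<le> y \<and> y < hi) \<Longrightarrow> le (T x) (S y)"
     "\<And>x. x < lo \<or> hi \<le> x \<Longrightarrow> T x = T0 x"
    using inv unfolding merge_inv_def by blast+
  have k: "lo \<le> k" "k < hi" using i b by auto
  have sa: "le (S b) (S y)" if "a \<le> y \<and> y < mid \<or> Suc b \<le> y \<and> y < hi" for y
  proof (cases "Suc b \<le> y \<and> y < hi")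
    case True
    then show ?thesis using srt(2) i(2) by (auto simp: sorted_seg_def)
  next
    case False
    then have y: "a \<le> y" "y < mid" using that by auto
    show ?thesis
    proof (cases "y = a")
      case False
      then have "le (S a) (S y)" using srt(1) i(1) y by (auto simp: sorted_seg_def)
      then show ?thesis using tr ab y by (meson le_less_trans)
    qed (use ab y in auto)
  qed
  have "mset (map (T(k := S b)) [lo..<Suc k]) = mset (map S [lo..<a]) + mset (map S [mid..<Suc b])"
    using k i(2,6) by (simp add: mset_upt_snoc mset_upt_upd del: upt_Suc mset_map mset_upt)
  moreover have "sorted_seg le (T(k := S b)) lo (Suc k)"
    using i(5) i(7)[of _ b] b by (auto simp: sorted_seg_def less_Suc_eq)
  moreover have "le ((T(k := S b)) x) (S y)"
    if "lo \<le> x" "x < Suc k" "(a \<le> y \<and> y < mid \<or> Suc b \<le> y \<and> y < hi)" for x y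
    using that i(7)[of x y] sa[of y] by (cases "x = k") auto
  ultimately show ?thesis
    using i k b unfolding merge_inv_def by auto
qed

definition sorted_blocks :: "(nat \<Rightarrow> nat \<Rightarrow> bool) \<Rightarrow> nat \<Rightarrow> (nat \<Rightarrow> nat) \<Rightarrow> nat \<Rightarrow> bool" where
  "sorted_blocks le w A m \<longleftrightarrow> (\<forall>x y. x < y \<longrightarrow> y < m \<longrightarrow> x div w = y div w \<longrightarrow> le (A x) (A y))"

lemma sorted_blocks_seg:
  assumes "sorted_blocks le w A m" "w dvd k" "h \<le> k + w" "h \<le> m" "w > 0"
  shows "sorted_seg le A k h"
proof -
  obtain c where c: "k = w * c" using assms(2) by auto
  have "x div w = c" if "k \<le> x" "x < h" for x
    using that assms(3,5) c by (intro div_nat_eqI) (auto simp: mult.commute)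
  then show ?thesis using assms(1,4) unfolding sorted_blocks_def sorted_seg_def
    by (metis (no_types, lifting) le_trans less_le_trans less_imp_le)
qed

text \<open>As \<open>k\<close> is a multiple of \<open>w\<close>, no block reaches across it; the
  old part and the new segment can be judged separately.\<close>

lemma sorted_blocks_extend:
  assumes "sorted_blocks le w A k" "sorted_seg le B k h" "w dvd k" "w > 0"
    and "\<And>x. x < k \<Longrightarrow> B x = A x"
  shows "sorted_blocks le w B h"
proof -
  obtain c where c: "k = w * c" using assms(3) by auto
  have lt: "x div w < c" if "x < k" for x using that c assms(4) by (simp add: div_less_iff_less_mult mult.commute)
  have ge: "c \<le> x div w" if "k \<le> x" for x
    using that c assms(4) by (metis div_le_mono nonzero_mult_div_cancel_left not_gr_zero)
  show ?thesis unfolding sorted_blocks_def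
  proof (intro allI impI)
    fix x y assume xy: "x < y" "y < h" "x div w = y div w"
    consider "y < k" | "k \<le> x" | "x < k" "k \<le> y" by linarith
    then show "le (B x) (B y)"
    proof cases
      case 1
      then show ?thesis using assms(1,5) xy by (auto simp: sorted_blocks_def)
    next
      case 2
      then show ?thesis using assms(2) xy by (auto simp: sorted_seg_def)
    next
      case 3
      then show ?thesis using lt ge xy by fastforce
    qed
  qed
qed

section \<open>Counting pairs\<close>

text \<open>Sums over lists, so that concatenation splits the count and sorting preserves
  it.\<close>

definition pair_count :: "('a \<Rightarrow> 'a \<Rightarrow> bool) \<Rightarrow> 'a list \<Rightarrow> 'a list \<Rightarrow> nat" where
  "pair_count P g h = (\<Sum>p\<leftarrow>g. \<Sum>q\<leftarrow>h. of_bool (P p q))"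

lemma pair_count_append:
  "pair_count P (g @ g') h = pair_count P g h + pair_count P g' h"
  "pair_count P g (h @ h') = pair_count P g h + pair_count P g h'"
  by (auto simp: pair_count_def sum_list_addf)

lemma pair_count_cong:
  "(\<And>p q. p \<in> set g \<Longrightarrow> q \<in> set h \<Longrightarrow> P p q = P' p q) \<Longrightarrow> pair_count P g h = pair_count P' g h"
  unfolding pair_count_def by (intro arg_cong[of _ _ sum_list] map_cong refl) simp

lemma pair_count_zero:
  "(\<And>p q. p \<in> set g \<Longrightarrow> q \<in> set h \<Longrightarrow> \<not> P p q) \<Longrightarrow> pair_count P g h = 0"
  using pair_count_cong[of g h P "\<lambda>_ _. False"] by (simp add: pair_count_def)

lemma sum_list_mset_eq:
  fixes f :: "'a \<Rightarrow> nat"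
  assumes "mset xs = mset ys"
  shows "(\<Sum>x\<leftarrow>xs. f x) = (\<Sum>x\<leftarrow>ys. f x)"
  by (metis assms mset_map sum_mset_sum_list)

lemma pair_count_mset:
  assumes "mset g = mset g'" "mset h = mset h'"
  shows "pair_count P g h = pair_count P g' h'"
  unfolding pair_count_def
  using sum_list_mset_eq[OF assms(1)] sum_list_mset_eq[OF assms(2)] by simp

lemma pair_count_filter_left:
  "(\<And>p q. P p q \<Longrightarrow> A p) \<Longrightarrow> pair_count P (filter A g) h = pair_count P g h"
proof (induction g)
  case (Cons x g)
  have "\<not> A x \<Longrightarrow> (\<Sum>q\<leftarrow>h. of_bool (P x q)) = (0::nat)"
    using Cons.prems[of x] by (auto intro!: sum_list_0 simp: sum_list_eq_0_iff)
  then show ?case using Cons by (auto simp: pair_count_def)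
qed (simp add: pair_count_def)

lemma pair_count_filter_right:
  "(\<And>p q. P p q \<Longrightarrow> A q) \<Longrightarrow> pair_count P g (filter A h) = pair_count P g h"
proof (induction h)
  case (Cons x h)
  have "\<not> A x \<Longrightarrow> (\<Sum>p\<leftarrow>g. of_bool (P p x)) = (0::nat)"
    using Cons.prems by (auto simp: sum_list_eq_0_iff)
  then show ?case using Cons by (auto simp: pair_count_def sum_list_addf)
qed (simp add: pair_count_def)

lemma pair_count_le: "pair_count P g h \<le> length g * length h"
proof (induction g)
  case (Cons a g)
  have "(\<Sum>q\<leftarrow>h. of_bool (P a q)) \<le> length h"
    by (induction h) auto
  then show ?case using Cons by (simp add: pair_count_def)
qed (simp add: pair_count_def)

lemma sum_list_map_upt: "(\<Sum>p\<leftarrow>map S [0..<m]. f p) = (\<Sum>x<m. f (S x :: 'a) :: 'b :: comm_monoid_add)"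
  by (induction m) (simp_all add: add.commute)

lemma pair_count_upt: "pair_count P (map S [0..<m]) (map S [0..<m]) = (\<Sum>x<m. \<Sum>y<m. of_bool (P (S x) (S y)))"
  by (simp only: pair_count_def sum_list_map_upt)

section \<open>Digit transforms\<close>

lemma sum_mult_split:
  "(\<Sum>y<q * n. f y) = (\<Sum>z<n. \<Sum>e<q. f (e + q * z :: nat) :: 'a :: comm_monoid_add)"
proof -
  have "(\<Sum>y<q * n. f y) = (\<Sum>z<n. sum f {z * q..<z * q + q})"
    by (simp add: sum.nat_group mult.commute)
  also have "\<dots> = (\<Sum>z<n. \<Sum>e<q. f (e + q * z))"
  proof (rule sum.cong[OF refl])
    fix z
    show "sum f {z * q..<z * q + q} = (\<Sum>e<q. f (e + q * z))"
      using sum.shift_bounds_nat_ivl[of f 0 "z * q" q] by (simp add: atLeast0LessThan ac_simps)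
  qed
  finally show ?thesis .
qed

text \<open>The base \<open>r\<close> digits of a number below \<open>r ^ L\<close> are the exponents of a monomial in \<open>L\<close> variables,
  and \<open>kern\<close> evaluates it at the points of the grid \<open>{0..<q} ^ L\<close>, which are read in base \<open>q\<close>.  With
  \<open>q = 2 * r - 1\<close> the digits of two such numbers can be added without carry in base \<open>q\<close>.\<close>

primrec rebase :: "nat \<Rightarrow> nat \<Rightarrow> nat \<Rightarrow> nat \<Rightarrow> nat" where
  "rebase b c 0 x = 0"
| "rebase b c (Suc L) x = x mod b + c * rebase b c L (x div b)"

primrec kern :: "(nat \<Rightarrow> nat \<Rightarrow> int) \<Rightarrow> nat \<Rightarrow> nat \<Rightarrow> nat \<Rightarrow> nat \<Rightarrow> int" where
  "kern A q 0 y j = 1"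
| "kern A q (Suc L) y j = A (y mod q) (j mod q) * kern A q L (y div q) (j div q)"

lemma rebase_less:
  assumes "0 < b" "b \<le> c"
  shows "rebase b c L x < c ^ L"
proof (induction L arbitrary: x)
  case (Suc L)
  have "x mod b < c" using assms by (meson less_le_trans mod_less_divisor)
  moreover have "c * (rebase b c L (x div b) + 1) \<le> c * c ^ L"
    using Suc[of "x div b"] by (intro mult_le_mono2) simp
  ultimately show ?case by (simp add: algebra_simps)
qed simp

text \<open>For the way back from base \<open>q\<close> to base \<open>r\<close>, where digits can
  exceed the new base and the result can exceed \<open>c ^ L\<close>. The summand \<open>b\<close>
  on the left makes the geometric sum go through the induction.\<close>

lemma rebase_bound:
  assumes "0 < b" "2 \<le> c"
  shows "rebase b c L x + b \<le> b * c ^ L"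
proof (induction L arbitrary: x)
  case (Suc L)
  have "x mod b + b \<le> 2 * b" using assms(1) by (simp add: less_imp_le)
  also have "\<dots> \<le> c * b" using assms(2) by simp
  finally have "x mod b + b \<le> c * b" .
  moreover have "c * (rebase b c L (x div b) + b) \<le> c * (b * c ^ L)"
    using Suc[of "x div b"] by (intro mult_le_mono2) simp
  moreover have "c * b \<le> c * (rebase b c L (x div b) + b)" by simp
  ultimately have "x mod b + c * rebase b c L (x div b) + b \<le> c * (b * c ^ L)"
    by (simp only: distrib_left)
  then show ?case by (simp add: algebra_simps)
qed simp

text \<open>A digit sum is at most \<open>2 * (r - 1) < q\<close>, so no carry arises and each claim
  reduces to single digits. The carries avoided here are performed in the second claim, when the
  digit sums are evaluated in base \<open>r\<close>.\<close>

lemma rebase_sum: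
  assumes "q = 2 * r - 1" "0 < r"
  shows "rebase r q L a + rebase r q L b < q ^ L"
    and "a < r ^ L \<Longrightarrow> b < r ^ L \<Longrightarrow> rebase q r L (rebase r q L a + rebase r q L b) = a + b"
    and "(\<And>y i j. A y (i + j) = A y i * A y j) \<Longrightarrow>
      kern A q L y (rebase r q L a) * kern A q L y (rebase r q L b) =
      kern A q L y (rebase r q L a + rebase r q L b)"
proof -
  have dig: "a mod r + b mod r < q" for a b
    using assms mod_less_divisor[of r a] mod_less_divisor[of r b] by linarith
  have q: "q > 0" using assms by simp
  have md: "(a mod r + q * x + (b mod r + q * y)) mod q = a mod r + b mod r"
       "(a mod r + q * x + (b mod r + q * y)) div q = x + y" for a b x y
  proof -
    have e: "a mod r + q * x + (b mod r + q * y) = (a mod r + b mod r) + q * (x + y)"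
      by (simp add: algebra_simps)
    show "(a mod r + q * x + (b mod r + q * y)) mod q = a mod r + b mod r"
       "(a mod r + q * x + (b mod r + q * y)) div q = x + y"
      unfolding e using dig[of a b] q by simp_all
  qed
  have md1: "(a mod r + q * x) mod q = a mod r" "(a mod r + q * x) div q = x" for a x
  proof -
    have "a mod r < q" using dig[of a b] by linarith
    then show "(a mod r + q * x) mod q = a mod r" "(a mod r + q * x) div q = x" using q by simp_all
  qed
  have md2: "a mod r mod q = a mod r" for a using md1(1)[of a 0] by simp
  show "rebase r q L a + rebase r q L b < q ^ L"
  proof (induction L arbitrary: a b)
    case (Suc L)
    have "q * (rebase r q L (a div r) + rebase r q L (b div r) + 1) \<le> q * q ^ L"
      using Suc[of "a div r" "b div r"] by (intro mult_le_mono2) simp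
    then show ?case using dig[of a b] by (simp add: algebra_simps)
  qed simp
  show "rebase q r L (rebase r q L a + rebase r q L b) = a + b" if "a < r ^ L" "b < r ^ L"
    using that
  proof (induction L arbitrary: a b)
    case (Suc L)
    have "a div r < r ^ L" "b div r < r ^ L"
      using Suc.prems by (auto simp: less_mult_imp_div_less mult.commute)
    from Suc.IH[OF this] show ?case
      by (simp add: md distrib_left)
  qed simp
  show "kern A q L y (rebase r q L a) * kern A q L y (rebase r q L b) =
      kern A q L y (rebase r q L a + rebase r q L b)"
    if "\<And>y i j. A y (i + j) = A y i * A y j"
  proof (induction L arbitrary: a b y)
    case (Suc L)
    show ?case
      by (simp add: md md1 md2 that Suc[symmetric])
  qed simp
qed

text \<open>\<open>kern A q L\<close> is the \<open>L\<close>-fold Kronecker power of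
  \<open>A\<close>. Kronecker powers multiply factor by factor, so a one-digit inverse with
  denominator \<open>D\<close> gives one with denominator \<open>D ^ L\<close>.\<close>

lemma kern_inverse:
  assumes inv: "\<And>g e. g < q \<Longrightarrow> e < q \<Longrightarrow> (\<Sum>y<q. B g y * A y e) = (if g = e then D else 0)"
    and "0 < q"
  shows "g < q ^ L \<Longrightarrow> j < q ^ L \<Longrightarrow>
    (\<Sum>y<q ^ L. kern B q L g y * kern A q L y j) = (if g = j then D ^ L else 0)"
proof (induction L arbitrary: g j)
  case (Suc L)
  have lt: "g div q < q ^ L" "j div q < q ^ L"
    using Suc.prems by (auto simp: less_mult_imp_div_less mult.commute)
  have "(\<Sum>y<q ^ Suc L. kern B q (Suc L) g y * kern A q (Suc L) y j) =
    (\<Sum>z<q ^ L. \<Sum>e<q. (B (g mod q) e * A e (j mod q)) *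
       (kern B q L (g div q) z * kern A q L z (j div q)))"
    unfolding power_Suc sum_mult_split using \<open>0 < q\<close>
    by (intro sum.cong refl) (simp add: ac_simps)
  also have "\<dots> = (\<Sum>e<q. B (g mod q) e * A e (j mod q)) *
       (\<Sum>z<q ^ L. kern B q L (g div q) z * kern A q L z (j div q))"
    by (subst sum.swap) (simp add: sum_product)
  also have "\<dots> = (if g mod q = j mod q then D else 0) * (if g div q = j div q then D ^ L else 0)"
    using inv[of "g mod q" "j mod q"] Suc.IH[OF lt] \<open>0 < q\<close> by simp
  also have "\<dots> = (if g = j then D ^ Suc L else 0)"
  proof -
    have "g = j \<longleftrightarrow> g mod q = j mod q \<and> g div q = j div q" by (metis div_mult_mod_eq)
    then show ?thesis by simp
  qed
  finally show ?case .
qed simp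

text \<open>Multiplication by the matrix \<open>A\<close> along the axis whose digit has weight
  \<open>s\<close>; the argument of \<open>a\<close> is \<open>j\<close> with that digit replaced by
  \<open>e\<close>. The subtraction does not truncate, as the digit contributes at most
  \<open>j\<close>.\<close>

definition tstep :: "(nat \<Rightarrow> nat \<Rightarrow> int) \<Rightarrow> nat \<Rightarrow> nat \<Rightarrow> (nat \<Rightarrow> int) \<Rightarrow> nat \<Rightarrow> int" where
  "tstep A q s a j = (\<Sum>e<q. A ((j div s) mod q) e * a (j - ((j div s) mod q) * s + e * s))"

text \<open>One axis at a time costs \<open>q\<close> per entry and axis, against
  \<open>q ^ L\<close> per entry for the full kernel.\<close>

primrec axes :: "(nat \<Rightarrow> nat \<Rightarrow> int) \<Rightarrow> nat \<Rightarrow> nat \<Rightarrow> (nat \<Rightarrow> int) \<Rightarrow> nat \<Rightarrow> int" where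
  "axes A q 0 a = a"
| "axes A q (Suc t) a = tstep A q (q ^ t) (axes A q t a)"

text \<open>\<open>kern\<close> is defined by splitting off the lowest digit, whereas the passes of
  \<open>axes\<close> end with the highest; this factorisation at the top connects them.\<close>

lemma kern_top:
  assumes "y < q ^ t" "l < q ^ t" "u < q" "e < q"
  shows "kern A q (Suc t) (y + q ^ t * u) (l + q ^ t * e) = kern A q t y l * A u e"
  using assms
proof (induction t arbitrary: y l)
  case (Suc t)
  have q: "q > 0" using assms by simp
  have lt: "y div q < q ^ t" "l div q < q ^ t"
    using Suc.prems by (auto simp: less_mult_imp_div_less mult.commute)
  have md: "(y + q ^ Suc t * u) mod q = y mod q" "(y + q ^ Suc t * u) div q = y div q + q ^ t * u" for y u
    using q by (auto simp: mult.assoc)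
  have "kern A q (Suc (Suc t)) (y + q ^ Suc t * u) (l + q ^ Suc t * e) =
     A (y mod q) (l mod q) * kern A q (Suc t) (y div q + q ^ t * u) (l div q + q ^ t * e)"
    by (subst kern.simps(2)) (simp only: md)
  also have "\<dots> = A (y mod q) (l mod q) * (kern A q t (y div q) (l div q) * A u e)"
    using Suc.IH[OF lt Suc.prems(3,4)] by simp
  finally show ?case by (simp add: mult.assoc)
qed simp

text \<open>After \<open>t\<close> passes the \<open>t\<close> lowest digits are fully transformed
  while the higher ones, \<open>hi\<close>, are mere parameters. Without \<open>hi\<close> the
  induction hypothesis would not apply to the fibres that the next pass combines.\<close>

lemma axes_eq:
  assumes "0 < q" "lo < q ^ t"
  shows "axes A q t a (lo + q ^ t * hi) = (\<Sum>l<q ^ t. kern A q t lo l * a (l + q ^ t * hi))"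
  using assms(2)
proof (induction t arbitrary: lo hi)
  case (Suc t)
  define y where "y = lo div q ^ t"
  define l0 where "l0 = lo mod q ^ t"
  have qt: "q ^ t > 0" using assms(1) by simp
  have y: "y < q" using Suc.prems by (simp add: y_def less_mult_imp_div_less)
  have l0: "l0 < q ^ t" using qt by (simp add: l0_def)
  have lo: "lo = l0 + q ^ t * y" by (simp add: y_def l0_def)
  define j where "j = lo + q ^ Suc t * hi"
  have j: "j = l0 + q ^ t * (y + q * hi)" by (simp add: j_def lo algebra_simps)
  have dj: "(j div q ^ t) mod q = y" using l0 y qt by (simp add: j)
  have bj: "j - y * q ^ t + e * q ^ t = l0 + q ^ t * (e + q * hi)" for e
    by (simp add: j algebra_simps)
  have "axes A q (Suc t) a j = (\<Sum>e<q. A y e * axes A q t a (l0 + q ^ t * (e + q * hi)))"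
    by (simp add: tstep_def dj bj)
  also have "\<dots> = (\<Sum>e<q. \<Sum>l<q ^ t. kern A q (Suc t) lo (l + q ^ t * e) * a (l + q ^ t * (e + q * hi)))"
  proof (rule sum.cong[OF refl])
    fix e assume "e \<in> {..<q}"
    then have "kern A q (Suc t) lo (l + q ^ t * e) = kern A q t l0 l * A y e" if "l < q ^ t" for l
      unfolding lo using kern_top[OF l0 that y] by simp
    then show "A y e * axes A q t a (l0 + q ^ t * (e + q * hi)) =
      (\<Sum>l<q ^ t. kern A q (Suc t) lo (l + q ^ t * e) * a (l + q ^ t * (e + q * hi)))"
      unfolding Suc.IH[OF l0] sum_distrib_left by (intro sum.cong refl) (simp del: kern.simps)
  qed
  also have "\<dots> = (\<Sum>l<q ^ t * q. kern A q (Suc t) lo l * a (l + q ^ Suc t * hi))"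
    unfolding sum_mult_split by (intro sum.cong refl) (simp add: algebra_simps)
  finally show ?case by (simp add: j_def mult.commute)
qed simp

corollary axes_full:
  "0 < q \<Longrightarrow> y < q ^ L \<Longrightarrow> axes A q L a y = (\<Sum>l<q ^ L. kern A q L y l * a l)"
  using axes_eq[of q y L A a 0] by simp

text \<open>At a fixed grid point the transform of a histogram is the sum of the monomial values of
  its members. The product of two such sums runs over pairs, each contributing the value at its
  digitwise sum, and \<open>kern_inverse\<close> retains the pairs with sum
  \<open>j\<close>.\<close>

lemma convolution:
  fixes f g :: "nat \<Rightarrow> nat" and P R :: "nat \<Rightarrow> bool"
  assumes inv: "\<And>i e. i < q \<Longrightarrow> e < q \<Longrightarrow> (\<Sum>y<q. B i y * A y e) = (if i = e then D else 0)"
    and mult: "\<And>y i j. A y (i + j) = A y i * A y j"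
    and q: "q = 2 * r - 1" "0 < r" and j: "j < q ^ L"
  defines "\<phi> \<equiv> rebase r q L"
  shows "axes B q L (\<lambda>y. axes A q L (\<lambda>l. \<Sum>x<m. of_bool (P x \<and> \<phi> (f x) = l)) y *
                        axes A q L (\<lambda>l. \<Sum>x<m. of_bool (R x \<and> \<phi> (f x) = l)) y) j =
     D ^ L * (\<Sum>x<m. \<Sum>z<m. of_bool (P x \<and> R z \<and> \<phi> (f x) + \<phi> (f z) = j))"
proof -
  have q0: "q > 0" using q by simp
  have less: "\<phi> x < q ^ L" for x
    using rebase_less[of r q L x] q by (simp add: \<phi>_def)
  have ax: "axes A q L (\<lambda>l. \<Sum>x<m. of_bool (P x \<and> \<phi> (f x) = l)) y =
     (\<Sum>x<m. of_bool (P x) * kern A q L y (\<phi> (f x)))" if "y < q ^ L" for y P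
  proof -
    have "axes A q L (\<lambda>l. \<Sum>x<m. of_bool (P x \<and> \<phi> (f x) = l)) y =
      (\<Sum>x<m. \<Sum>l<q ^ L. kern A q L y l * of_bool (P x \<and> \<phi> (f x) = l))"
      unfolding axes_full[OF q0 that] sum_distrib_left by (rule sum.swap)
    also have "\<dots> = (\<Sum>x<m. of_bool (P x) * kern A q L y (\<phi> (f x)))"
    proof (intro sum.cong refl)
      fix x
      have "(\<Sum>l<q ^ L. kern A q L y l * of_bool (P x \<and> \<phi> (f x) = l)) =
         (\<Sum>l<q ^ L. if \<phi> (f x) = l then of_bool (P x) * kern A q L y l else 0)"
        by (intro sum.cong refl) auto
      also have "\<dots> = of_bool (P x) * kern A q L y (\<phi> (f x))"
        using less[of "f x"] by (simp add: sum.delta')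
      finally show "(\<Sum>l<q ^ L. kern A q L y l * of_bool (P x \<and> \<phi> (f x) = l)) =
         of_bool (P x) * kern A q L y (\<phi> (f x))" .
    qed
    finally show ?thesis .
  qed
  have prod: "axes A q L (\<lambda>l. \<Sum>x<m. of_bool (P x \<and> \<phi> (f x) = l)) y *
              axes A q L (\<lambda>l. \<Sum>x<m. of_bool (R x \<and> \<phi> (f x) = l)) y =
      (\<Sum>x<m. \<Sum>z<m. of_bool (P x \<and> R z) * kern A q L y (\<phi> (f x) + \<phi> (f z)))" if "y < q ^ L" for y
    unfolding ax[OF that] sum_product
    by (intro sum.cong refl) (auto simp: rebase_sum(3)[OF q mult, symmetric] \<phi>_def)
  have "axes B q L (\<lambda>y. axes A q L (\<lambda>l. \<Sum>x<m. of_bool (P x \<and> \<phi> (f x) = l)) y *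
                        axes A q L (\<lambda>l. \<Sum>x<m. of_bool (R x \<and> \<phi> (f x) = l)) y) j =
     (\<Sum>y<q ^ L. \<Sum>x<m. \<Sum>z<m. of_bool (P x \<and> R z) * (kern B q L j y * kern A q L y (\<phi> (f x) + \<phi> (f z))))"
    unfolding axes_full[OF q0 j]
    by (rule sum.cong[OF refl], simp only: lessThan_iff prod sum_distrib_left, intro sum.cong refl)
      (simp add: ac_simps)
  also have "\<dots> = (\<Sum>x<m. \<Sum>y<q ^ L. \<Sum>z<m. of_bool (P x \<and> R z) * (kern B q L j y * kern A q L y (\<phi> (f x) + \<phi> (f z))))"
    by (rule sum.swap)
  also have "\<dots> = (\<Sum>x<m. \<Sum>z<m. \<Sum>y<q ^ L. of_bool (P x \<and> R z) * (kern B q L j y * kern A q L y (\<phi> (f x) + \<phi> (f z))))"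
    by (intro sum.cong refl sum.swap)
  also have "\<dots> = (\<Sum>x<m. \<Sum>z<m. of_bool (P x \<and> R z) * (if j = \<phi> (f x) + \<phi> (f z) then D ^ L else 0))"
  proof (intro sum.cong refl)
    fix x z
    have "\<phi> (f x) + \<phi> (f z) < q ^ L" using rebase_sum(1)[OF q] by (simp add: \<phi>_def)
    from kern_inverse[of q B A D, OF inv q0 j this]
    show "(\<Sum>y<q ^ L. of_bool (P x \<and> R z) * (kern B q L j y * kern A q L y (\<phi> (f x) + \<phi> (f z)))) =
      of_bool (P x \<and> R z) * (if j = \<phi> (f x) + \<phi> (f z) then D ^ L else 0)"
      by (simp add: sum_distrib_left[symmetric])
  qed
  also have "\<dots> = D ^ L * (\<Sum>x<m. \<Sum>z<m. of_bool (P x \<and> R z \<and> \<phi> (f x) + \<phi> (f z) = j))"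
    unfolding sum_distrib_left by (intro sum.cong refl) auto
  finally show ?thesis .
qed

text \<open>The entries read by \<open>tstep\<close> stay inside the grid, and the subtraction in
  its index is exact; the program needs both to pass its checks.\<close>

lemma digit_replace:
  assumes "j < q ^ L" "t < L" "e < (q :: nat)"
  shows "((j div q ^ t) mod q) * q ^ t \<le> j" "j - ((j div q ^ t) mod q) * q ^ t + e * q ^ t < q ^ L"
proof -
  let ?y = "(j div q ^ t) mod q"
  have q: "q > 0" using assms by simp
  define h where "h = j div q ^ t div q"
  define y where "y = ?y"
  have j: "j = j mod q ^ t + q ^ t * (y + q * h)"
    unfolding y_def h_def by (metis mod_mult_div_eq)
  have yq: "y * q ^ t \<le> q ^ t * (y + q * h)" by (simp add: algebra_simps)
  then show le: "?y * q ^ t \<le> j"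
    unfolding y_def[symmetric] using j by linarith
  have "j - y * q ^ t = j mod q ^ t + q ^ t * q * h"
    using j yq by (simp add: algebra_simps)
  then have 1: "j - ?y * q ^ t + e * q ^ t = j mod q ^ t + q ^ t * (e + q * (j div q ^ t div q))"
    unfolding y_def h_def by (simp add: algebra_simps)
  obtain u where u: "L = Suc (t + u)" using assms(2) less_iff_Suc_add by blast
  have "j < q ^ t * q * q ^ u" using assms(1) by (simp add: u power_add mult.commute mult.left_commute)
  then have "j div q ^ t div q < q ^ u"
    by (metis div_mult2_eq less_mult_imp_div_less mult.commute)
  then have "e + q * (j div q ^ t div q) + 1 \<le> q * q ^ u"
    using assms(3) mult_le_mono2[of "Suc (j div q ^ t div q)" "q ^ u" q] by simp
  then have "q ^ t * (e + q * (j div q ^ t div q) + 1) \<le> q ^ t * (q * q ^ u)"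
    by (rule mult_le_mono2)
  moreover have "j mod q ^ t < q ^ t" using q by simp
  ultimately show "j - ?y * q ^ t + e * q ^ t < q ^ L"
    unfolding 1 u by (simp add: power_add algebra_simps)
qed

text \<open>Lagrange interpolation at \<open>0, ..., q - 1\<close>. \<open>P y\<close> is the
  unnormalised basis polynomial and \<open>N y\<close> its value at \<open>y\<close>.
  \<open>D\<close> is a common multiple of the \<open>N y\<close>, with squares to be positive, and
  \<open>C y = D / N y\<close> keeps all entries integral.\<close>

lemma vandermonde_inverse:
  fixes q :: nat
  shows "\<exists>(D :: nat) B. 0 < D \<and>
    (\<forall>g<q. \<forall>e<q. (\<Sum>y<q. B g y * int y ^ e) = (if g = e then int D else 0))"
proof -
  define P :: "nat \<Rightarrow> int poly" where "P y = (\<Prod>z\<in>{..<q} - {y}. [:- int z, 1:])" for y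
  define N :: "nat \<Rightarrow> int" where "N y = poly (P y) (int y)" for y
  define D where "D = (\<Prod>y<q. (N y)\<^sup>2)"
  define C where "C y = N y * (\<Prod>z\<in>{..<q} - {y}. (N z)\<^sup>2)" for y
  have N0: "N y \<noteq> 0" for y
    by (auto simp: N_def P_def poly_prod)
  have D0: "D > 0" using N0 by (auto simp: D_def intro!: prod_pos)
  have CN: "C y * N y = D" if "y < q" for y
    using that prod.remove[of "{..<q}" y "\<lambda>z. (N z)\<^sup>2"] by (simp add: C_def D_def power2_eq_square ac_simps)
  have Pz: "poly (P y) (int z) = (if z = y then N y else 0)" if "z < q" for y z
    using that by (auto simp: N_def P_def poly_prod)
  have degP: "degree (P y) < q" if "y < q" for y
  proof -
    have "degree (P y) \<le> (\<Sum>z\<in>{..<q} - {y}. degree [:- int z, 1:])"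
      unfolding P_def using degree_prod_sum_le[of "{..<q} - {y}" "\<lambda>z. [:- int z, 1:]"] by (simp add: o_def)
    also have "\<dots> = q - 1" using that by simp
    finally show ?thesis using that by simp
  qed
  \<comment> \<open>Both sides have degree below \<open>q\<close> and agree at \<open>q\<close>
    points. Their coefficients at \<open>g\<close> are the two sides of the matrix identity.\<close>
  have eq: "(\<Sum>y<q. smult (int y ^ e * C y) (P y)) = monom D e" if e: "e < q" for e
  proof (rule ccontr)
    define H where "H = (\<Sum>y<q. smult (int y ^ e * C y) (P y)) - monom D e"
    assume "\<not> ?thesis"
    then have H0: "H \<noteq> 0" by (simp add: H_def)
    have "poly H (int z) = 0" if "z < q" for z
    proof -
      have "poly H (int z) = (\<Sum>y<q. if y = z then int z ^ e * (C z * N z) else 0) - D * int z ^ e"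
        unfolding H_def poly_diff poly_sum poly_monom
        by (intro arg_cong2[of _ _ _ _ "(-)"] sum.cong refl) (use that in \<open>auto simp: Pz\<close>)
      then show ?thesis using that CN[OF that] by simp
    qed
    then have "int ` {..<q} \<subseteq> {x. poly H x = 0}" by auto
    then have "q \<le> card {x. poly H x = 0}"
      using card_mono[OF poly_roots_finite[OF H0], of "int ` {..<q}"] by (simp add: card_image)
    also have "\<dots> \<le> degree H" using card_poly_roots_bound[OF H0] .
    also have "degree H < q"
      unfolding H_def
    proof (rule degree_diff_less)
      show "degree (\<Sum>y<q. smult (int y ^ e * C y) (P y)) < q"
        using degP e by (intro degree_sum_less) (auto intro: le_less_trans[OF degree_smult_le])
      show "degree (monom D e) < q"
        using degree_monom_le[of D e] e by linarith
    qed
    finally show False by simp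
  qed
  show ?thesis
  proof (rule exI[of _ "nat D"], rule exI[of _ "\<lambda>g y. C y * coeff (P y) g"], intro conjI allI impI)
    fix g e assume "g < q" "e < q"
    have "(\<Sum>y<q. C y * coeff (P y) g * int y ^ e) = coeff (\<Sum>y<q. smult (int y ^ e * C y) (P y)) g"
      by (simp add: coeff_sum ac_simps)
    also have "\<dots> = (if g = e then int (nat D) else 0)"
      using eq[OF \<open>e < q\<close>] D0 by simp
    finally show "(\<Sum>y<q. C y * coeff (P y) g * int y ^ e) = (if g = e then int (nat D) else 0)" .
  qed (use D0 in simp)
qed

section \<open>Weakest preconditions\<close>

context ram
begin

text \<open>As \<open>big\<close> has no run past a failed check, the existence of a run entails
  termination and the absence of overflow.\<close>

definition wp :: "com \<Rightarrow> (nat \<Rightarrow> st \<Rightarrow> bool) \<Rightarrow> st \<Rightarrow> bool" where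
  "wp c Q s \<longleftrightarrow> (\<exists>t s'. big c s t s' \<and> Q t s')"

lemma wp_Skip [simp]: "wp Skip Q s = Q 0 s"
  unfolding wp_def by (auto elim: SkipE intro: big.intros)

lemma wp_Assign [simp]: "wp (Assign x e) Q s = (chk e s \<and> Q 1 (set_var s x (ev e s)))"
  unfolding wp_def by (auto elim!: AssignE intro: big.Assign[simplified])

lemma wp_Store [simp]: "wp (Store a e f) Q s = (chk e s \<and> chk f s \<and> ev e s < M \<and>
    Q 1 (s\<lparr>ar := (ar s)(a := (ar s a)(ev e s := ev f s))\<rparr>))"
  unfolding wp_def by (auto elim!: StoreE intro: big.Store[simplified])

lemma wp_Out [simp]: "wp (Out e f) Q s = (chk e s \<and> chk f s \<and> ev e s < base \<and>
    Q 1 (s\<lparr>rw := (rw s)(ev e s := ev f s)\<rparr>))"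
  unfolding wp_def by (auto elim!: OutE intro: big.Out[simplified])

lemma wp_Seq [simp]: "wp (Seq c1 c2) Q s = wp c1 (\<lambda>t s'. wp c2 (\<lambda>t' s''. Q (t + t') s'') s') s"
proof
  assume "wp (Seq c1 c2) Q s"
  then show "wp c1 (\<lambda>t s'. wp c2 (\<lambda>t' s''. Q (t + t') s'') s') s"
    unfolding wp_def by (fast elim: SeqE)
next
  assume "wp c1 (\<lambda>t s'. wp c2 (\<lambda>t' s''. Q (t + t') s'') s') s"
  then show "wp (Seq c1 c2) Q s"
    unfolding wp_def by (fast intro: big.Seq)
qed

lemma wp_If [simp]: "wp (IfLess e f c1 c2) Q s = (chk e s \<and> chk f s \<and>
    (if ev e s < ev f s then wp c1 (\<lambda>t. Q (Suc t)) s else wp c2 (\<lambda>t. Q (Suc t)) s))"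
  (is "?l = ?r")
proof
  show "?l \<Longrightarrow> ?r" unfolding wp_def by (auto elim!: IfE)
  show "?r \<Longrightarrow> ?l" unfolding wp_def by (auto split: if_splits intro: big.IfT big.IfF)
qed

lemma wp_Real [simp]: "wp (IfReal e f c1 c2) Q s = (chk e s \<and> chk f s \<and>
    (if X (ev e s) < X (ev f s) then wp c1 (\<lambda>t. Q (Suc t)) s else wp c2 (\<lambda>t. Q (Suc t)) s))"
  (is "?l = ?r")
proof
  show "?l \<Longrightarrow> ?r" unfolding wp_def by (auto elim!: RealE)
  show "?r \<Longrightarrow> ?l" unfolding wp_def by (auto split: if_splits intro: big.RealT big.RealF)
qed

lemma wp_mono:
  assumes "wp c R s" "\<And>t s'. unchanged c s s' \<Longrightarrow> R t s' \<Longrightarrow> Q t s'"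
  shows "wp c Q s"
  using assms big_unchanged unfolding wp_def by blast

text \<open>The potential belongs to a ghost value rather than to the state, because the main loop
  is measured by a list of tasks that the state only encodes. It may be real, since every round
  lowers it by at least 1.\<close>

lemma wp_while:
  fixes pot :: "'g \<Rightarrow> real"
  assumes init: "I g0 s0"
    and pos: "\<And>g s. I g s \<Longrightarrow> 0 \<le> pot g"
    and step: "\<And>g s. I g s \<Longrightarrow> unchanged c s0 s \<Longrightarrow> chk e s \<and> chk f s \<and>
      (ev e s < ev f s \<longrightarrow> wp c (\<lambda>t s'. \<exists>g'. I g' s' \<and> real t + 1 + pot g' \<le> pot g) s)"
  shows "wp (While e f c) (\<lambda>t s'. real t \<le> pot g0 + 1 \<and> (\<exists>g. I g s') \<and> \<not> ev e s' < ev f s') s0"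
proof -
  have "wp (While e f c) (\<lambda>t s'. real t \<le> pot g + 1 \<and> (\<exists>g. I g s') \<and> \<not> ev e s' < ev f s') s"
    if "I g s" "unchanged c s0 s" "pot g < real n" for n g s
    using that
  proof (induction n arbitrary: g s)
    case 0
    then show ?case using pos by force
  next
    case (Suc n)
    have ch: "chk e s" "chk f s" using step[OF Suc.prems(1,2)] by auto
    show ?case
    proof (cases "ev e s < ev f s")
      case False
      then show ?thesis
        unfolding wp_def using big.WhileF[OF ch False] Suc.prems(1) pos[of g s] by fastforce
    next
      case True
      then obtain t s' g' where b: "big c s t s'" and g': "I g' s'" "real t + 1 + pot g' \<le> pot g"
        using step[OF Suc.prems(1,2)] unfolding wp_def by blast
      have "unchanged c s0 s'" using unchanged_trans[OF Suc.prems(2) big_unchanged[OF b]] .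
      moreover have "pot g' < real n" using g'(2) Suc.prems(3) by simp
      ultimately obtain t' s'' where "big (While e f c) s' t' s''" "real t' \<le> pot g' + 1"
        "\<exists>g. I g s''" "\<not> ev e s'' < ev f s''"
        using Suc.IH[OF g'(1)] unfolding wp_def by blast
      then show ?thesis
        unfolding wp_def using big.WhileT[OF ch True b] g'(2)
        by (intro exI[of _ "Suc (t + t')"] exI[of _ s'']) auto
    qed
  qed
  then show ?thesis
    using init unchanged_refl reals_Archimedean2 by blast
qed

lemma wp_while_measure:
  fixes m :: "st \<Rightarrow> nat"
  assumes init: "I s0"
    and step: "\<And>s. I s \<Longrightarrow> unchanged c s0 s \<Longrightarrow> chk e s \<and> chk f s \<and>
      (ev e s < ev f s \<longrightarrow> wp c (\<lambda>t s'. I s' \<and> t + 1 + m s' \<le> m s) s)"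
  shows "wp (While e f c) (\<lambda>t s'. t \<le> m s0 + 1 \<and> I s' \<and> \<not> ev e s' < ev f s') s0"
proof -
  have "wp (While e f c) (\<lambda>t s'. real t \<le> real (m s0) + 1 \<and> (\<exists>g. g = s' \<and> I s') \<and> \<not> ev e s' < ev f s') s0"
  proof (rule wp_while[where I = "\<lambda>g s. g = s \<and> I s" and pot = "\<lambda>s. real (m s)"])
    fix g s assume "g = s \<and> I s" "unchanged c s0 s"
    then have st: "chk e s \<and> chk f s \<and> (ev e s < ev f s \<longrightarrow> wp c (\<lambda>t s'. I s' \<and> t + 1 + m s' \<le> m s) s)" "g = s"
      using step by auto
    show "chk e s \<and> chk f s \<and> (ev e s < ev f s \<longrightarrow>
       wp c (\<lambda>t s'. \<exists>g'. (g' = s' \<and> I s') \<and> real t + 1 + real (m g') \<le> real (m g)) s)"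
    proof (intro conjI impI)
      assume "ev e s < ev f s"
      with st have "wp c (\<lambda>t s'. I s' \<and> t + 1 + m s' \<le> m s) s" by blast
      then show "wp c (\<lambda>t s'. \<exists>g'. (g' = s' \<and> I s') \<and> real t + 1 + real (m g') \<le> real (m g)) s"
        by (rule wp_mono) (use st(2) in auto)
    qed (use st in auto)
  qed (use init in auto)
  then show ?thesis by (rule wp_mono) auto
qed

end

definition For :: "var \<Rightarrow> exp \<Rightarrow> com \<Rightarrow> com" where
  "For i e c = (i ::= Num 0 ;; While (Var i) e (c ;; i ::= Var i \<oplus> Num 1))"

lemma writes_For [simp]:
  "writes_var (For i e c) x = (x = i \<or> writes_var c x)"
  "writes_arr (For i e c) a = writes_arr c a"
  "writes_raw (For i e c) = writes_raw c"
  by (auto simp: For_def)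

text \<open>The body establishes the invariant for the state after the increment, so the increment
  needs no separate treatment. Each round pays 2 for test and increment, the whole loop 2 for the
  initialisation and the failing test.\<close>

lemma (in ram) wp_for:
  assumes lim: "\<And>s. unchanged (For i e c) s0 s \<Longrightarrow> chk e s \<and> ev e s = N"
    and N: "N < M"
    and init: "I 0 (set_var s0 i 0)"
    and body: "\<And>k s. k < N \<Longrightarrow> I k s \<Longrightarrow> unchanged (For i e c) s0 s \<Longrightarrow> vs s i = k \<Longrightarrow>
      wp c (\<lambda>t s'. t \<le> T \<and> I (Suc k) (set_var s' i (Suc k))) s"
    and i: "\<not> writes_var c i"
  shows "wp (For i e c) (\<lambda>t s'. t \<le> N * (T + 2) + 2 \<and> I N s' \<and> vs s' i = N) s0"
proof -
  let ?s = "set_var s0 i 0"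
  have un: "unchanged (For i e c) s0 s" if "unchanged (c ;; i ::= Var i \<oplus> Num 1) ?s s" for s
    using that unfolding unchanged_def by auto
  have "wp (While (Var i) e (c ;; i ::= Var i \<oplus> Num 1))
     (\<lambda>t s'. t \<le> (N - vs ?s i) * (T + 2) + 1 \<and> (I (vs s' i) s' \<and> vs s' i \<le> N) \<and> \<not> ev (Var i) s' < ev e s') ?s"
  proof (rule wp_while_measure[where m = "\<lambda>s. (N - vs s i) * (T + 2)"])
    show "I (vs ?s i) ?s \<and> vs ?s i \<le> N" using init by simp
    fix s assume s: "I (vs s i) s \<and> vs s i \<le> N" "unchanged (c ;; i ::= Var i \<oplus> Num 1) ?s s"
    have e: "chk e s" "ev e s = N" using lim un[OF s(2)] by auto
    show "chk (Var i) s \<and> chk e s \<and> (ev (Var i) s < ev e s \<longrightarrow>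
       wp (c ;; i ::= Var i \<oplus> Num 1) (\<lambda>t s'. (I (vs s' i) s' \<and> vs s' i \<le> N) \<and>
          t + 1 + (N - vs s' i) * (T + 2) \<le> (N - vs s i) * (T + 2)) s)"
    proof (intro conjI impI)
      assume lt: "ev (Var i) s < ev e s"
      then have k: "vs s i < N" using e by simp
      then obtain u where u: "N = Suc (vs s i + u)" using less_iff_Suc_add by blast
      show "wp (c ;; i ::= Var i \<oplus> Num 1) (\<lambda>t s'. (I (vs s' i) s' \<and> vs s' i \<le> N) \<and>
          t + 1 + (N - vs s' i) * (T + 2) \<le> (N - vs s i) * (T + 2)) s"
        unfolding wp_Seq
      proof (rule wp_mono[OF body[OF k]])
        fix t s' assume s': "unchanged c s s'" "t \<le> T \<and> I (Suc (vs s i)) (set_var s' i (Suc (vs s i)))"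
        have "vs s' i = vs s i" using unchanged_var[OF s'(1) i] .
        then show "wp (i ::= Var i \<oplus> Num 1) (\<lambda>t' s''. (I (vs s'' i) s'' \<and> vs s'' i \<le> N) \<and>
          t + t' + 1 + (N - vs s'' i) * (T + 2) \<le> (N - vs s i) * (T + 2)) s'"
          using k N s'(2) by (auto simp: u)
      qed (use s un in auto)
    qed (use e in auto)
  qed
  then have "wp (While (Var i) e (c ;; i ::= Var i \<oplus> Num 1))
     (\<lambda>t s'. Suc t \<le> N * (T + 2) + 2 \<and> I N s' \<and> vs s' i = N) ?s"
  proof (rule wp_mono)
    fix t s'
    assume u: "unchanged (While (Var i) e (c ;; i ::= Var i \<oplus> Num 1)) ?s s'"
      and h: "t \<le> (N - vs ?s i) * (T + 2) + 1 \<and> (I (vs s' i) s' \<and> vs s' i \<le> N) \<and> \<not> ev (Var i) s' < ev e s'"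
    have "unchanged (c ;; i ::= Var i \<oplus> Num 1) ?s s'" using u by (simp add: unchanged_def)
    then have "ev e s' = N" using lim un by blast
    then have "vs s' i = N" using h by simp
    then show "Suc t \<le> N * (T + 2) + 2 \<and> I N s' \<and> vs s' i = N" using h by auto
  qed
  then show ?thesis
    unfolding For_def using N by simp
qed

section \<open>Sorting\<close>

abbreviation coord :: "exp \<Rightarrow> exp" where
  "coord e \<equiv> e \<otimes> Var Dim \<oplus> Var CurI"

text \<open>\<open>Fl = 1\<close> takes the head of the right run. Only strict comparisons of
  coordinates are available, so equality shows as two failed ones; in that case the right head goes
  first exactly when it is blue and the left one red.\<close>

definition merge_step :: com where
  "merge_step =
     (Fl ::= Num 1 ;;
      IfLess (Var LA) (Var Mid)
        (Fl ::= Num 0 ;;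
         IfLess (Var LB) (Var Hi)
           (IfReal (coord (Arr AS (Var LB))) (coord (Arr AS (Var LA))) (Fl ::= Num 1)
             (IfReal (coord (Arr AS (Var LA))) (coord (Arr AS (Var LB))) Skip
               (IfLess (Arr AS (Var LA)) (Var Reds)
                 (IfLess (Arr AS (Var LB)) (Var Reds) Skip (Fl ::= Num 1)) Skip)))
           Skip)
        Skip ;;
      IfLess (Var Fl) (Num 1)
        (AT[Var K] ::= Arr AS (Var LA) ;; LA ::= Var LA \<oplus> Num 1)
        (AT[Var K] ::= Arr AS (Var LB) ;; LB ::= Var LB \<oplus> Num 1) ;;
      K ::= Var K \<oplus> Num 1)"

definition merge_block :: com where
  "merge_block =
     (LA ::= Var K ;;
      Mid ::= Var K \<oplus> Var Wd ;; IfLess (Var CurM) (Var Mid) (Mid ::= Var CurM) Skip ;;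
      LB ::= Var Mid ;;
      Hi ::= Var Mid \<oplus> Var Wd ;; IfLess (Var CurM) (Var Hi) (Hi ::= Var CurM) Skip ;;
      While (Var K) (Var Hi) merge_step)"

text \<open>Bottom-up merge sort, as there is no recursion: \<open>Wd\<close> is the length of the
  sorted blocks, and each pass merges neighbours into \<open>AT\<close> and copies the result
  back.\<close>

definition sort :: com where
  "sort =
     (Wd ::= Num 1 ;;
      While (Var Wd) (Var CurM)
        (K ::= Num 0 ;;
         While (Var K) (Var CurM) merge_block ;;
         For J (Var CurM) (AS[Var J] ::= Arr AT (Var J)) ;;
         Wd ::= Var Wd \<oplus> Var Wd))"

lemma writes_merge_step [simp]:
  "writes_var merge_step x \<longleftrightarrow> x \<in> {Fl, LA, LB, K}"
  "writes_arr merge_step a \<longleftrightarrow> a = AT" "\<not> writes_raw merge_step"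
  by (auto simp: merge_step_def)

lemma writes_merge_block [simp]:
  "writes_var merge_block x \<longleftrightarrow> x \<in> {Fl, LA, LB, K, Mid, Hi}"
  "writes_arr merge_block a \<longleftrightarrow> a = AT" "\<not> writes_raw merge_block"
  by (auto simp: merge_block_def)

lemma writes_sort [simp]:
  "writes_var sort x \<longleftrightarrow> x \<in> {Fl, LA, LB, K, Mid, Hi, Wd, J}"
  "writes_arr sort a \<longleftrightarrow> a \<in> {AT, AS}" "\<not> writes_raw sort"
  by (auto simp: sort_def)

context ram
begin

text \<open>Ties are broken by colour, blue before red: in the sorted order a red point precedes a blue
  one if and only if its coordinate is strictly smaller.\<close>

definition le_at :: "nat \<Rightarrow> nat \<Rightarrow> nat \<Rightarrow> nat \<Rightarrow> nat \<Rightarrow> bool" where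
  "le_at d r i p q \<longleftrightarrow> X (p * d + i) < X (q * d + i) \<or>
     X (p * d + i) = X (q * d + i) \<and> (p < r \<longrightarrow> q < r)"

lemma le_at_trans: "le_at d r i p q \<Longrightarrow> le_at d r i q u \<Longrightarrow> le_at d r i p u"
  by (auto simp: le_at_def)

lemma le_at_linear: "le_at d r i p q \<or> le_at d r i q p"
  by (auto simp: le_at_def)

abbreviation (input) le_cur :: "st \<Rightarrow> nat \<Rightarrow> nat \<Rightarrow> bool" where
  "le_cur s \<equiv> le_at (vs s Dim) (vs s Reds) (vs s CurI)"

lemma merge_step_correct:
  assumes inv: "merge_inv (le_cur s) (ar s AS) T0 lo (vs s Mid) (vs s Hi) (vs s LA) (vs s LB) (vs s K) (ar s AT)"
    and k: "vs s K < vs s Hi"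
    and srt: "sorted_seg (le_cur s) (ar s AS) lo (vs s Mid)" "sorted_seg (le_cur s) (ar s AS) (vs s Mid) (vs s Hi)"
    and hi: "vs s Hi < M"
    and idx: "\<And>x. x < vs s Hi \<Longrightarrow> ar s AS x * vs s Dim + vs s CurI < M"
  shows "wp merge_step (\<lambda>t s'. t \<le> 13 \<and> vs s' K = Suc (vs s K) \<and>
     merge_inv (le_cur s) (ar s AS) T0 lo (vs s Mid) (vs s Hi) (vs s' LA) (vs s' LB) (vs s' K) (ar s' AT)) s"
proof -
  have b: "vs s LA \<le> vs s Mid" "vs s Mid \<le> vs s LB" "vs s LB \<le> vs s Hi" "vs s K + vs s Mid = vs s LA + vs s LB"
    using inv unfolding merge_inv_def by blast+
  have M2: "1 < M" "vs s LA < M" "vs s LB < M" "Suc (vs s K) < M" using b hi k by linarith+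
  let ?le = "le_cur s"
  define A where "A = ar s AS (vs s LA)"
  define B where "B = ar s AS (vs s LB)"
  have left: "vs s LA < vs s Mid \<Longrightarrow> (vs s LB < vs s Hi \<Longrightarrow> ?le A B) \<Longrightarrow>
     merge_inv ?le (ar s AS) T0 lo (vs s Mid) (vs s Hi) (Suc (vs s LA)) (vs s LB) (Suc (vs s K)) ((ar s AT)(vs s K := A))"
    unfolding A_def B_def by (rule merge_inv_left[OF inv _ _ srt]) (blast, blast, erule (1) le_at_trans)
  have right: "vs s LB < vs s Hi \<Longrightarrow> (vs s LA < vs s Mid \<Longrightarrow> ?le B A) \<Longrightarrow>
     merge_inv ?le (ar s AS) T0 lo (vs s Mid) (vs s Hi) (vs s LA) (Suc (vs s LB)) (Suc (vs s K)) ((ar s AT)(vs s K := B))"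
    unfolding A_def B_def by (rule merge_inv_right[OF inv _ _ srt]) (blast, blast, erule (1) le_at_trans)
  have iA: "A * vs s Dim + vs s CurI < M" "A * vs s Dim < M" if "vs s LA < vs s Mid"
    unfolding A_def using idx[of "vs s LA"] that b by auto
  have iB: "B * vs s Dim + vs s CurI < M" "B * vs s Dim < M" if "vs s LB < vs s Hi"
    unfolding B_def using idx[of "vs s LB"] that b by auto
  have leB: "\<not> vs s LA < vs s Mid \<Longrightarrow> vs s LB < vs s Hi" using b k by linarith
  have S: "Suc (vs s LA) < M" if "vs s LA < vs s Mid" using that b hi by linarith
  have S': "Suc (vs s LB) < M" if "vs s LB < vs s Hi" using that b hi by linarith
  have mid: "vs s LA \<le> vs s K" using b by linarith
  have kM: "vs s K < M" "0 < M" "Suc 0 < M" using M2 by auto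
  show ?thesis
  proof (cases "vs s LA < vs s Mid \<and> (vs s LB < vs s Hi \<longrightarrow> ?le A B)")
    case True
    have "merge_inv ?le (ar s AS) T0 lo (vs s Mid) (vs s Hi) (Suc (vs s LA)) (vs s LB) (Suc (vs s K)) ((ar s AT)(vs s K := A))"
      using left True by blast
    moreover have "vs s LA < vs s Mid" "vs s LB < vs s Hi \<Longrightarrow> X (A * vs s Dim + vs s CurI) < X (B * vs s Dim + vs s CurI) \<or>
        X (A * vs s Dim + vs s CurI) = X (B * vs s Dim + vs s CurI) \<and> (A < vs s Reds \<longrightarrow> B < vs s Reds)"
      using True unfolding le_at_def by blast+
    ultimately show ?thesis
      using iA iB S kM M2 unfolding merge_step_def
      by (auto simp: A_def[symmetric] B_def[symmetric])
  next
    case False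
    then have lt: "vs s LB < vs s Hi" using leB by blast
    have n: "vs s LA < vs s Mid \<Longrightarrow> \<not> ?le A B" using False lt by blast
    have "merge_inv ?le (ar s AS) T0 lo (vs s Mid) (vs s Hi) (vs s LA) (Suc (vs s LB)) (Suc (vs s K)) ((ar s AT)(vs s K := B))"
      by (rule right[OF lt]) (use n le_at_linear in blast)
    moreover have "vs s LA < vs s Mid \<Longrightarrow> \<not> X (A * vs s Dim + vs s CurI) < X (B * vs s Dim + vs s CurI) \<and>
        (X (A * vs s Dim + vs s CurI) = X (B * vs s Dim + vs s CurI) \<longrightarrow> A < vs s Reds \<and> \<not> B < vs s Reds)"
      using n unfolding le_at_def by blast
    ultimately show ?thesis
      using lt iA iB S' kM M2 unfolding merge_step_def
      by (auto simp: A_def[symmetric] B_def[symmetric])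
  qed
qed

lemma merge_block_correct:
  assumes w: "0 < vs s Wd" "2 * vs s Wd dvd vs s K" "vs s K < vs s CurM" "vs s Wd < vs s CurM"
    and blk: "sorted_blocks (le_cur s) (vs s Wd) (ar s AS) (vs s CurM)"
    and M: "2 * vs s CurM < M"
    and idx: "\<And>x. x < vs s CurM \<Longrightarrow> ar s AS x * vs s Dim + vs s CurI < M"
  shows "wp merge_block (\<lambda>t s'. t \<le> 9 + 14 * (vs s' K - vs s K) \<and>
      vs s' K = min (vs s K + 2 * vs s Wd) (vs s CurM) \<and>
      sorted_seg (le_cur s) (ar s' AT) (vs s K) (vs s' K) \<and>
      mset (map (ar s' AT) [vs s K..<vs s' K]) = mset (map (ar s AS) [vs s K..<vs s' K]) \<and>
      (\<forall>x < vs s K. ar s' AT x = ar s AT x)) s"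
proof -
  define lo where "lo = vs s K"
  define mid where "mid = min (lo + vs s Wd) (vs s CurM)"
  define hi where "hi = min (lo + 2 * vs s Wd) (vs s CurM)"
  have hi': "hi = min (mid + vs s Wd) (vs s CurM)" by (auto simp: hi_def mid_def)
  have ord: "lo \<le> mid" "mid \<le> hi" "lo < hi" "hi \<le> vs s CurM"
    using w by (auto simp: mid_def hi_def lo_def)
  have dv: "vs s Wd dvd lo" unfolding lo_def using w(2) by (rule dvd_mult_right)
  have srt1: "sorted_seg (le_cur s) (ar s AS) lo mid"
    by (rule sorted_blocks_seg[OF blk dv]) (auto simp: mid_def w)
  have srt2: "sorted_seg (le_cur s) (ar s AS) mid hi"
  proof (cases "lo + vs s Wd \<le> vs s CurM")
    case True
    then have "mid = lo + vs s Wd" by (simp add: mid_def)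
    then show ?thesis
      using dv by (intro sorted_blocks_seg[OF blk]) (auto simp: hi' w)
  next
    case False
    then show ?thesis by (auto simp: sorted_seg_def mid_def hi_def)
  qed
  define s1 where "s1 = s\<lparr>vs := (vs s)(LA := lo, Mid := mid, LB := mid, Hi := hi)\<rparr>"
  define Q where "Q = (\<lambda>t (s' :: st). t \<le> 9 + 14 * (vs s' K - vs s K) \<and>
      vs s' K = min (vs s K + 2 * vs s Wd) (vs s CurM) \<and>
      sorted_seg (le_cur s) (ar s' AT) (vs s K) (vs s' K) \<and>
      mset (map (ar s' AT) [vs s K..<vs s' K]) = mset (map (ar s AS) [vs s K..<vs s' K]) \<and>
      (\<forall>x < vs s K. ar s' AT x = ar s AT x))"
  have "wp (While (Var K) (Var Hi) merge_step)
     (\<lambda>t s'. t \<le> 14 * (hi - vs s1 K) + 1 \<and>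
        (merge_inv (le_cur s) (ar s AS) (ar s AT) lo mid hi (vs s' LA) (vs s' LB) (vs s' K) (ar s' AT) \<and> vs s' K \<le> hi) \<and>
        \<not> ev (Var K) s' < ev (Var Hi) s') s1"
  proof (rule wp_while_measure[where m = "\<lambda>s. 14 * (hi - vs s K)"])
    show "merge_inv (le_cur s) (ar s AS) (ar s AT) lo mid hi (vs s1 LA) (vs s1 LB) (vs s1 K) (ar s1 AT) \<and> vs s1 K \<le> hi"
      using merge_inv_init[OF ord(1,2)] ord by (simp add: s1_def lo_def)
    fix u
    assume inv: "merge_inv (le_cur s) (ar s AS) (ar s AT) lo mid hi (vs u LA) (vs u LB) (vs u K) (ar u AT) \<and> vs u K \<le> hi"
      and un: "unchanged merge_step s1 u"
    have eq: "vs u Mid = mid" "vs u Hi = hi" "ar u AS = ar s AS" "vs u Dim = vs s Dim" "vs u CurI = vs s CurI" "vs u Reds = vs s Reds"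
      using un by (simp_all add: unchanged_def s1_def)
    show "chk (Var K) u \<and> chk (Var Hi) u \<and> (ev (Var K) u < ev (Var Hi) u \<longrightarrow>
       wp merge_step (\<lambda>t s'. (merge_inv (le_cur s) (ar s AS) (ar s AT) lo mid hi (vs s' LA) (vs s' LB) (vs s' K) (ar s' AT) \<and> vs s' K \<le> hi) \<and>
         t + 1 + 14 * (hi - vs s' K) \<le> 14 * (hi - vs u K)) u)"
    proof (intro conjI impI)
      assume lt: "ev (Var K) u < ev (Var Hi) u"
      have "wp merge_step (\<lambda>t s'. t \<le> 13 \<and> vs s' K = Suc (vs u K) \<and>
         merge_inv (le_cur u) (ar u AS) (ar s AT) lo (vs u Mid) (vs u Hi) (vs s' LA) (vs s' LB) (vs s' K) (ar s' AT)) u"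
        by (rule merge_step_correct) (use inv eq srt1 srt2 lt ord idx M in auto)
      then show "wp merge_step (\<lambda>t s'. (merge_inv (le_cur s) (ar s AS) (ar s AT) lo mid hi (vs s' LA) (vs s' LB) (vs s' K) (ar s' AT) \<and> vs s' K \<le> hi) \<and>
         t + 1 + 14 * (hi - vs s' K) \<le> 14 * (hi - vs u K)) u"
        by (rule wp_mono) (use eq lt in auto)
    qed auto
  qed
  then have "wp (While (Var K) (Var Hi) merge_step) (\<lambda>t. Q (8 + t)) s1"
  proof (rule wp_mono)
    fix t and s' :: st
    assume un: "unchanged (While (Var K) (Var Hi) merge_step) s1 s'"
      and h: "t \<le> 14 * (hi - vs s1 K) + 1 \<and>
        (merge_inv (le_cur s) (ar s AS) (ar s AT) lo mid hi (vs s' LA) (vs s' LB) (vs s' K) (ar s' AT) \<and> vs s' K \<le> hi) \<and>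
        \<not> ev (Var K) s' < ev (Var Hi) s'"
    have eq: "vs s' Hi = hi" using un by (simp add: unchanged_def s1_def)
    have k: "vs s' K = hi" using h eq by simp
    have i: "merge_inv (le_cur s) (ar s AS) (ar s AT) lo mid hi (vs s' LA) (vs s' LB) hi (ar s' AT)"
      using h k by simp
    have ab: "vs s' LA = mid" "vs s' LB = hi" using i by (auto simp: merge_inv_def)
    have ms: "mset (map (ar s' AT) [lo..<hi]) = mset (map (ar s AS) [lo..<hi])"
    proof -
      have "[lo..<hi] = [lo..<mid] @ [mid..<hi]" using ord upt_add_eq_append[of lo mid "hi - mid"] by simp
      moreover have "mset (map (ar s' AT) [lo..<hi]) = mset (map (ar s AS) [lo..<mid]) + mset (map (ar s AS) [mid..<hi])"
        using i unfolding ab merge_inv_def by blast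
      ultimately show ?thesis by (simp del: mset_map mset_upt)
    qed
    moreover have "sorted_seg (le_cur s) (ar s' AT) lo hi" "\<forall>x<lo. ar s' AT x = ar s AT x"
      using i unfolding merge_inv_def by blast+
    ultimately show "Q (8 + t) s'"
      unfolding Q_def k using h by (simp add: lo_def[symmetric] hi_def[symmetric] s1_def del: mset_map mset_upt)
  qed
  then have "wp (While (Var K) (Var Hi) merge_step) (\<lambda>t. Q (8 + t)) s1" .
  \<comment> \<open>The statements before the loop take 6, 7 or 8 ticks, depending on how many of
    the two clippings at \<open>CurM\<close> apply; a bound proved for 8 serves all cases.\<close>
  moreover have "Q (8 + t) s' \<Longrightarrow> t' \<le> 8 \<Longrightarrow> Q (t' + t) s'" for t t' s'
    unfolding Q_def by auto
  ultimately have wp': "wp (While (Var K) (Var Hi) merge_step) (\<lambda>t. Q (t' + t)) s1" if "t' \<le> 8" for t'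
    by (rule wp_mono) (use that in auto)
  have s1: "s\<lparr>vs := (vs s)(LA := lo, Mid := lo + vs s Wd, Mid := mid, LB := mid, Hi := mid + vs s Wd, Hi := hi)\<rparr> = s1"
     "s\<lparr>vs := (vs s)(LA := lo, Mid := mid, LB := mid, Hi := mid + vs s Wd, Hi := hi)\<rparr> = s1"
     "s\<lparr>vs := (vs s)(LA := lo, Mid := lo + vs s Wd, Mid := mid, LB := mid, Hi := hi)\<rparr> = s1"
     "s\<lparr>vs := (vs s)(LA := lo, Mid := mid, LB := mid, Hi := hi)\<rparr> = s1"
    by (simp_all add: s1_def)
  have m1: "\<not> vs s CurM < lo + vs s Wd \<Longrightarrow> lo + vs s Wd = mid" "vs s CurM < lo + vs s Wd \<Longrightarrow> vs s CurM = mid"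
     "\<not> vs s CurM < mid + vs s Wd \<Longrightarrow> mid + vs s Wd = hi" "vs s CurM < mid + vs s Wd \<Longrightarrow> vs s CurM = hi"
    by (auto simp: mid_def hi')
  have bd: "lo + vs s Wd < M" "mid + vs s Wd < M" using w M by (auto simp: lo_def mid_def)
  have "wp merge_block Q s"
  proof (cases "vs s CurM < lo + vs s Wd")
    case c1: True
    note e1 = m1(2)[OF c1]
    show ?thesis
    proof (cases "vs s CurM < mid + vs s Wd")
      case c2: True
      show ?thesis unfolding merge_block_def
        using c1 c2 bd wp'[of 6] wp'[of 7] wp'[of 8] e1 m1(4)[OF c2] by (simp add: lo_def[symmetric] s1_def fun_upd_twist eval_nat_numeral)
    next
      case c2: False
      show ?thesis unfolding merge_block_def
        using c1 c2 bd wp'[of 6] wp'[of 7] wp'[of 8] e1 m1(3)[OF c2] by (simp add: lo_def[symmetric] s1_def fun_upd_twist eval_nat_numeral)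
    qed
  next
    case c1: False
    note e1 = m1(1)[OF c1]
    show ?thesis
    proof (cases "vs s CurM < mid + vs s Wd")
      case c2: True
      show ?thesis unfolding merge_block_def
        using c1 c2 bd wp'[of 6] wp'[of 7] wp'[of 8] e1 m1(4)[OF c2] by (simp add: lo_def[symmetric] s1_def fun_upd_twist eval_nat_numeral)
    next
      case c2: False
      show ?thesis unfolding merge_block_def
        using c1 c2 bd wp'[of 6] wp'[of 7] wp'[of 8] e1 m1(3)[OF c2] by (simp add: lo_def[symmetric] s1_def fun_upd_twist eval_nat_numeral)
    qed
  qed
  then show ?thesis unfolding Q_def .
qed

text \<open>\<open>P\<close> is any exponent with \<open>vs s CurM <= 2 ^ P\<close> and bounds the
  number of passes; keeping it abstract leaves the logarithm to the final estimate.\<close>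

lemma sort_correct:
  assumes M: "2 * vs s CurM < M" "vs s CurM \<le> 2 ^ P" "1 < M"
    and idx: "\<And>x. x < vs s CurM \<Longrightarrow> ar s AS x * vs s Dim + vs s CurI < M"
  shows "wp sort (\<lambda>t s'. t \<le> 2 + P * (8 + 27 * vs s CurM) \<and>
      sorted_seg (le_cur s) (ar s' AS) 0 (vs s CurM) \<and>
      mset (map (ar s' AS) [0..<vs s CurM]) = mset (map (ar s AS) [0..<vs s CurM])) s"
proof -
  define m where "m = vs s CurM"
  let ?le = "le_cur s"
  let ?L = "map (ar s AS) [0..<m]"
  have vals: "f x * vs s Dim + vs s CurI < M" if "mset (map f [0..<m]) = mset ?L" "x < m" for f x
  proof -
    have "f x \<in> set (map f [0..<m])" using that(2) by simp
    also have "\<dots> = set ?L" using that(1) by (rule mset_eq_setD)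
    finally show ?thesis using idx by (auto simp: m_def)
  qed
  define T where "T = 6 + 27 * m"
  let ?body = "K ::= Num 0 ;; While (Var K) (Var CurM) merge_block ;;
         For J (Var CurM) (AS[Var J] ::= Arr AT (Var J)) ;; Wd ::= Var Wd \<oplus> Var Wd"
  define I where "I = (\<lambda>g (u :: st). g \<le> P \<and> vs u Wd = 2 ^ g \<and> sorted_blocks ?le (2 ^ g) (ar u AS) m \<and>
     mset (map (ar u AS) [0..<m]) = mset ?L)"
  let ?s0 = "set_var s Wd 1"
  have pass: "wp ?body (\<lambda>t u'. I (Suc g) u' \<and> t \<le> T) u"
    if u: "I g u" "unchanged ?body ?s0 u" "vs u Wd < m" for g u
  proof -
    have eq: "vs u CurM = m" "vs u Dim = vs s Dim" "vs u Reds = vs s Reds" "vs u CurI = vs s CurI"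
      using u(2) by (simp_all add: unchanged_def m_def)
    have Iu: "vs u Wd = 2 ^ g" "sorted_blocks ?le (2 ^ g) (ar u AS) m" "mset (map (ar u AS) [0..<m]) = mset ?L"
      using u(1) by (auto simp: I_def)
    have m0: "0 < m" using u(3) by simp
    let ?W = "2 * (2 :: nat) ^ g"
    let ?u = "set_var u K 0"
    define R where "R = (\<lambda>(x :: st). (?W dvd vs x K \<or> vs x K = m) \<and> vs x K \<le> m \<and>
       mset (map (ar x AT) [0..<vs x K]) = mset (map (ar u AS) [0..<vs x K]) \<and>
       sorted_blocks ?le ?W (ar x AT) (vs x K))"
    have "wp (While (Var K) (Var CurM) merge_block)
      (\<lambda>t x. t \<le> 24 * (m - vs ?u K) + 1 \<and> R x \<and> \<not> ev (Var K) x < ev (Var CurM) x) ?u"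
    \<comment> \<open>A block costs 14 per element plus 10, the loop test included, and it contains
      at least one element.\<close>
    proof (rule wp_while_measure[where m = "\<lambda>x. 24 * (m - vs x K)"])
      show "R ?u" by (simp add: R_def sorted_blocks_def)
      fix x assume x: "R x" "unchanged merge_block ?u x"
      have xe: "vs x CurM = m" "vs x Dim = vs s Dim" "vs x Reds = vs s Reds" "vs x CurI = vs s CurI"
        "vs x Wd = 2 ^ g" "ar x AS = ar u AS"
        using x(2) eq Iu(1) by (simp_all add: unchanged_def)
      show "chk (Var K) x \<and> chk (Var CurM) x \<and> (ev (Var K) x < ev (Var CurM) x \<longrightarrow>
        wp merge_block (\<lambda>t x'. R x' \<and> t + 1 + 24 * (m - vs x' K) \<le> 24 * (m - vs x K)) x)"
      proof (intro conjI impI)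
        assume "ev (Var K) x < ev (Var CurM) x"
        then have lt: "vs x K < m" using xe by simp
        then have dv: "?W dvd vs x K" using x(1) by (auto simp: R_def)
        show "wp merge_block (\<lambda>t x'. R x' \<and> t + 1 + 24 * (m - vs x' K) \<le> 24 * (m - vs x K)) x"
        proof (rule wp_mono[OF merge_block_correct])
          fix t and x' :: st
          assume h: "t \<le> 9 + 14 * (vs x' K - vs x K) \<and>
            vs x' K = min (vs x K + 2 * vs x Wd) (vs x CurM) \<and>
            sorted_seg (le_cur x) (ar x' AT) (vs x K) (vs x' K) \<and>
            mset (map (ar x' AT) [vs x K..<vs x' K]) = mset (map (ar x AS) [vs x K..<vs x' K]) \<and>
            (\<forall>y < vs x K. ar x' AT y = ar x AT y)"
          have k': "vs x' K = min (vs x K + ?W) m" using h xe by simp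
          have kk: "vs x K < vs x' K" using lt k' by simp
          have spl: "[0..<vs x' K] = [0..<vs x K] @ [vs x K..<vs x' K]"
            using kk upt_add_eq_append[of 0 "vs x K" "vs x' K - vs x K"] by simp
          have "map (ar x' AT) [0..<vs x K] = map (ar x AT) [0..<vs x K]" using h by simp
          moreover have "mset (map (ar x' AT) [vs x K..<vs x' K]) = mset (map (ar u AS) [vs x K..<vs x' K])"
            using h unfolding xe(6) by blast
          moreover have "mset (map (ar x AT) [0..<vs x K]) = mset (map (ar u AS) [0..<vs x K])"
            using x(1) unfolding R_def by blast
          ultimately have "mset (map (ar x' AT) [0..<vs x' K]) = mset (map (ar u AS) [0..<vs x' K])"
            unfolding spl map_append mset_append by argo
          moreover have "sorted_blocks ?le ?W (ar x' AT) (vs x' K)"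
          proof (rule sorted_blocks_extend[OF _ _ dv])
            show "sorted_blocks ?le ?W (ar x AT) (vs x K)" using x(1) unfolding R_def by blast
            show "sorted_seg ?le (ar x' AT) (vs x K) (vs x' K)" using h unfolding xe by blast
          qed (use h in auto)
          moreover have "?W dvd vs x' K \<or> vs x' K = m"
          proof (cases "vs x K + ?W \<le> m")
            case True
            then have "vs x' K = vs x K + ?W" unfolding k' by (rule min_absorb1)
            then show ?thesis using dvd_add[OF dv dvd_refl] by metis
          qed (simp add: k')
          moreover have "t + 1 + 24 * (m - vs x' K) \<le> 24 * (m - vs x K)" using h kk k' by auto
          ultimately show "R x' \<and> t + 1 + 24 * (m - vs x' K) \<le> 24 * (m - vs x K)"
            unfolding R_def using k' by auto
        qed (use xe dv lt u(3) Iu M vals[OF Iu(3)] m_def in auto)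
      qed auto
    qed
    then have w1: "wp (While (Var K) (Var CurM) merge_block)
      (\<lambda>t x. t \<le> 24 * m + 1 \<and> mset (map (ar x AT) [0..<m]) = mset ?L \<and>
         sorted_blocks ?le ?W (ar x AT) m \<and> vs x CurM = m \<and> vs x Wd = 2 ^ g) ?u"
    proof (rule wp_mono)
      fix t x
      assume un: "unchanged (While (Var K) (Var CurM) merge_block) ?u x"
        and h: "t \<le> 24 * (m - vs ?u K) + 1 \<and> R x \<and> \<not> ev (Var K) x < ev (Var CurM) x"
      have e: "vs x CurM = m" "vs x Wd = 2 ^ g" using un eq Iu by (simp_all add: unchanged_def)
      then have "vs x K = m" using h by (simp add: R_def)
      then show "t \<le> 24 * m + 1 \<and> mset (map (ar x AT) [0..<m]) = mset ?L \<and>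
         sorted_blocks ?le ?W (ar x AT) m \<and> vs x CurM = m \<and> vs x Wd = 2 ^ g"
        using h e Iu(3) unfolding R_def by auto
    qed
    have w2: "wp (For J (Var CurM) (AS[Var J] ::= Arr AT (Var J)))
        (\<lambda>t y. t \<le> m * (1 + 2) + 2 \<and> (\<forall>z<m. ar y AS z = ar x AT z) \<and> vs y J = m) x" if "vs x CurM = m" for x
    proof (rule wp_for)
      show "m < M" using M m0 m_def by simp
      fix k y
      assume k: "k < m" and J: "vs y J = k" and IH: "\<forall>z<k. ar y AS z = ar x AT z"
        and un: "unchanged (For J (Var CurM) (AS[Var J] ::= Arr AT (Var J))) x y"
      have "ar y AT = ar x AT" using un by (simp add: unchanged_def)
      then show "wp (AS[Var J] ::= Arr AT (Var J))
        (\<lambda>t y'. t \<le> 1 \<and> (\<forall>z<Suc k. ar (set_var y' J (Suc k)) AS z = ar x AT z)) y"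
        using k J IH M m0 m_def by (auto simp: less_Suc_eq)
    qed (use that in \<open>auto simp: unchanged_def\<close>)
    have pg: "g < P"
    proof -
      have "(2 :: nat) ^ g < 2 ^ P" using u(3) Iu(1) M(2) m_def by linarith
      then show ?thesis by simp
    qed
    show ?thesis
      unfolding wp_Seq[of "K ::= Num 0"] wp_Assign
    proof (intro conjI)
      show "chk (Num 0) u" using M by simp
      show "wp (While (Var K) (Var CurM) merge_block ;;
         For J (Var CurM) (AS[Var J] ::= Arr AT (Var J)) ;; Wd ::= Var Wd \<oplus> Var Wd)
         (\<lambda>t' x. I (Suc g) x \<and> 1 + t' \<le> T) (set_var u K (ev (Num 0) u))"
        unfolding wp_Seq ev.simps
      proof (rule wp_mono[OF w1], rule wp_mono[OF w2])
        fix t t' and x y :: st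
        assume x: "t \<le> 24 * m + 1 \<and> mset (map (ar x AT) [0..<m]) = mset ?L \<and>
         sorted_blocks ?le ?W (ar x AT) m \<and> vs x CurM = m \<and> vs x Wd = 2 ^ g"
        then show "vs x CurM = m" by blast
        assume un: "unchanged (For J (Var CurM) (AS[Var J] ::= Arr AT (Var J))) x y"
          and y: "t' \<le> m * (1 + 2) + 2 \<and> (\<forall>z<m. ar y AS z = ar x AT z) \<and> vs y J = m"
        have "vs y Wd = 2 ^ g" using un x by (simp add: unchanged_def)
        moreover have "map (ar y AS) [0..<m] = map (ar x AT) [0..<m]" using y by simp
        then have "mset (map (ar y AS) [0..<m]) = mset ?L" using x by argo
        moreover have "sorted_blocks ?le ?W (ar y AS) m" using x y by (auto simp: sorted_blocks_def)
        ultimately show "wp (Wd ::= Var Wd \<oplus> Var Wd) (\<lambda>t'' x. I (Suc g) x \<and> 1 + (t + (t' + t'')) \<le> T) y"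
          using x y pg u(3) Iu(1) M m_def by (auto simp: I_def T_def simp del: mset_map mset_upt)
      qed
    qed
  qed
  have "wp (While (Var Wd) (Var CurM) ?body)
     (\<lambda>t u. real t \<le> real ((P - 0) * (T + 1)) + 1 \<and> (\<exists>g. I g u) \<and> \<not> ev (Var Wd) u < ev (Var CurM) u) ?s0"
  proof (rule wp_while[where I = I and pot = "\<lambda>g. real ((P - g) * (T + 1))"])
    show "I 0 ?s0" by (auto simp: I_def sorted_blocks_def)
    fix g u assume u: "I g u" "unchanged ?body ?s0 u"
    have m: "vs u CurM = m" using u(2) by (simp add: unchanged_def m_def)
    show "chk (Var Wd) u \<and> chk (Var CurM) u \<and> (ev (Var Wd) u < ev (Var CurM) u \<longrightarrow>
      wp ?body (\<lambda>t u'. \<exists>g'. I g' u' \<and> real t + 1 + real ((P - g') * (T + 1)) \<le> real ((P - g) * (T + 1))) u)"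
    proof (intro conjI impI)
      assume "ev (Var Wd) u < ev (Var CurM) u"
      then have "vs u Wd < m" using m by simp
      from pass[OF u this]
      show "wp ?body (\<lambda>t u'. \<exists>g'. I g' u' \<and> real t + 1 + real ((P - g') * (T + 1)) \<le> real ((P - g) * (T + 1))) u"
      proof (rule wp_mono)
        fix t and u' :: st assume h: "I (Suc g) u' \<and> t \<le> T"
        then have "Suc g \<le> P" by (simp add: I_def)
        then obtain v where v: "P = Suc g + v" using le_Suc_ex by blast
        have "t + 1 + (P - Suc g) * (T + 1) \<le> (P - g) * (T + 1)" using h by (simp add: v)
        then have "real t + 1 + real ((P - Suc g) * (T + 1)) \<le> real ((P - g) * (T + 1))"
          by (metis of_nat_1 of_nat_add of_nat_mono)
        then show "\<exists>g'. I g' u' \<and> real t + 1 + real ((P - g') * (T + 1)) \<le> real ((P - g) * (T + 1))"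
          using h by blast
      qed
    qed auto
  qed simp
  then have "wp (While (Var Wd) (Var CurM) ?body) (\<lambda>t u. 1 + t \<le> 2 + P * (8 + 27 * m) \<and>
      sorted_seg ?le (ar u AS) 0 m \<and> mset (map (ar u AS) [0..<m]) = mset ?L) ?s0"
  proof (rule wp_mono)
    fix t u
    assume un: "unchanged (While (Var Wd) (Var CurM) ?body) ?s0 u"
      and h: "real t \<le> real ((P - 0) * (T + 1)) + 1 \<and> (\<exists>g. I g u) \<and> \<not> ev (Var Wd) u < ev (Var CurM) u"
    have "real t \<le> real (P * (T + 1) + 1)" using h by simp
    then have "t \<le> P * (T + 1) + 1" by (simp only: of_nat_le_iff)
    moreover have "P * (T + 1) \<le> P * (8 + 27 * m)" by (intro mult_le_mono2) (simp add: T_def)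
    moreover have "vs u CurM = m" using un by (simp add: unchanged_def m_def)
    moreover obtain g where g: "I g u" using h by blast
    ultimately have t: "1 + t \<le> 2 + P * (8 + 27 * m)" and "m \<le> 2 ^ g"
      using h by (auto simp: I_def)
    then have "sorted_seg ?le (ar u AS) 0 m"
      using g unfolding I_def by (intro sorted_blocks_seg[of _ "2 ^ g" _ m]) auto
    then show "1 + t \<le> 2 + P * (8 + 27 * m) \<and>
      sorted_seg ?le (ar u AS) 0 m \<and> mset (map (ar u AS) [0..<m]) = mset ?L"
      using g t unfolding I_def by blast
  qed
  then show ?thesis
    unfolding sort_def wp_Seq[of "Wd ::= Num 1"] wp_Assign m_def[symmetric] ev.simps
    using M by (simp only: chk.simps)
qed

end

section \<open>Accumulating coefficients\<close>

text \<open>An exponent is listed when its accumulator is still 0, so each is listed once and the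
  output can be written without scanning \<open>ACC\<close>.\<close>

definition add_acc :: com where
  "add_acc =
     (IfLess (Arr ACC (Var EE)) (Num 1)
        (LST[Var Cnt] ::= Var EE ;; Cnt ::= Var Cnt \<oplus> Num 1) Skip ;;
      ACC[Var EE] ::= Arr ACC (Var EE) \<oplus> Var CC)"

definition pairs :: com where
  "pairs =
     For PA (Var CurM)
       (IfLess (Arr AS (Var PA)) (Var Reds)
          (For PB (Var CurM)
             (IfLess (Arr AS (Var PB)) (Var Reds) Skip
                (EE ::= Raw (Arr AS (Var PA)) \<oplus> Raw (Arr AS (Var PB)) ;;
                 CC ::= Num 1 ;; add_acc)))
          Skip)"

definition recode :: "nat \<Rightarrow> nat \<Rightarrow> com" where
  "recode b c =
     (Y ::= Num 0 ;; Z ::= Num 1 ;;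
      For Ax (Var Len)
        (Y ::= Var Y \<oplus> Op Mod (Var U) (Num b) \<otimes> Var Z ;;
         U ::= Op Div (Var U) (Num b) ;;
         Z ::= Var Z \<otimes> Num c))"

text \<open>\<open>PB\<close> is the digit being transformed and \<open>U\<close> the index with
  that digit cleared. Results are collected in \<open>AT\<close>, as every old entry is read by
  \<open>q\<close> new ones.\<close>

definition axis :: "nat \<Rightarrow> arr \<Rightarrow> arr \<Rightarrow> com" where
  "axis q tab A =
     (For J (Var Grid)
        (PB ::= Op Mod (Op Div (Var J) (Var St)) (Num q) ;;
         U ::= Var J \<ominus> Var PB \<otimes> Var St ;;
         CC ::= Num 0 ;;
         For Ie (Num q)
           (CC ::= Op MPlus (Var CC)
              (Op MTimes (Arr tab (Var PB \<otimes> Num q \<oplus> Var Ie)) (Arr A (Var U \<oplus> Var Ie \<otimes> Var St)))) ;;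
         AT[Var J] ::= Var CC) ;;
      For J (Var Grid) (A[Var J] ::= Arr AT (Var J)))"

definition transform :: "nat \<Rightarrow> arr \<Rightarrow> arr \<Rightarrow> com" where
  "transform q tab A =
     (St ::= Num 1 ;;
      For Ax (Var Len) (axis q tab A ;; St ::= Var St \<otimes> Num q))"

text \<open>The histograms, red in \<open>AF\<close> and blue in \<open>AH\<close>, are reused by
  every leaf that is convolved. Clearing the grid first costs only a constant per grid
  point.\<close>

definition scatter :: "nat \<Rightarrow> nat \<Rightarrow> com" where
  "scatter r q =
     (For J (Var Grid) (AF[Var J] ::= Num 0 ;; AH[Var J] ::= Num 0) ;;
      For PA (Var CurM)
        (U ::= Raw (Arr AS (Var PA)) ;; recode r q ;;
         IfLess (Arr AS (Var PA)) (Var Reds)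
           (AF[Var Y] ::= Arr AF (Var Y) \<oplus> Num 1)
           (AH[Var Y] ::= Arr AH (Var Y) \<oplus> Num 1)))"

definition gather :: "nat \<Rightarrow> nat \<Rightarrow> com" where
  "gather r q =
     For PA (Var Grid)
       (CC ::= Op Div (Arr AF (Var PA)) (Var Scale) ;;
        IfLess (Num 0) (Var CC)
          (U ::= Var PA ;; recode q r ;; EE ::= Var Y ;; add_acc) Skip)"

definition convolve :: "nat \<Rightarrow> nat \<Rightarrow> com" where
  "convolve r q =
     (scatter r q ;; transform q FW AF ;; transform q FW AH ;;
      For J (Var Grid) (AF[Var J] ::= Op MTimes (Arr AF (Var J)) (Arr AH (Var J))) ;;
      transform q BW AF ;; gather r q)"

lemma writes_add_acc [simp]:
  "writes_var add_acc x \<longleftrightarrow> x = Cnt" "writes_arr add_acc a \<longleftrightarrow> a \<in> {ACC, LST}" "\<not> writes_raw add_acc"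
  by (auto simp: add_acc_def)

lemma writes_pairs [simp]:
  "writes_var pairs x \<longleftrightarrow> x \<in> {PA, PB, EE, CC, Cnt}" "writes_arr pairs a \<longleftrightarrow> a \<in> {ACC, LST}"
  "\<not> writes_raw pairs"
  by (auto simp: pairs_def)

lemma writes_recode [simp]:
  "writes_var (recode b c) x \<longleftrightarrow> x \<in> {Y, Z, Ax, U}" "\<not> writes_arr (recode b c) a" "\<not> writes_raw (recode b c)"
  by (auto simp: recode_def)

lemma writes_axis [simp]:
  "writes_var (axis q tab A) x \<longleftrightarrow> x \<in> {J, PB, U, CC, Ie}" "writes_arr (axis q tab A) a \<longleftrightarrow> a \<in> {AT, A}"
  "\<not> writes_raw (axis q tab A)"
  by (auto simp: axis_def)

lemma writes_transform [simp]:
  "writes_var (transform q tab A) x \<longleftrightarrow> x \<in> {J, PB, U, CC, Ie, St, Ax}" "writes_arr (transform q tab A) a \<longleftrightarrow> a \<in> {AT, A}"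
  "\<not> writes_raw (transform q tab A)"
  by (auto simp: transform_def)

lemma writes_scatter [simp]:
  "writes_var (scatter r q) x \<longleftrightarrow> x \<in> {J, PA, U, Y, Z, Ax}" "writes_arr (scatter r q) a \<longleftrightarrow> a \<in> {AF, AH}"
  "\<not> writes_raw (scatter r q)"
  by (auto simp: scatter_def)

lemma writes_gather [simp]:
  "writes_var (gather r q) x \<longleftrightarrow> x \<in> {PA, CC, U, Y, Z, Ax, EE, Cnt}" "writes_arr (gather r q) a \<longleftrightarrow> a \<in> {ACC, LST}"
  "\<not> writes_raw (gather r q)"
  by (auto simp: gather_def)

lemma writes_convolve [simp]:
  "writes_var (convolve r q) x \<longleftrightarrow> x \<in> {J, PA, PB, U, Y, Z, Ax, CC, Ie, St, EE, Cnt}"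
  "writes_arr (convolve r q) a \<longleftrightarrow> a \<in> {AF, AH, AT, ACC, LST}"
  "\<not> writes_raw (convolve r q)"
  by (auto simp: convolve_def)

context ram
begin

text \<open>The equality with \<open>f\<close> covers all indices, those never written included;
  this relies on the array being zero at the start.\<close>

definition acc_holds :: "st \<Rightarrow> (nat \<Rightarrow> nat) \<Rightarrow> bool" where
  "acc_holds s f \<longleftrightarrow> ar s ACC = f \<and> distinct (map (ar s LST) [0..<vs s Cnt]) \<and>
     set (map (ar s LST) [0..<vs s Cnt]) = {e. f e \<noteq> 0}"

lemma acc_holds_card: "acc_holds s f \<Longrightarrow> card {e. f e \<noteq> 0} = vs s Cnt"
  unfolding acc_holds_def by (metis distinct_card length_map length_upt minus_nat.diff_0)

lemma acc_holds_Cnt: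
  assumes "acc_holds s f" "\<And>e. f e \<noteq> 0 \<Longrightarrow> e \<le> E"
  shows "vs s Cnt \<le> Suc E"
proof -
  have "{e. f e \<noteq> 0} \<subseteq> {..E}" using assms(2) by auto
  then have "card {e. f e \<noteq> 0} \<le> card {..E}" by (rule card_mono[rotated]) simp
  then show ?thesis using acc_holds_card[OF assms(1)] by simp
qed

lemma acc_holds_cong:
  "acc_holds s f \<Longrightarrow> ar s' ACC = ar s ACC \<Longrightarrow> ar s' LST = ar s LST \<Longrightarrow> vs s' Cnt = vs s Cnt \<Longrightarrow> acc_holds s' f"
  by (simp add: acc_holds_def)

text \<open>Positivity of the increment ensures that a listed exponent has a non-zero coefficient.
  \<open>E\<close> bounds the support and thereby the length of the list, which serves as an array
  index.\<close>

lemma add_acc_correct: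
  assumes acc: "acc_holds s f" and E: "\<And>e. f e \<noteq> 0 \<Longrightarrow> e \<le> E" "vs s EE \<le> E" "E + 2 < M"
    and CC: "0 < vs s CC" "f (vs s EE) + vs s CC < M"
  shows "wp add_acc (\<lambda>t s'. t \<le> 4 \<and> acc_holds s' (f(vs s EE := f (vs s EE) + vs s CC))) s"
proof -
  have cnt: "vs s Cnt \<le> Suc E" using acc_holds_Cnt[OF acc E(1)] .
  have a: "ar s ACC = f" using acc by (simp add: acc_holds_def)
  let ?l = "map (ar s LST) [0..<vs s Cnt]"
  have l: "distinct ?l" "set ?l = {e. f e \<noteq> 0}" using acc unfolding acc_holds_def by auto
  have up: "map ((ar s LST)(vs s Cnt := e)) [0..<vs s Cnt] = ?l" for e by simp
  have eM: "vs s EE < M" using E(2,3) by linarith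
  show ?thesis
  proof (cases "f (vs s EE) = 0")
    case True
    have "acc_holds (s\<lparr>vs := (vs s)(Cnt := Suc (vs s Cnt)), ar := (ar s)(LST := (ar s LST)(vs s Cnt := vs s EE), ACC := f(vs s EE := vs s CC))\<rparr>)
        (f(vs s EE := f (vs s EE) + vs s CC))"
      using l True CC up[of "vs s EE"] by (auto simp: acc_holds_def)
    then show ?thesis
      using True cnt E CC eM by (simp add: add_acc_def a fun_upd_twist)
  next
    case False
    have "acc_holds (s\<lparr>ar := (ar s)(ACC := f(vs s EE := f (vs s EE) + vs s CC))\<rparr>)
        (f(vs s EE := f (vs s EE) + vs s CC))"
      using l False by (auto simp: acc_holds_def)
    then show ?thesis
      using False cnt E CC eM by (simp add: add_acc_def a)
  qed
qed

end

text \<open>A leaf of the recursion is a group all of whose red points lie below all of its blue points.\<close>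

locale leaf = ram +
  fixes n nr v :: nat and val :: "nat \<Rightarrow> nat"
  assumes n_base: "n \<le> base" and val_le: "p < n \<Longrightarrow> val p \<le> v" and v_less: "2 * v + 2 < M"
begin

definition holds_group :: "st \<Rightarrow> (nat \<Rightarrow> nat) \<Rightarrow> nat \<Rightarrow> bool" where
  "holds_group s S m \<longleftrightarrow> ar s AS = S \<and> vs s CurM = m \<and> vs s Reds = nr \<and> (\<forall>x<m. S x < n) \<and> m < M \<and>
     (\<forall>p<n. rw s p = val p)"

definition contrib :: "(nat \<Rightarrow> nat) \<Rightarrow> nat \<Rightarrow> nat \<Rightarrow> nat \<Rightarrow> nat" where
  "contrib S x y e = of_bool (S x < nr \<and> \<not> S y < nr \<and> val (S x) + val (S y) = e)"

abbreviation "contribs S m e \<equiv> (\<Sum>x<m. \<Sum>y<m. contrib S x y e)"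

lemma n_less: "holds_group s S m \<Longrightarrow> x < m \<Longrightarrow> S x < base"
  using n_base unfolding holds_group_def by (meson le_trans less_le_trans)

lemma pairs_correct:
  assumes g: "holds_group s S m" and acc: "acc_holds s f"
    and f: "\<And>e. f e \<noteq> 0 \<Longrightarrow> e \<le> 2 * v"
    and b: "\<And>e. f e + contribs S m e < M"
  shows "wp pairs (\<lambda>t s'. t \<le> m * (m * 10 + 5) + 2 \<and>
    acc_holds s' (\<lambda>e. f e + contribs S m e)) s"
proof -
  have mM: "m < M" using g by (simp add: holds_group_def)
  have "wp pairs (\<lambda>t s'. t \<le> m * ((m * 10 + 3) + 2) + 2 \<and>
    acc_holds s' (\<lambda>e. f e + contribs S m e) \<and> vs s' PA = m) s"
    unfolding pairs_def
  proof (rule wp_for[where N = m and T = "m * 10 + 3" and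
      I = "\<lambda>k u. acc_holds u (\<lambda>e. f e + (\<Sum>x<k. \<Sum>y<m. contrib S x y e))"], fold pairs_def)
    fix u assume "unchanged pairs s u"
    then show "chk (Var CurM) u \<and> ev (Var CurM) u = m"
      using g by (simp add: unchanged_def holds_group_def)
  next
    show "acc_holds (set_var s PA 0) (\<lambda>e. f e + (\<Sum>x<0. \<Sum>y<m. contrib S x y e))"
      using acc by (simp add: acc_holds_def)
  next
    fix k u
    assume k: "k < m" and IH: "acc_holds u (\<lambda>e. f e + (\<Sum>x<k. \<Sum>y<m. contrib S x y e))"
      and un: "unchanged pairs s u" and uk: "vs u PA = k"
    have gu: "holds_group u S m" using g un by (simp add: unchanged_def holds_group_def)
    define h where "h = (\<lambda>e. f e + (\<Sum>x<k. \<Sum>y<m. contrib S x y e))"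
    have hb: "h e + (\<Sum>y<m. contrib S k y e) < M" for e
    proof -
      have "(\<Sum>x<Suc k. \<Sum>y<m. contrib S x y e) \<le> contribs S m e"
        using k by (intro sum_mono2) auto
      then show ?thesis using b[of e] by (simp add: h_def)
    qed
    have ce: "e \<le> 2 * v" if "contrib S x y e \<noteq> 0" "x < m" "y < m" for x y e
      using that g val_le[of "S x"] val_le[of "S y"] by (auto simp: contrib_def holds_group_def)
    have h0: "e \<le> 2 * v" if "h e \<noteq> 0" for e
    proof -
      consider "f e \<noteq> 0" | x y where "x < k" "y < m" "contrib S x y e \<noteq> 0"
        using \<open>h e \<noteq> 0\<close> by (auto simp: h_def)
      then show ?thesis using f ce k by cases (blast, meson less_trans)
    qed
    let ?inner = "For PB (Var CurM)
             (IfLess (Arr AS (Var PB)) (Var Reds) Skip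
                (EE ::= Raw (Arr AS (Var PA)) \<oplus> Raw (Arr AS (Var PB)) ;;
                 CC ::= Num 1 ;; add_acc))"
    show "wp (IfLess (Arr AS (Var PA)) (Var Reds) ?inner Skip)
         (\<lambda>t s'. t \<le> m * 10 + 3 \<and> acc_holds (set_var s' PA (Suc k))
             (\<lambda>e. f e + (\<Sum>x<Suc k. \<Sum>y<m. contrib S x y e))) u"
    proof (cases "S k < nr")
      case False
      then have "(\<Sum>y<m. contrib S k y e) = 0" for e by (simp add: contrib_def)
      then show ?thesis using False gu uk IH k mM by (simp add: holds_group_def acc_holds_def)
    next
      case red: True
      have "wp ?inner (\<lambda>t s'. t \<le> m * (8 + 2) + 2 \<and> acc_holds s' (\<lambda>e. h e + (\<Sum>y<m. contrib S k y e)) \<and> vs s' PB = m) u"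
      proof (rule wp_for[where N = m and T = 8 and
          I = "\<lambda>l x. acc_holds x (\<lambda>e. h e + (\<Sum>y<l. contrib S k y e))"])
        fix x assume "unchanged ?inner u x"
        then show "chk (Var CurM) x \<and> ev (Var CurM) x = m"
          using gu by (simp add: unchanged_def holds_group_def)
      next
        show "acc_holds (set_var u PB 0) (\<lambda>e. h e + (\<Sum>y<0. contrib S k y e))"
          using IH by (simp add: acc_holds_def h_def)
      next
        fix l x
        assume l: "l < m" and IH': "acc_holds x (\<lambda>e. h e + (\<Sum>y<l. contrib S k y e))"
          and un': "unchanged ?inner u x" and xl: "vs x PB = l"
        have gx: "holds_group x S m" "vs x PA = k" using gu un' uk by (simp_all add: unchanged_def holds_group_def)
        have lM: "l < M" "k < M" "S k < base" "S l < base" "rw x (S k) = val (S k)" "rw x (S l) = val (S l)"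
          "val (S k) \<le> v" "val (S l) \<le> v"
          using l k mM n_less[OF gx(1)] gx(1) val_le by (auto simp: holds_group_def)
        show "wp (IfLess (Arr AS (Var PB)) (Var Reds) Skip
                (EE ::= Raw (Arr AS (Var PA)) \<oplus> Raw (Arr AS (Var PB)) ;; CC ::= Num 1 ;; add_acc))
           (\<lambda>t s'. t \<le> 8 \<and> acc_holds (set_var s' PB (Suc l)) (\<lambda>e. h e + (\<Sum>y<Suc l. contrib S k y e))) x"
        proof (cases "S l < nr")
          case True
          then have "contrib S k l e = 0" for e by (simp add: contrib_def)
          then show ?thesis using True gx xl IH' lM by (simp add: holds_group_def acc_holds_def)
        next
          case False
          let ?e = "val (S k) + val (S l)"
          let ?F = "\<lambda>e. h e + (\<Sum>y<l. contrib S k y e)"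
          let ?x = "x\<lparr>vs := (vs x)(EE := ?e, CC := 1)\<rparr>"
          have F: "(\<lambda>e. h e + (\<Sum>y<Suc l. contrib S k y e)) = ?F(?e := ?F ?e + 1)"
            using red False by (auto simp: contrib_def fun_eq_iff)
          have "(\<Sum>y<Suc l. contrib S k y ?e) \<le> (\<Sum>y<m. contrib S k y ?e)"
            using l by (intro sum_mono2) auto
          then have "?F ?e + contrib S k l ?e < M" using hb[of ?e] by simp
          then have FM: "?F ?e + 1 < M" using red False by (simp add: contrib_def)
          have "e \<le> 2 * v" if "?F e \<noteq> 0" for e
          proof -
            consider "h e \<noteq> 0" | y where "y < l" "contrib S k y e \<noteq> 0"
              using \<open>?F e \<noteq> 0\<close> by auto
            then show ?thesis using h0 ce k l by cases (blast, meson less_trans)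
          qed
          from add_acc_correct[of ?x ?F "2 * v", OF _ this]
          have "wp add_acc (\<lambda>t s'. t \<le> 4 \<and> acc_holds s' (?F(?e := ?F ?e + 1))) ?x"
            using IH' lM FM v_less by (simp add: acc_holds_def)
          then have "wp add_acc (\<lambda>t s'. Suc (Suc (Suc t)) \<le> 8 \<and> acc_holds (set_var s' PB (Suc l)) (\<lambda>e. h e + (\<Sum>y<Suc l. contrib S k y e))) ?x"
            by (rule wp_mono) (unfold F, auto simp: acc_holds_def)
          then show ?thesis
            using False gx xl lM v_less by (simp add: holds_group_def)
        qed
      qed (use mM in auto)
      then have "wp ?inner (\<lambda>t s'. Suc t \<le> m * 10 + 3 \<and> acc_holds (set_var s' PA (Suc k))
             (\<lambda>e. f e + (\<Sum>x<Suc k. \<Sum>y<m. contrib S x y e))) u"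
        by (rule wp_mono) (auto simp: h_def acc_holds_def add.assoc)
      then show ?thesis using red gu uk k mM by (simp add: holds_group_def)
    qed
  qed (use mM in auto)
  then show ?thesis by (rule wp_mono) (auto simp: algebra_simps)
qed

end

section \<open>Convolution\<close>

context ram
begin

text \<open>\<open>Y + Z * rebase b c (L - k) U\<close> is constant over the rounds. Partial results
  never exceed the final one, so the bounds on the result and on \<open>c ^ L\<close> rule out
  overflow throughout.\<close>

lemma recode_correct:
  assumes L: "vs s Len = L" "L < M" and b: "0 < b" "b < M" "c < M" "1 < M" "c ^ L < M" "0 < c"
    and x: "rebase b c L (vs s U) < M"
  shows "wp (recode b c) (\<lambda>t s'. t \<le> L * 5 + 4 \<and> vs s' Y = rebase b c L (vs s U)) s"
proof -
  let ?x = "rebase b c L (vs s U)"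
  let ?body = "Y ::= Var Y \<oplus> Op Mod (Var U) (Num b) \<otimes> Var Z ;;
         U ::= Op Div (Var U) (Num b) ;; Z ::= Var Z \<otimes> Num c"
  let ?s = "s\<lparr>vs := (vs s)(Y := 0, Z := 1)\<rparr>"
  have "wp (For Ax (Var Len) ?body) (\<lambda>t u. t \<le> L * (3 + 2) + 2 \<and>
      (vs u Z = c ^ L \<and> vs u Y + vs u Z * rebase b c (L - L) (vs u U) = ?x) \<and> vs u Ax = L) ?s"
  proof (rule wp_for[where N = L and T = 3 and
        I = "\<lambda>k u. vs u Z = c ^ k \<and> vs u Y + vs u Z * rebase b c (L - k) (vs u U) = ?x"])
    fix k and u :: st
    assume k: "k < L" and IH: "vs u Z = c ^ k \<and> vs u Y + vs u Z * rebase b c (L - k) (vs u U) = ?x"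
    have Lk: "L - k = Suc (L - Suc k)" using k by simp
    have eq: "vs u Y + c ^ k * (vs u U mod b + c * rebase b c (L - Suc k) (vs u U div b)) = ?x"
      using IH unfolding Lk rebase.simps by metis
    then have eq': "vs u Y + vs u U mod b * c ^ k + c ^ k * c * rebase b c (L - Suc k) (vs u U div b) = ?x"
      by (simp add: algebra_simps)
    have le: "vs u Y + vs u U mod b * c ^ k < M" using eq' x by linarith
    have "c ^ Suc k \<le> c ^ L" using k b by (intro power_increasing) auto
    then have ck: "c ^ k * c < M" using b by (simp add: mult.commute)
    show "wp ?body (\<lambda>t s'. t \<le> 3 \<and> (vs (set_var s' Ax (Suc k)) Z = c ^ Suc k \<and>
       vs (set_var s' Ax (Suc k)) Y + vs (set_var s' Ax (Suc k)) Z *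
         rebase b c (L - Suc k) (vs (set_var s' Ax (Suc k)) U) = ?x)) u"
      using IH le ck b eq' by (auto simp: mult.commute)
  qed (use L in \<open>auto simp: unchanged_def\<close>)
  then have "wp (For Ax (Var Len) ?body) (\<lambda>t u. Suc (Suc t) \<le> L * 5 + 4 \<and> vs u Y = ?x) ?s"
    by (rule wp_mono) auto
  then show ?thesis unfolding recode_def using b by simp
qed

lemma mod_add_mult_mod: "(a + x mod m * (y mod m)) mod m = (a + x * y) mod (m :: int)"
  by (metis mod_add_right_eq mod_mult_eq)

lemma int_mplus_mtimes:
  "int ((c + (a * b) mod 2 ^ w) mod 2 ^ w) = (int c + int a * int b) mod 2 ^ w"
  by (simp add: zmod_int mod_simps)

text \<open>The integers \<open>F j\<close> may be negative or far beyond a word; the array holds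
  their residues. \<open>tstep\<close> consists of sums and products, which commute with
  reduction.\<close>

lemma axis_correct:
  fixes Mx :: "nat \<Rightarrow> nat \<Rightarrow> int"
  assumes A: "A \<noteq> AT" "tab \<noteq> AT" "tab \<noteq> A"
    and st: "vs s Grid = q ^ L" "vs s St = q ^ t" "t < L"
    and q: "0 < q" "q * q < M" "q ^ L < M"
    and tab: "\<And>y e. y < q \<Longrightarrow> e < q \<Longrightarrow> int (ar s tab (y * q + e)) = Mx y e mod 2 ^ w"
    and X: "\<And>j. j < q ^ L \<Longrightarrow> int (ar s A j) = F j mod 2 ^ w"
  shows "wp (axis q tab A) (\<lambda>t' s'. t' \<le> q ^ L * (3 * q + 11) + 4 \<and>
     (\<forall>j<q ^ L. int (ar s' A j) = tstep Mx q (q ^ t) F j mod 2 ^ w)) s"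
proof -
  define Q where "Q = q ^ L"
  have QM: "Q < M" "0 < M" "q < M" using q by (auto simp: Q_def) (metis le_less_trans le_square)
  let ?in = "CC ::= Op MPlus (Var CC)
              (Op MTimes (Arr tab (Var PB \<otimes> Num q \<oplus> Var Ie)) (Arr A (Var U \<oplus> Var Ie \<otimes> Var St)))"
  let ?body = "PB ::= Op Mod (Op Div (Var J) (Var St)) (Num q) ;;
         U ::= Var J \<ominus> Var PB \<otimes> Var St ;;
         CC ::= Num 0 ;; For Ie (Num q) ?in ;; AT[Var J] ::= Var CC"
  let ?copy = "A[Var J] ::= Arr AT (Var J)"
  have w1: "wp (For J (Var Grid) ?body) (\<lambda>t' u. t' \<le> Q * ((3 * q + 6) + 2) + 2 \<and>
    (\<forall>j<Q. int (ar u AT j) = tstep Mx q (q ^ t) F j mod 2 ^ w) \<and> vs u J = Q) s"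
  proof (rule wp_for[where N = Q and T = "3 * q + 6" and
        I = "\<lambda>k u. \<forall>j<k. int (ar u AT j) = tstep Mx q (q ^ t) F j mod 2 ^ w"])
    fix k and u :: st
    assume k: "k < Q" and IH: "\<forall>j<k. int (ar u AT j) = tstep Mx q (q ^ t) F j mod 2 ^ w"
      and un: "unchanged (For J (Var Grid) ?body) s u" and uk: "vs u J = k"
    have eq: "ar u tab = ar s tab" "ar u A = ar s A" "vs u St = q ^ t" 
      using un A st by (simp_all add: unchanged_def)
    define y where "y = (k div q ^ t) mod q"
    have y: "y < q" using q by (simp add: y_def)
    have yk: "y * q ^ t \<le> k" unfolding y_def using digit_replace(1)[OF _ st(3) q(1)] k Q_def by blast
    define b where "b = k - y * q ^ t"
    have be: "b + e * q ^ t < Q" if "e < q" for e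
      unfolding b_def y_def Q_def using digit_replace(2)[OF _ st(3) that] k Q_def by blast
    let ?u = "u\<lparr>vs := (vs u)(PB := y, U := b, CC := 0)\<rparr>"
    have "wp (For Ie (Num q) ?in) (\<lambda>t' x. t' \<le> q * (1 + 2) + 2 \<and>
       int (vs x CC) = (\<Sum>e<q. Mx y e * F (b + e * q ^ t)) mod 2 ^ w \<and> vs x Ie = q) ?u"
    proof (rule wp_for[where N = q and T = 1 and
          I = "\<lambda>e x. int (vs x CC) = (\<Sum>e<e. Mx y e * F (b + e * q ^ t)) mod 2 ^ w"])
      fix e and x :: st
      assume e: "e < q" and IH': "int (vs x CC) = (\<Sum>e<e. Mx y e * F (b + e * q ^ t)) mod 2 ^ w"
        and un': "unchanged (For Ie (Num q) ?in) ?u x" and xe: "vs x Ie = e"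
      have eq': "ar x tab = ar s tab" "ar x A = ar s A" "vs x St = q ^ t" "vs x PB = y" "vs x U = b"
        using un' eq by (simp_all add: unchanged_def)
      have "y * q + e < Suc y * q" using e by simp
      also have "\<dots> \<le> q * q" using y by (intro mult_le_mono1) simp
      finally have i1: "y * q + e < M" "y * q < M" using q by auto
      have i2: "b + e * q ^ t < M" "e * q ^ t < M" using be[OF e] QM by auto
      have "int (ar s A (b + e * q ^ t)) = F (b + e * q ^ t) mod 2 ^ w" using X be[OF e] Q_def by simp
      then have "int ((vs x CC + (ar s tab (y * q + e) * ar s A (b + e * q ^ t)) mod 2 ^ w) mod 2 ^ w) =
         (\<Sum>e<Suc e. Mx y e * F (b + e * q ^ t)) mod 2 ^ w"
        unfolding int_mplus_mtimes IH' tab[OF y e]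
        by (simp only: mod_add_left_eq mod_add_mult_mod sum.lessThan_Suc)
      then show "wp ?in (\<lambda>t' s'. t' \<le> 1 \<and>
           int (vs (set_var s' Ie (Suc e)) CC) = (\<Sum>e<Suc e. Mx y e * F (b + e * q ^ t)) mod 2 ^ w) x"
        using i1 i2 QM xe by (simp add: eq')
    qed (use QM in auto)
    then have "wp (For Ie (Num q) ?in) (\<lambda>t'. wp (AT[Var J] ::= Var CC) (\<lambda>t'' s'. 3 + (t' + t'') \<le> 3 * q + 6 \<and>
       (\<forall>j<Suc k. int (ar (set_var s' J (Suc k)) AT j) = tstep Mx q (q ^ t) F j mod 2 ^ w))) ?u"
    proof (rule wp_mono)
      fix t' and x :: st
      assume un': "unchanged (For Ie (Num q) ?in) ?u x" and h: "t' \<le> q * (1 + 2) + 2 \<and>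
       int (vs x CC) = (\<Sum>e<q. Mx y e * F (b + e * q ^ t)) mod 2 ^ w \<and> vs x Ie = q"
      have "vs x J = k" "ar x AT = ar u AT" using un' uk by (simp_all add: unchanged_def)
      moreover have "tstep Mx q (q ^ t) F k = (\<Sum>e<q. Mx y e * F (b + e * q ^ t))"
        by (simp add: tstep_def y_def b_def)
      ultimately show "wp (AT[Var J] ::= Var CC) (\<lambda>t'' s'. 3 + (t' + t'') \<le> 3 * q + 6 \<and>
       (\<forall>j<Suc k. int (ar (set_var s' J (Suc k)) AT j) = tstep Mx q (q ^ t) F j mod 2 ^ w)) x"
        using h IH k QM by (auto simp: less_Suc_eq)
    qed
    then show "wp ?body (\<lambda>t' s'. t' \<le> 3 * q + 6 \<and>
        (\<forall>j<Suc k. int (ar (set_var s' J (Suc k)) AT j) = tstep Mx q (q ^ t) F j mod 2 ^ w)) u"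
      using uk eq yk k QM
      by (simp add: y_def[symmetric] b_def[symmetric] eval_nat_numeral) (erule wp_mono, auto)
  qed (use st QM Q_def in \<open>auto simp: unchanged_def\<close>)
  have w2: "wp (For J (Var Grid) ?copy) (\<lambda>t' y. t' \<le> Q * (1 + 2) + 2 \<and>
     (\<forall>j<Q. ar y A j = ar x AT j) \<and> vs y J = Q) x" if "vs x Grid = Q" for x
  proof (rule wp_for[where N = Q and T = 1 and I = "\<lambda>k y. \<forall>j<k. ar y A j = ar x AT j"])
    fix k and y :: st
    assume "k < Q" "\<forall>j<k. ar y A j = ar x AT j" "unchanged (For J (Var Grid) ?copy) x y" "vs y J = k"
    then show "wp ?copy (\<lambda>t s'. t \<le> 1 \<and> (\<forall>j<Suc k. ar (set_var s' J (Suc k)) A j = ar x AT j)) y"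
      using QM A by (auto simp: less_Suc_eq unchanged_def)
  qed (use that QM in \<open>auto simp: unchanged_def\<close>)
  show ?thesis unfolding axis_def wp_Seq[of "For J (Var Grid) ?body"] Q_def[symmetric]
  proof (rule wp_mono[OF w1], rule wp_mono[OF w2])
    fix t1 t2 and x y :: st
    assume h: "t1 \<le> Q * ((3 * q + 6) + 2) + 2 \<and>
      (\<forall>j<Q. int (ar x AT j) = tstep Mx q (q ^ t) F j mod 2 ^ w) \<and> vs x J = Q"
    assume h': "t2 \<le> Q * (1 + 2) + 2 \<and> (\<forall>j<Q. ar y A j = ar x AT j) \<and> vs y J = Q"
    show "t1 + t2 \<le> Q * (3 * q + 11) + 4 \<and> (\<forall>j<Q. int (ar y A j) = tstep Mx q (q ^ t) F j mod 2 ^ w)"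
      using h h' by (auto simp: algebra_simps)
  next
    fix t1 and x :: st
    assume "unchanged (For J (Var Grid) ?body) s x"
    then show "vs x Grid = Q" using st by (simp add: unchanged_def Q_def)
  qed
qed

lemma transform_correct:
  fixes Mx :: "nat \<Rightarrow> nat \<Rightarrow> int"
  assumes A: "A \<noteq> AT" "tab \<noteq> AT" "tab \<noteq> A"
    and st: "vs s Grid = q ^ L" "vs s Len = L" "L < M"
    and q: "0 < q" "q * q < M" "q ^ L < M" "1 < M"
    and tab: "\<And>y e. y < q \<Longrightarrow> e < q \<Longrightarrow> int (ar s tab (y * q + e)) = Mx y e mod 2 ^ w"
    and X: "\<And>j. j < q ^ L \<Longrightarrow> int (ar s A j) = F j mod 2 ^ w"
  shows "wp (transform q tab A) (\<lambda>t' s'. t' \<le> L * (q ^ L * (3 * q + 11) + 7) + 3 \<and>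
     (\<forall>j<q ^ L. int (ar s' A j) = axes Mx q L F j mod 2 ^ w)) s"
proof -
  let ?body = "axis q tab A ;; St ::= Var St \<otimes> Num q"
  let ?s = "set_var s St 1"
  define T where "T = q ^ L * (3 * q + 11) + 5"
  define I where "I = (\<lambda>k (u :: st). vs u St = q ^ k \<and> (\<forall>j<q ^ L. int (ar u A j) = axes Mx q k F j mod 2 ^ w))"
  have "wp (For Ax (Var Len) ?body) (\<lambda>t' u. t' \<le> L * (T + 2) + 2 \<and> I L u \<and> vs u Ax = L) ?s"
  proof (rule wp_for[where N = L and T = T and I = I])
    show "I 0 (set_var ?s Ax 0)" using X by (simp add: I_def)
    fix k and u :: st
    assume k: "k < L" and IH: "I k u" and un: "unchanged (For Ax (Var Len) ?body) ?s u"
    have eq: "vs u Grid = q ^ L" "ar u tab = ar s tab"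
      using un st A by (simp_all add: unchanged_def)
    have "q ^ Suc k \<le> q ^ L" using k q by (intro power_increasing) auto
    then have ck: "q ^ k * q < M" "q < M" using q by (auto simp: mult.commute) (metis le_less_trans le_square)
    show "wp ?body (\<lambda>t s'. t \<le> T \<and> I (Suc k) (set_var s' Ax (Suc k))) u"
      unfolding wp_Seq
    proof (rule wp_mono[OF axis_correct[where L = L and t = k and F = "axes Mx q k F" and Mx = Mx]])
      fix t' and x :: st
      assume un': "unchanged (axis q tab A) u x" and h: "t' \<le> q ^ L * (3 * q + 11) + 4 \<and>
        (\<forall>j<q ^ L. int (ar x A j) = tstep Mx q (q ^ k) (axes Mx q k F) j mod 2 ^ w)"
      have "vs x St = q ^ k" using un' IH by (simp add: unchanged_def I_def)
      then show "wp (St ::= Var St \<otimes> Num q)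
          (\<lambda>t'' s'. t' + t'' \<le> T \<and> I (Suc k) (set_var s' Ax (Suc k))) x"
        using h ck by (auto simp: I_def T_def mult.commute)
    qed (use A eq IH k q tab in \<open>auto simp: I_def\<close>)
  qed (use st A in \<open>auto simp: unchanged_def\<close>)
  then have "wp (For Ax (Var Len) ?body) (\<lambda>t' u. 1 + t' \<le> L * (q ^ L * (3 * q + 11) + 7) + 3 \<and>
    (\<forall>j<q ^ L. int (ar u A j) = axes Mx q L F j mod 2 ^ w)) ?s"
    by (rule wp_mono) (auto simp: T_def I_def algebra_simps)
  then show ?thesis unfolding transform_def using q by simp
qed

end

text \<open>\<open>v_L\<close> lets \<open>L\<close> digits suffice for every value,
  \<open>rL_M\<close> bounds the re-encoding of arbitrary grid points, and \<open>D_w\<close> makes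
  a coefficient below \<open>M\<close> recoverable after scaling by \<open>D ^ L\<close>, although
  the transforms compute modulo \<open>2 ^ w\<close>.\<close>

locale conv = leaf +
  fixes r q L D :: nat and Bm :: "nat \<Rightarrow> nat \<Rightarrow> int"
  assumes q_def: "q = 2 * r - 1" and r_ge: "2 \<le> r" and D_pos: "0 < D"
    and Bm: "\<And>i e. i < q \<Longrightarrow> e < q \<Longrightarrow> (\<Sum>y<q. Bm i y * int y ^ e) = (if i = e then int D else 0)"
    and v_L: "v < r ^ L" and L_M: "L < M" and qq_M: "q * q < M" and Q_M: "q ^ L < M"
    and rL_M: "q * r ^ L < M" and D_M: "D ^ L < M" and D_w: "D ^ L * M \<le> 2 ^ w"
begin

definition holds_params :: "st \<Rightarrow> bool" where
  "holds_params s \<longleftrightarrow> vs s Len = L \<and> vs s Grid = q ^ L \<and> vs s Scale = D ^ L \<and>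
     (\<forall>y<q. \<forall>e<q. int (ar s FW (y * q + e)) = int y ^ e mod 2 ^ w) \<and>
     (\<forall>y<q. \<forall>e<q. int (ar s BW (y * q + e)) = Bm y e mod 2 ^ w)"

abbreviation "\<phi> \<equiv> rebase r q L"
abbreviation "\<psi> \<equiv> rebase q r L"

definition grid_count :: "(nat \<Rightarrow> nat) \<Rightarrow> nat \<Rightarrow> nat \<Rightarrow> nat" where
  "grid_count S m j = (\<Sum>x<m. \<Sum>z<m. of_bool (S x < nr \<and> \<not> S z < nr \<and> \<phi> (val (S x)) + \<phi> (val (S z)) = j))"

lemma q_ge: "3 \<le> q" "0 < q" "r \<le> q"
  using q_def r_ge by auto

lemma q_M: "q < M" "r < M" "1 < M"
  using qq_M q_ge le_square[of q] by linarith+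

lemma psi_sum:
  assumes "a \<le> v" "b \<le> v"
  shows "\<psi> (\<phi> a + \<phi> b) = a + b"
  using rebase_sum(2)[OF q_def] r_ge v_L assms by simp

lemma grid_count_le: "grid_count S m j \<le> m * m"
proof -
  have "grid_count S m j \<le> (\<Sum>x<m. \<Sum>z<m. 1)"
    unfolding grid_count_def by (intro sum_mono) simp
  then show ?thesis by simp
qed

lemma grid_count_psi:
  assumes "grid_count S m j \<noteq> 0" "\<And>x. x < m \<Longrightarrow> S x < n"
  shows "\<psi> j \<le> 2 * v"
proof -
  obtain x z where "x < m" "z < m" "\<phi> (val (S x)) + \<phi> (val (S z)) = j"
    using assms(1) by (auto simp: grid_count_def split: if_splits)
  then have "val (S x) \<le> v" "val (S z) \<le> v" using val_le assms(2) by blast+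
  then show ?thesis using psi_sum \<open>\<phi> (val (S x)) + \<phi> (val (S z)) = j\<close> by force
qed

text \<open>Pairs with the same sum of values can have different digitwise sums, because carries are
  not performed on the grid. An exponent therefore collects a whole fibre of
  \<open>\<psi>\<close>.\<close>

lemma sum_grid_count:
  assumes "\<And>x. x < m \<Longrightarrow> S x < n"
  shows "(\<Sum>j<q ^ L. of_bool (\<psi> j = e) * grid_count S m j) = (\<Sum>x<m. \<Sum>z<m. contrib S x z e)"
proof -
  have "(\<Sum>j<q ^ L. of_bool (\<psi> j = e) * grid_count S m j) =
     (\<Sum>x<m. \<Sum>z<m. \<Sum>j<q ^ L. of_bool (\<psi> j = e) * of_bool (S x < nr \<and> \<not> S z < nr \<and> \<phi> (val (S x)) + \<phi> (val (S z)) = j))"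
    unfolding grid_count_def sum_distrib_left
    by (subst sum.swap, rule sum.cong[OF refl], rule sum.swap)
  also have "\<dots> = (\<Sum>x<m. \<Sum>z<m. contrib S x z e)"
  proof (rule sum.cong[OF refl], rule sum.cong[OF refl])
    fix x z assume xz: "x \<in> {..<m}" "z \<in> {..<m}"
    let ?j = "\<phi> (val (S x)) + \<phi> (val (S z))"
    have "?j < q ^ L" using rebase_sum(1)[OF q_def] r_ge by simp
    have "\<psi> ?j = val (S x) + val (S z)" using psi_sum val_le assms xz by simp
    have "(\<Sum>j<q ^ L. of_bool (\<psi> j = e) * of_bool (S x < nr \<and> \<not> S z < nr \<and> ?j = j)) =
       (\<Sum>j<q ^ L. if ?j = j then of_bool (\<psi> j = e \<and> S x < nr \<and> \<not> S z < nr) else (0::nat))"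
      by (intro sum.cong refl) auto
    also have "\<dots> = of_bool (\<psi> ?j = e \<and> S x < nr \<and> \<not> S z < nr)"
      using \<open>?j < q ^ L\<close> by (simp add: sum.delta')
    also have "\<dots> = contrib S x z e"
      unfolding \<open>\<psi> ?j = val (S x) + val (S z)\<close> contrib_def by (rule arg_cong[of _ _ of_bool]) blast
    finally show "(\<Sum>j<q ^ L. of_bool (\<psi> j = e) * of_bool (S x < nr \<and> \<not> S z < nr \<and> ?j = j)) = contrib S x z e" .
  qed
  finally show ?thesis .
qed

lemma scatter_correct:
  assumes g: "holds_group s S m" and p: "holds_params s"
  shows "wp (scatter r q) (\<lambda>t s'. t \<le> q ^ L * 4 + m * (L * 5 + 10) + 4 \<and>
     (\<forall>j<q ^ L. ar s' AF j = (\<Sum>x<m. of_bool (S x < nr \<and> \<phi> (val (S x)) = j))) \<and>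
     (\<forall>j<q ^ L. ar s' AH j = (\<Sum>x<m. of_bool (\<not> S x < nr \<and> \<phi> (val (S x)) = j)))) s"
proof -
  define Q where "Q = q ^ L"
  have QM: "Q < M" "m < M" using Q_M g by (auto simp: Q_def holds_group_def)
  let ?zero = "AF[Var J] ::= Num 0 ;; AH[Var J] ::= Num 0"
  let ?body = "U ::= Raw (Arr AS (Var PA)) ;; recode r q ;;
         IfLess (Arr AS (Var PA)) (Var Reds)
           (AF[Var Y] ::= Arr AF (Var Y) \<oplus> Num 1)
           (AH[Var Y] ::= Arr AH (Var Y) \<oplus> Num 1)"
  have w1: "wp (For J (Var Grid) ?zero) (\<lambda>t u. t \<le> Q * (2 + 2) + 2 \<and>
     (\<forall>j<Q. ar u AF j = 0 \<and> ar u AH j = 0) \<and> vs u J = Q) s"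
  proof (rule wp_for[where N = Q and T = 2 and I = "\<lambda>k u. \<forall>j<k. ar u AF j = 0 \<and> ar u AH j = 0"])
    fix k and u :: st
    assume "k < Q" "\<forall>j<k. ar u AF j = 0 \<and> ar u AH j = 0" "vs u J = k"
    then show "wp ?zero (\<lambda>t s'. t \<le> 2 \<and> (\<forall>j<Suc k. ar (set_var s' J (Suc k)) AF j = 0 \<and>
        ar (set_var s' J (Suc k)) AH j = 0)) u"
      using QM by (auto simp: less_Suc_eq)
  qed (use p QM in \<open>auto simp: unchanged_def holds_params_def Q_def\<close>)
  define CR where "CR = (\<lambda>k j. \<Sum>x<k. of_bool (S x < nr \<and> \<phi> (val (S x)) = j) :: nat)"
  define CB where "CB = (\<lambda>k j. \<Sum>x<k. of_bool (\<not> S x < nr \<and> \<phi> (val (S x)) = j) :: nat)"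
  have Suc: "CR (Suc k) j = CR k j + of_bool (S k < nr \<and> \<phi> (val (S k)) = j)"
    "CB (Suc k) j = CB k j + of_bool (\<not> S k < nr \<and> \<phi> (val (S k)) = j)" for k j
    by (simp_all only: CR_def CB_def sum.lessThan_Suc)
  have le: "CR k j \<le> k" "CB k j \<le> k" for k j
    unfolding CR_def CB_def by (induction k) auto
  have w2: "wp (For PA (Var CurM) ?body) (\<lambda>t x. t \<le> m * ((L * 5 + 8) + 2) + 2 \<and>
     (\<forall>j<Q. ar x AF j = CR m j \<and> ar x AH j = CB m j) \<and> vs x PA = m) u"
    if u: "\<forall>j<Q. ar u AF j = 0 \<and> ar u AH j = 0" "unchanged (For J (Var Grid) ?zero) s u" for u
  proof (rule wp_for[where N = m and T = "L * 5 + 8" and I = "\<lambda>k x. \<forall>j<Q. ar x AF j = CR k j \<and> ar x AH j = CB k j"])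
    have gu: "holds_group u S m" and pu: "vs u Len = L"
      using g p u(2) by (simp_all add: unchanged_def holds_group_def holds_params_def)
    show "\<forall>j<Q. ar (set_var u PA 0) AF j = CR 0 j \<and> ar (set_var u PA 0) AH j = CB 0 j"
      using u by (simp add: CR_def CB_def)
    show "chk (Var CurM) x \<and> ev (Var CurM) x = m" if "unchanged (For PA (Var CurM) ?body) u x" for x
      using that gu by (simp add: unchanged_def holds_group_def)
    fix k and x :: st
    assume k: "k < m" and IH: "\<forall>j<Q. ar x AF j = CR k j \<and> ar x AH j = CB k j"
      and un: "unchanged (For PA (Var CurM) ?body) u x" and xk: "vs x PA = k"
    have gx: "holds_group x S m" "vs x Len = L"
      using gu pu un by (simp_all add: unchanged_def holds_group_def)
    have kk: "S k < base" "rw x (S k) = val (S k)" "ar x AS = S" "vs x Reds = nr"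
      using n_less[OF gx(1) k] gx(1) k by (auto simp: holds_group_def)
    define a where "a = \<phi> (val (S k))"
    have aQ: "a < Q" unfolding a_def Q_def using rebase_less[of r q L] r_ge q_ge by simp
    let ?x = "set_var x U (val (S k))"
    have "wp (recode r q) (\<lambda>t s'. t \<le> L * 5 + 4 \<and> vs s' Y = rebase r q L (vs ?x U)) ?x"
      by (rule recode_correct) (use gx r_ge q_ge q_M L_M Q_M aQ QM in \<open>auto simp: a_def Q_def\<close>)
    then have "wp (recode r q) (\<lambda>t. wp (IfLess (Arr AS (Var PA)) (Var Reds)
           (AF[Var Y] ::= Arr AF (Var Y) \<oplus> Num 1)
           (AH[Var Y] ::= Arr AH (Var Y) \<oplus> Num 1)) (\<lambda>t' s'. 1 + (t + t') \<le> L * 5 + 8 \<and>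
              (\<forall>j<Q. ar (set_var s' PA (Suc k)) AF j = CR (Suc k) j \<and>
                     ar (set_var s' PA (Suc k)) AH j = CB (Suc k) j))) ?x"
    proof (rule wp_mono)
      fix t and y :: st
      assume un': "unchanged (recode r q) ?x y" and h: "t \<le> L * 5 + 4 \<and> vs y Y = rebase r q L (vs ?x U)"
      have e: "ar y = ar x" "vs y PA = k" "vs y Reds = nr" "vs y Y = a"
        using un' h xk kk by (auto simp: unchanged_def a_def)
      show "wp (IfLess (Arr AS (Var PA)) (Var Reds)
           (AF[Var Y] ::= Arr AF (Var Y) \<oplus> Num 1)
           (AH[Var Y] ::= Arr AH (Var Y) \<oplus> Num 1)) (\<lambda>t' s'. 1 + (t + t') \<le> L * 5 + 8 \<and>
              (\<forall>j<Q. ar (set_var s' PA (Suc k)) AF j = CR (Suc k) j \<and>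
                     ar (set_var s' PA (Suc k)) AH j = CB (Suc k) j)) y"
        using h IH aQ QM k le[of k a] q_M kk by (auto simp: e Suc a_def)
    qed
    moreover have "chk (Raw (Arr AS (Var PA))) x" "ev (Raw (Arr AS (Var PA))) x = val (S k)"
      using kk k QM xk by simp_all
    ultimately show "wp ?body (\<lambda>t s'. t \<le> L * 5 + 8 \<and>
              (\<forall>j<Q. ar (set_var s' PA (Suc k)) AF j = CR (Suc k) j \<and>
                     ar (set_var s' PA (Suc k)) AH j = CB (Suc k) j)) x"
      by (simp only: wp_Seq wp_Assign)
  qed (use QM in auto)
  show ?thesis unfolding scatter_def wp_Seq[of "For J (Var Grid) ?zero"] Q_def[symmetric]
  proof (rule wp_mono[OF w1], rule wp_mono[OF w2])
    fix t1 t2 and x y :: st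
    assume h: "t1 \<le> Q * (2 + 2) + 2 \<and> (\<forall>j<Q. ar x AF j = 0 \<and> ar x AH j = 0) \<and> vs x J = Q"
      and h': "t2 \<le> m * ((L * 5 + 8) + 2) + 2 \<and> (\<forall>j<Q. ar y AF j = CR m j \<and> ar y AH j = CB m j) \<and> vs y PA = m"
    show "t1 + t2 \<le> Q * 4 + m * (L * 5 + 10) + 4 \<and>
     (\<forall>j<Q. ar y AF j = (\<Sum>x<m. of_bool (S x < nr \<and> \<phi> (val (S x)) = j))) \<and>
     (\<forall>j<Q. ar y AH j = (\<Sum>x<m. of_bool (\<not> S x < nr \<and> \<phi> (val (S x)) = j)))"
      using h h' unfolding CR_def CB_def by (simp add: algebra_simps)
  qed auto
qed

end

lemma eq_of_int_mod:
  assumes "int a = int b mod 2 ^ w" "b < 2 ^ w"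
  shows "a = b"
proof -
  have "int b < 2 ^ w" using assms(2) of_nat_less_iff[of b "2 ^ w", where 'a = int] by simp
  then show ?thesis using assms(1) by simp
qed

context conv
begin

text \<open>Grid points with count 0 have to be skipped: their image under \<open>\<psi>\<close>
  need not be an exponent that occurs, and listing it could report a zero coefficient. At the other
  points \<open>\<psi>\<close> is an actual sum of two values, hence at most
  \<open>2 * v\<close>.\<close>

lemma gather_correct:
  assumes p: "holds_params s" and acc: "acc_holds s f"
    and S: "\<And>x. x < m \<Longrightarrow> S x < n"
    and f: "\<And>e. f e \<noteq> 0 \<Longrightarrow> e \<le> 2 * v"
    and b: "\<And>e. f e + contribs S m e < M"
    and AF: "\<And>j. j < q ^ L \<Longrightarrow> ar s AF j = D ^ L * grid_count S m j"
  shows "wp (gather r q) (\<lambda>t s'. t \<le> q ^ L * (L * 5 + 14) + 2 \<and>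
     acc_holds s' (\<lambda>e. f e + contribs S m e)) s"
proof -
  define Q where "Q = q ^ L"
  have QM: "Q < M" using Q_M by (simp add: Q_def)
  let ?add = "U ::= Var PA ;; recode q r ;; EE ::= Var Y ;; add_acc"
  let ?body = "CC ::= Op Div (Arr AF (Var PA)) (Var Scale) ;; IfLess (Num 0) (Var CC) ?add Skip"
  \<comment> \<open>The intended accumulator after the first \<open>k\<close> grid points. It grows
    with \<open>k\<close>, so the bound at \<open>Q\<close> excludes overflow on the way.\<close>
  define h where "h = (\<lambda>k e. f e + (\<Sum>j<k. of_bool (\<psi> j = e) * grid_count S m j))"
  have hQ: "h Q e = f e + contribs S m e" for e
    using sum_grid_count[OF S] by (simp add: h_def Q_def)
  have h0: "e \<le> 2 * v" if "h k e \<noteq> 0" for k e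
  proof -
    show ?thesis
    proof (cases "f e = 0")
      case True
      then have "(\<Sum>j<k. of_bool (\<psi> j = e) * grid_count S m j) \<noteq> 0"
        using that by (simp only: h_def)
      then obtain j where "of_bool (\<psi> j = e) * grid_count S m j \<noteq> 0"
        by (rule sum.not_neutral_contains_not_neutral)
      then have "\<psi> j = e" "grid_count S m j \<noteq> 0" by (auto split: if_splits)
      then show ?thesis using grid_count_psi[of S m j] S by blast
    qed (rule f)
  qed
  have hM: "h (Suc k) e < M" if "k < Q" for k e
  proof -
    have "h (Suc k) e \<le> h Q e"
      unfolding h_def using that by (intro add_left_mono sum_mono2) auto
    then show ?thesis using b[of e] hQ[of e] by simp
  qed
  have hS: "h (Suc k) = (h k)(\<psi> k := h k (\<psi> k) + grid_count S m k)" for k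
    unfolding h_def fun_eq_iff sum.lessThan_Suc by (simp del: sum_of_bool_mult_eq sum_mult_of_bool_eq)
  have D0: "D ^ L > 0" using D_pos by simp
  have psi_less: "\<psi> x < M" for x
    using rebase_bound[of q r L x] q_ge r_ge rL_M by linarith
  have rL: "r ^ L < M" using rL_M q_ge by (metis le_less_trans mult_le_mono1 nat_mult_1 One_nat_def Suc_leI)
  have "wp (For PA (Var Grid) ?body) (\<lambda>t u. t \<le> Q * ((L * 5 + 12) + 2) + 2 \<and> acc_holds u (h Q) \<and> vs u PA = Q) s"
  proof (rule wp_for[where N = Q and T = "L * 5 + 12" and I = "\<lambda>k u. acc_holds u (h k)"])
    show "acc_holds (set_var s PA 0) (h 0)"
      using acc by (simp add: h_def acc_holds_def)
    show "chk (Var Grid) u \<and> ev (Var Grid) u = Q" if "unchanged (For PA (Var Grid) ?body) s u" for u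
      using that p by (simp add: unchanged_def holds_params_def Q_def)
    fix k and u :: st
    assume k: "k < Q" and IH: "acc_holds u (h k)" and un: "unchanged (For PA (Var Grid) ?body) s u" and uk: "vs u PA = k"
    have e: "ar u AF = ar s AF" "vs u Scale = D ^ L" "vs u Len = L"
      using un p by (simp_all add: unchanged_def holds_params_def)
    define c where "c = grid_count S m k"
    have AFk: "ar u AF k div D ^ L = c" using AF[of k] k e D0 by (simp add: Q_def c_def)
    show "wp ?body (\<lambda>t s'. t \<le> L * 5 + 12 \<and> acc_holds (set_var s' PA (Suc k)) (h (Suc k))) u"
    proof (cases "c = 0")
      case True
      then have "h (Suc k) = h k" by (simp add: hS c_def)
      then show ?thesis using True AFk e uk k QM IH by (simp add: acc_holds_def)
    next
      case False
      let ?u = "u\<lparr>vs := (vs u)(CC := c, U := k)\<rparr>"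
      have "wp (recode q r) (\<lambda>t s'. t \<le> L * 5 + 4 \<and> vs s' Y = rebase q r L (vs ?u U)) ?u"
        by (rule recode_correct) (use e q_ge r_ge q_M L_M psi_less rL in auto)
      then have "wp (recode q r) (\<lambda>t. wp (EE ::= Var Y) (\<lambda>t'. wp add_acc (\<lambda>t'' s'. 1 + Suc (1 + (t + (t' + t''))) \<le> L * 5 + 12 \<and>
          acc_holds (set_var s' PA (Suc k)) (h (Suc k))))) ?u"
      proof (rule wp_mono)
        fix t x
        assume un': "unchanged (recode q r) ?u x" and t: "t \<le> L * 5 + 4 \<and> vs x Y = rebase q r L (vs ?u U)"
        let ?x = "set_var x EE (\<psi> k)"
        have xe: "vs x CC = c" "vs x Y = \<psi> k" "ar x = ar u" "vs x Cnt = vs u Cnt"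
          using un' t by (auto simp: unchanged_def)
        have le: "vs ?x EE \<le> 2 * v" using h0[of "Suc k" "\<psi> k"] False by (simp add: hS c_def)
        have "acc_holds ?x (h k)" using IH xe by (simp add: acc_holds_def)
        from add_acc_correct[OF this h0 le v_less]
        have "wp add_acc (\<lambda>t s'. t \<le> 4 \<and> acc_holds s' ((h k)(\<psi> k := h k (\<psi> k) + c))) ?x"
          using False xe hM[OF k, of "\<psi> k"] by (simp add: hS c_def)
        then have "wp add_acc (\<lambda>t'' s'. 1 + Suc (1 + (t + (1 + t''))) \<le> L * 5 + 12 \<and>
          acc_holds (set_var s' PA (Suc k)) (h (Suc k))) ?x"
          by (rule wp_mono) (use t in \<open>auto simp: hS c_def acc_holds_def\<close>)
        then show "wp (EE ::= Var Y) (\<lambda>t'. wp add_acc (\<lambda>t'' s'. 1 + Suc (1 + (t + (t' + t''))) \<le> L * 5 + 12 \<and>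
          acc_holds (set_var s' PA (Suc k)) (h (Suc k)))) x"
          using xe by simp
      qed
      moreover have "chk (Op Div (Arr AF (Var PA)) (Var Scale)) u" "ev (Op Div (Arr AF (Var PA)) (Var Scale)) u = c"
        using uk k QM e AFk by simp_all
      moreover have "chk (Num 0) (set_var u CC c)" "ev (Num 0) (set_var u CC c) < ev (Var CC) (set_var u CC c)"
        "chk (Var CC) (set_var u CC c)" "chk (Var PA) (set_var u CC c)" "ev (Var PA) (set_var u CC c) = k"
        using QM False uk by auto
      moreover have "u\<lparr>vs := (vs u)(CC := c)\<rparr>\<lparr>vs := (vs (set_var u CC c))(U := k)\<rparr> = ?u" by simp
      ultimately show ?thesis
        by (simp only: wp_Seq[of "CC ::= _"] wp_Assign wp_If if_True simp_thms) (simp only: wp_Seq wp_Assign[of U] simp_thms)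
    qed
  qed (use QM in auto)
  then show ?thesis unfolding gather_def hQ[abs_def, symmetric] Q_def[symmetric]
    by (rule wp_mono) (auto simp: algebra_simps hQ[symmetric])
qed

text \<open>The predicates \<open>R1\<close> to \<open>R5\<close> follow the two arrays through
  histograms, forward transforms, product and scaled inverse. Up to \<open>R4\<close> the entries
  are known modulo \<open>2 ^ w\<close> only; \<open>R5\<close> is exact.\<close>

lemma convolve_correct:
  assumes g: "holds_group s S m" and p: "holds_params s" and acc: "acc_holds s f"
    and f: "\<And>e. f e \<noteq> 0 \<Longrightarrow> e \<le> 2 * v"
    and b: "\<And>e. f e + contribs S m e < M" and mm: "m * m < M"
  shows "wp (convolve r q) (\<lambda>t s'. t \<le> (q ^ L + m) * (L + 1) * (9 * q + 80) \<and>
     acc_holds s' (\<lambda>e. f e + contribs S m e)) s"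
proof -
  define Q where "Q = q ^ L"
  have Q1: "1 \<le> Q" using q_ge by (simp add: Q_def)
  have QM: "Q < M" using Q_M by (simp add: Q_def)
  define V where "V = (\<lambda>y e. int y ^ e)"
  define F1 where "F1 = (\<lambda>l. \<Sum>x<m. of_bool (S x < nr \<and> \<phi> (val (S x)) = l) :: int)"
  define F2 where "F2 = (\<lambda>l. \<Sum>x<m. of_bool (\<not> S x < nr \<and> \<phi> (val (S x)) = l) :: int)"
  let ?mul = "AF[Var J] ::= Op MTimes (Arr AF (Var J)) (Arr AH (Var J))"
  let ?scatter = "scatter r q" let ?t1 = "transform q FW AF" let ?t2 = "transform q FW AH"
  let ?t3 = "transform q BW AF" let ?mulf = "For J (Var Grid) ?mul"
  define T1 where "T1 = Q * 4 + m * (L * 5 + 10) + 4"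
  define T2 where "T2 = L * (Q * (3 * q + 11) + 7) + 3"
  define R1 where "R1 = (\<lambda>(u :: st). (\<forall>j<Q. int (ar u AF j) = F1 j mod 2 ^ w) \<and> (\<forall>j<Q. int (ar u AH j) = F2 j mod 2 ^ w) \<and>
      holds_params u \<and> acc_holds u f)"
  have cnt: "int (\<Sum>x<m. of_bool (P x)) = (\<Sum>x<m. of_bool (P x)) mod 2 ^ w" for P :: "nat \<Rightarrow> bool"
  proof -
    have "(\<Sum>x<m. of_bool (P x)) \<le> m" using sum_mono[of "{..<m}" "\<lambda>x. of_bool (P x)" "\<lambda>_. 1 :: nat"] by simp
    then have "(\<Sum>x<m. of_bool (P x)) < (2 :: nat) ^ w" using g M_less[of m] by (simp add: holds_group_def)
    then have "int (\<Sum>x<m. of_bool (P x)) < 2 ^ w" using of_nat_less_iff[of "\<Sum>x<m. of_bool (P x)" "2 ^ w", where 'a = int] by simp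
    moreover have "int (\<Sum>x<m. of_bool (P x)) = (\<Sum>x<m. of_bool (P x))"
      unfolding of_nat_sum of_nat_of_bool ..
    ultimately show ?thesis by (metis mod_pos_pos_trivial of_nat_0_le_iff)
  qed
  have w1: "wp ?scatter (\<lambda>t u. t \<le> T1 \<and> R1 u) s"
  proof (rule wp_mono[OF scatter_correct[OF g p]])
    fix t u
    assume un: "unchanged ?scatter s u" and h: "t \<le> q ^ L * 4 + m * (L * 5 + 10) + 4 \<and>
     (\<forall>j<q ^ L. ar u AF j = (\<Sum>x<m. of_bool (S x < nr \<and> \<phi> (val (S x)) = j))) \<and>
     (\<forall>j<q ^ L. ar u AH j = (\<Sum>x<m. of_bool (\<not> S x < nr \<and> \<phi> (val (S x)) = j)))"
    have "holds_params u" "acc_holds u f"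
      using un p acc by (simp_all add: unchanged_def holds_params_def acc_holds_def)
    moreover have "\<forall>j<Q. int (ar u AF j) = F1 j mod 2 ^ w"
    proof (intro allI impI)
      fix j assume "j < Q"
      then have "ar u AF j = (\<Sum>x<m. of_bool (S x < nr \<and> \<phi> (val (S x)) = j))" using h Q_def by blast
      then show "int (ar u AF j) = F1 j mod 2 ^ w" unfolding F1_def by (simp only: cnt)
    qed
    moreover have "\<forall>j<Q. int (ar u AH j) = F2 j mod 2 ^ w"
    proof (intro allI impI)
      fix j assume "j < Q"
      then have "ar u AH j = (\<Sum>x<m. of_bool (\<not> S x < nr \<and> \<phi> (val (S x)) = j))" using h Q_def by blast
      then show "int (ar u AH j) = F2 j mod 2 ^ w" unfolding F2_def by (simp only: cnt)
    qed
    ultimately show "t \<le> T1 \<and> R1 u" using h unfolding R1_def T1_def Q_def by blast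
  qed
  define R2 where "R2 = (\<lambda>(u :: st). (\<forall>j<Q. int (ar u AF j) = axes V q L F1 j mod 2 ^ w) \<and> (\<forall>j<Q. int (ar u AH j) = F2 j mod 2 ^ w) \<and>
      holds_params u \<and> acc_holds u f)"
  have w2: "wp ?t1 (\<lambda>t x. t \<le> T2 \<and> R2 x) u" if u: "R1 u" for u
  proof (rule wp_mono[OF transform_correct[where L = L and Mx = V and F = F1]])
    fix t x
    assume un: "unchanged ?t1 u x" and h: "t \<le> L * (q ^ L * (3 * q + 11) + 7) + 3 \<and>
     (\<forall>j<q ^ L. int (ar x AF j) = axes V q L F1 j mod 2 ^ w)"
    show "t \<le> T2 \<and> R2 x"
      using un h u by (simp add: unchanged_def R1_def R2_def holds_params_def acc_holds_def T2_def Q_def)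
  qed (use u q_ge q_M qq_M Q_M L_M in \<open>auto simp: R1_def holds_params_def V_def Q_def\<close>)
  define R3 where "R3 = (\<lambda>(u :: st). (\<forall>j<Q. int (ar u AF j) = axes V q L F1 j mod 2 ^ w) \<and> (\<forall>j<Q. int (ar u AH j) = axes V q L F2 j mod 2 ^ w) \<and>
      holds_params u \<and> acc_holds u f)"
  have w3: "wp ?t2 (\<lambda>t x. t \<le> T2 \<and> R3 x) u" if u: "R2 u" for u
  proof (rule wp_mono[OF transform_correct[where L = L and Mx = V and F = F2]])
    fix t x
    assume un: "unchanged ?t2 u x" and h: "t \<le> L * (q ^ L * (3 * q + 11) + 7) + 3 \<and>
     (\<forall>j<q ^ L. int (ar x AH j) = axes V q L F2 j mod 2 ^ w)"
    show "t \<le> T2 \<and> R3 x"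
      using un h u by (simp add: unchanged_def R2_def R3_def holds_params_def acc_holds_def T2_def Q_def)
  qed (use u q_ge q_M qq_M Q_M L_M in \<open>auto simp: R2_def holds_params_def V_def Q_def\<close>)
  define G where "G = (\<lambda>j. axes V q L F1 j * axes V q L F2 j)"
  define R4 where "R4 = (\<lambda>(u :: st). (\<forall>j<Q. int (ar u AF j) = G j mod 2 ^ w) \<and> holds_params u \<and> acc_holds u f)"
  have w4: "wp ?mulf (\<lambda>t x. t \<le> Q * 3 + 2 \<and> R4 x) u" if u: "R3 u" for u
  proof -
    have "wp ?mulf (\<lambda>t x. t \<le> Q * (1 + 2) + 2 \<and> ((\<forall>j<Q. int (ar x AF j) = G j mod 2 ^ w) \<and> (\<forall>j. Q \<le> j \<and> j < Q \<longrightarrow> ar x AF j = ar u AF j)) \<and> vs x J = Q) u"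
    proof (rule wp_for[where N = Q and T = 1 and
          I = "\<lambda>k x. (\<forall>j<k. int (ar x AF j) = G j mod 2 ^ w) \<and> (\<forall>j. k \<le> j \<and> j < Q \<longrightarrow> ar x AF j = ar u AF j)"])
      fix k and x :: st
      assume k: "k < Q" and IH: "(\<forall>j<k. int (ar x AF j) = G j mod 2 ^ w) \<and> (\<forall>j. k \<le> j \<and> j < Q \<longrightarrow> ar x AF j = ar u AF j)"
        and un: "unchanged ?mulf u x" and xk: "vs x J = k"
      have e: "ar x AH = ar u AH" using un by (simp add: unchanged_def)
      have "int ((ar x AF k * ar x AH k) mod 2 ^ w) = G k mod 2 ^ w"
      proof -
        have "int (ar x AF k) = axes V q L F1 k mod 2 ^ w" "int (ar x AH k) = axes V q L F2 k mod 2 ^ w"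
          using IH k u e by (auto simp: R3_def)
        then show ?thesis by (simp add: zmod_int G_def mod_mult_eq)
      qed
      then show "wp ?mul (\<lambda>t s'. t \<le> 1 \<and> ((\<forall>j<Suc k. int (ar (set_var s' J (Suc k)) AF j) = G j mod 2 ^ w) \<and>
          (\<forall>j. Suc k \<le> j \<and> j < Q \<longrightarrow> ar (set_var s' J (Suc k)) AF j = ar u AF j))) x"
        using xk k QM IH by (auto simp: less_Suc_eq)
    qed (use u QM in \<open>auto simp: R3_def holds_params_def unchanged_def Q_def\<close>)
    then show ?thesis
    proof (rule wp_mono)
      fix t x
      assume un: "unchanged ?mulf u x" and h: "t \<le> Q * (1 + 2) + 2 \<and> ((\<forall>j<Q. int (ar x AF j) = G j mod 2 ^ w) \<and> (\<forall>j. Q \<le> j \<and> j < Q \<longrightarrow> ar x AF j = ar u AF j)) \<and> vs x J = Q"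
      have "holds_params x \<and> acc_holds x f"
        using un u by (simp add: unchanged_def R3_def holds_params_def acc_holds_def)
      then show "t \<le> Q * 3 + 2 \<and> R4 x" using h by (simp add: R4_def)
    qed
  qed
  define R5 where "R5 = (\<lambda>(u :: st). (\<forall>j<Q. ar u AF j = D ^ L * grid_count S m j) \<and> holds_params u \<and> acc_holds u f)"
  have w5: "wp ?t3 (\<lambda>t x. t \<le> T2 \<and> R5 x) u" if u: "R4 u" for u
  proof (rule wp_mono[OF transform_correct[where L = L and Mx = Bm and F = G]])
    fix t x
    assume un: "unchanged ?t3 u x" and h: "t \<le> L * (q ^ L * (3 * q + 11) + 7) + 3 \<and>
     (\<forall>j<q ^ L. int (ar x AF j) = axes Bm q L G j mod 2 ^ w)"
    have "ar x AF j = D ^ L * grid_count S m j" if j: "j < Q" for j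
    proof -
      have "axes Bm q L G j = int D ^ L * (\<Sum>x<m. \<Sum>z<m. of_bool (S x < nr \<and> \<not> S z < nr \<and> \<phi> (val (S x)) + \<phi> (val (S z)) = j))"
        unfolding G_def F1_def F2_def V_def
        using convolution[where q = q and B = Bm and A = "\<lambda>y e. int y ^ e" and D = "int D" and r = r and j = j
            and L = L and m = m and P = "\<lambda>x. S x < nr" and f = "\<lambda>x. val (S x)" and R = "\<lambda>x. \<not> S x < nr"]
          Bm q_def r_ge j by (simp add: power_add Q_def)
      also have "\<dots> = int (D ^ L * grid_count S m j)"
        unfolding grid_count_def of_nat_mult of_nat_sum of_nat_power of_nat_of_bool ..
      finally have "int (ar x AF j) = int (D ^ L * grid_count S m j) mod 2 ^ w"
        using h j by (simp add: Q_def)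
      \<comment> \<open>Here the residue becomes the number itself: a count is at most
        \<open>m * m\<close>, hence below \<open>M\<close>.\<close>
      moreover have "D ^ L * grid_count S m j < 2 ^ w"
      proof -
        have "grid_count S m j < M" using grid_count_le mm by (rule le_less_trans)
        then have "D ^ L * grid_count S m j < D ^ L * M" using D_pos by simp
        then show ?thesis using D_w by linarith
      qed
      ultimately show ?thesis by (rule eq_of_int_mod)
    qed
    then show "t \<le> T2 \<and> R5 x"
      using un h u by (simp add: unchanged_def R4_def R5_def holds_params_def acc_holds_def T2_def Q_def)
  qed (use u q_ge q_M qq_M Q_M L_M in \<open>auto simp: R4_def holds_params_def V_def Q_def\<close>)
  have w6: "wp (gather r q) (\<lambda>t s'. t \<le> Q * (L * 5 + 14) + 2 \<and>
     acc_holds s' (\<lambda>e. f e + contribs S m e)) u" if u: "R5 u" for u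
    unfolding Q_def
    by (rule gather_correct) (use u g f b in \<open>auto simp: R5_def holds_group_def Q_def\<close>)
  \<comment> \<open>\<open>9 * q\<close> stems from three transforms at \<open>3 * q\<close> per
    entry and axis; 80 covers all other coefficients.\<close>
  have tm: "t1 + (t2 + (t3 + (t4 + (t5 + t6)))) \<le> (q ^ L + m) * (L + 1) * (9 * q + 80)"
    if "t1 \<le> T1" "t2 \<le> T2" "t3 \<le> T2" "t4 \<le> Q * 3 + 2" "t5 \<le> T2" "t6 \<le> Q * (L * 5 + 14) + 2"
    for t1 t2 t3 t4 t5 t6
  proof -
    obtain Q' where "Q = Suc Q'" using Q1 by (cases Q) auto
    then have "T1 + 3 * T2 + (Q * 3 + 2) + (Q * (L * 5 + 14) + 2) \<le> (Q + m) * (L + 1) * (9 * q + 80)"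
      by (simp add: T1_def T2_def algebra_simps)
    then show ?thesis using that unfolding Q_def by linarith
  qed
  show ?thesis
    unfolding convolve_def wp_Seq[of ?scatter] wp_Seq[of ?t1] wp_Seq[of ?t2] wp_Seq[of ?mulf] wp_Seq[of ?t3]
    apply (rule wp_mono[OF w1])
    apply (rule wp_mono[OF w2], blast)
    apply (rule wp_mono[OF w3], blast)
    apply (rule wp_mono[OF w4], blast)
    apply (rule wp_mono[OF w5], blast)
    apply (rule wp_mono[OF w6], blast)
    using tm by blast
qed

end

section \<open>The stack of subproblems\<close>

definition push_cross :: com where
  "push_cross = (AG[Var Gtop \<oplus> Var Cr] ::= Var Pt ;; Cr ::= Var Cr \<oplus> Num 1)"

definition push_task :: "exp \<Rightarrow> exp \<Rightarrow> com" where
  "push_task i m = (ATI[Var Stop] ::= i ;; ATM[Var Stop] ::= m ;; Stop ::= Var Stop \<oplus> Num 1)"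

text \<open>The group for the next coordinate goes on top of both halves and is processed first. It
  is omitted if empty, so the stack never has more tasks than points.\<close>

definition split_group :: com where
  "split_group =
     (Half ::= Op Div (Var CurM) (Num 2) ;;
      For J (Var CurM) (AG[Var Gtop \<oplus> Var J] ::= Arr AS (Var J)) ;;
      Gtop ::= Var Gtop \<oplus> Var CurM ;;
      push_task (Var CurI) (Var Half) ;;
      push_task (Var CurI) (Var CurM \<ominus> Var Half) ;;
      Cr ::= Num 0 ;;
      For J (Var CurM)
        (Pt ::= Arr AS (Var J) ;;
         IfLess (Var Pt) (Var Reds)
           (IfLess (Var J) (Var Half) push_cross Skip)
           (IfLess (Var J) (Var Half) Skip push_cross)) ;;
      IfLess (Num 0) (Var Cr)
        (push_task (Var CurI \<oplus> Num 1) (Var Cr) ;; Gtop ::= Var Gtop \<oplus> Var Cr) Skip)"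

definition pop_task :: com where
  "pop_task =
     (Stop ::= Var Stop \<ominus> Num 1 ;;
      CurI ::= Arr ATI (Var Stop) ;; CurM ::= Arr ATM (Var Stop) ;;
      Gtop ::= Var Gtop \<ominus> Var CurM ;;
      For J (Var CurM) (AS[Var J] ::= Arr AG (Var Gtop \<oplus> Var J)))"

definition process :: "nat \<Rightarrow> nat \<Rightarrow> com" where
  "process r q =
     IfLess (Var CurI) (Var Dim)
       (IfLess (Num 1) (Var CurM) (sort ;; split_group) Skip)
       (IfLess (Var CurM \<otimes> Var CurM) (Var MaxV \<oplus> Num 1) pairs (convolve r q))"

definition main_loop :: "nat \<Rightarrow> nat \<Rightarrow> com" where
  "main_loop r q = While (Num 0) (Var Stop) (pop_task ;; process r q)"

lemma writes_push [simp]: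
  "writes_var push_cross x \<longleftrightarrow> x = Cr" "writes_arr push_cross a \<longleftrightarrow> a = AG" "\<not> writes_raw push_cross"
  "writes_var (push_task i m) x \<longleftrightarrow> x = Stop" "writes_arr (push_task i m) a \<longleftrightarrow> a \<in> {ATI, ATM}"
  "\<not> writes_raw (push_task i m)"
  by (auto simp: push_cross_def push_task_def)

lemma writes_split_group [simp]:
  "writes_var split_group x \<longleftrightarrow> x \<in> {Half, J, Gtop, Stop, Cr, Pt}"
  "writes_arr split_group a \<longleftrightarrow> a \<in> {AG, ATI, ATM}" "\<not> writes_raw split_group"
  by (auto simp: split_group_def)

lemma writes_pop_task [simp]:
  "writes_var pop_task x \<longleftrightarrow> x \<in> {Stop, CurI, CurM, Gtop, J}"
  "writes_arr pop_task a \<longleftrightarrow> a = AS" "\<not> writes_raw pop_task"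
  by (auto simp: pop_task_def)

type_synonym tasks = "(nat \<times> nat list) list"

definition total :: "tasks \<Rightarrow> nat" where
  "total ts = length (concat (map snd ts))"

text \<open>Groups lie contiguously in the order of their tasks, so a task stores only a length.
  Cells from \<open>gt\<close> on are free; the group for the next coordinate is assembled there
  before it is pushed.\<close>

definition stack_holds :: "(nat \<Rightarrow> nat) \<Rightarrow> (nat \<Rightarrow> nat) \<Rightarrow> (nat \<Rightarrow> nat) \<Rightarrow> nat \<Rightarrow> nat \<Rightarrow> tasks \<Rightarrow> bool" where
  "stack_holds TI TM G st gt ts \<longleftrightarrow> st = length ts \<and> gt = total ts \<and>
     (\<forall>k<length ts. TI k = fst (ts ! k) \<and> TM k = length (snd (ts ! k))) \<and>
     (\<forall>x<gt. G x = concat (map snd ts) ! x)"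

lemma total_simps [simp]:
  "total [] = 0" "total (ts @ us) = total ts + total us" "total ((i, g) # ts) = length g + total ts"
  by (auto simp: total_def)

lemma stack_push:
  assumes "stack_holds TI TM G st gt ts"
    and "\<And>x. x < length g \<Longrightarrow> G' (gt + x) = g ! x" "\<And>x. x < gt \<Longrightarrow> G' x = G x"
  shows "stack_holds (TI(st := i)) (TM(st := length g)) G' (Suc st) (gt + length g) (ts @ [(i, g)])"
proof -
  have "G' x = concat (map snd (ts @ [(i, g)])) ! x" if "x < gt + length g" for x
  proof (cases "x < gt")
    case True
    then show ?thesis using assms by (simp add: stack_holds_def total_def nth_append)
  next
    case False
    then show ?thesis using assms(1) assms(2)[of "x - gt"] that
      by (simp add: stack_holds_def total_def nth_append)
  qed
  then show ?thesis using assms(1) by (auto simp: stack_holds_def nth_append)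
qed

lemma stack_pop:
  assumes "stack_holds TI TM G st gt (ts @ [(i, g)])"
  shows "st = Suc (length ts)" "TI (length ts) = i" "TM (length ts) = length g"
    "gt = total ts + length g" "stack_holds TI TM G (length ts) (total ts) ts"
    "\<And>x. x < length g \<Longrightarrow> G (total ts + x) = g ! x"
  using assms by (auto simp: stack_holds_def nth_append total_def)

text \<open>A task of dimension \<open>i\<close> leaves at most \<open>(i + 1) * n\<close> points in the stack up to its own
  position: halving a group adds nothing, and only a task of the next dimension comes on top.\<close>

definition bounded_stack :: "nat \<Rightarrow> tasks \<Rightarrow> bool" where
  "bounded_stack n ts \<longleftrightarrow> (\<forall>k<length ts. total (take (Suc k) ts) \<le> (fst (ts ! k) + 1) * n)"

lemma bounded_stack_snoc:
  "bounded_stack n (ts @ [(i, g)]) \<longleftrightarrow> bounded_stack n ts \<and> total ts + length g \<le> (i + 1) * n"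
  by (auto simp: bounded_stack_def nth_append less_Suc_eq all_conj_distrib)

text \<open>\<open>nd_M\<close> bounds the positions in the real array, \<open>nn_M\<close> the
  coefficients, and \<open>stack_M\<close> the height of the stack together with the groups under
  construction.\<close>

locale problem = conv +
  fixes d :: nat
  assumes nd_M: "n * d + d < M" and nn_M: "n * n < M" and stack_M: "(d + 4) * n + 4 < M" and d_M: "d + 2 < M"
begin

text \<open>Coordinates below \<open>i\<close> are left out: for a task of dimension
  \<open>i\<close> they have been settled by earlier splits.\<close>

definition pair_ok :: "nat \<Rightarrow> nat \<Rightarrow> nat \<Rightarrow> nat \<Rightarrow> bool" where
  "pair_ok i e a b \<longleftrightarrow> a < nr \<and> \<not> b < nr \<and> (\<forall>c. i \<le> c \<and> c < d \<longrightarrow> X (a * d + c) < X (b * d + c)) \<and>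
     val a + val b = e"

definition count :: "nat \<Rightarrow> nat list \<Rightarrow> nat \<Rightarrow> nat" where
  "count i g e = pair_count (pair_ok i e) g g"

definition cross :: "nat list \<Rightarrow> nat list \<Rightarrow> nat list" where
  "cross g h = filter (\<lambda>p. p < nr) g @ filter (\<lambda>p. \<not> p < nr) h"

lemma count_mset: "mset g = mset h \<Longrightarrow> count i g e = count i h e"
  unfolding count_def by (rule pair_count_mset)

lemma count_split:
  assumes i: "i < d" and le: "\<And>p q. p \<in> set g \<Longrightarrow> q \<in> set h \<Longrightarrow> le_at d nr i p q"
  shows "count i (g @ h) e = count i g e + count i h e + count (Suc i) (cross g h) e"
proof -
  have 1: "pair_count (pair_ok i e) h g = 0"
  proof (rule pair_count_zero)
    fix p q assume "p \<in> set h" "q \<in> set g"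
    then have "le_at d nr i q p" using le by blast
    then show "\<not> pair_ok i e p q" using i by (auto simp: pair_ok_def le_at_def dest!: spec[of _ i])
  qed
  have "pair_count (pair_ok i e) g h = pair_count (pair_ok (Suc i) e) g h"
  proof (rule pair_count_cong)
    fix p q assume "p \<in> set g" "q \<in> set h"
    then have "le_at d nr i p q" by (rule le)
    then have "p < nr \<Longrightarrow> \<not> q < nr \<Longrightarrow> X (p * d + i) < X (q * d + i)" by (auto simp: le_at_def)
    then show "pair_ok i e p q = pair_ok (Suc i) e p q"
      unfolding pair_ok_def by (metis Suc_le_eq le_eq_less_or_eq)
  qed
  also have "\<dots> = pair_count (pair_ok (Suc i) e) (filter (\<lambda>p. p < nr) g) (filter (\<lambda>p. \<not> p < nr) h)"
    by (subst pair_count_filter_left, simp add: pair_ok_def, subst pair_count_filter_right) (auto simp: pair_ok_def)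
  also have "\<dots> = count (Suc i) (cross g h) e"
  proof -
    have z: "pair_count (pair_ok (Suc i) e) (filter (\<lambda>p. \<not> p < nr) h) xs = 0"
       "pair_count (pair_ok (Suc i) e) xs (filter (\<lambda>p. p < nr) g) = 0" for xs
      by (auto intro!: pair_count_zero simp: pair_ok_def)
    show ?thesis unfolding count_def cross_def pair_count_append by (simp add: z)
  qed
  finally show ?thesis using 1 by (simp add: count_def pair_count_append)
qed

lemma count_single: "length g \<le> 1 \<Longrightarrow> count i g e = 0"
  unfolding count_def by (rule pair_count_zero) (cases g, auto simp: pair_ok_def)

lemma count_leaf: "count d (map S [0..<m]) e = contribs S m e"
  unfolding count_def pair_count_upt contrib_def pair_ok_def by simp

lemma count_le: "count i g e \<le> length g * length g"
  unfolding count_def by (rule pair_count_le)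

lemma count_support:
  assumes "count i g e \<noteq> 0" "set g \<subseteq> {..<n}"
  shows "e \<le> 2 * v"
proof (rule ccontr)
  assume "\<not> e \<le> 2 * v"
  then have "count i g e = 0"
    unfolding count_def
  proof (intro pair_count_zero notI)
    fix a b assume "a \<in> set g" "b \<in> set g" "pair_ok i e a b"
    then have "val a \<le> v" "val b \<le> v" "val a + val b = e"
      using assms(2) val_le by (auto simp: pair_ok_def)
    then show False using \<open>\<not> e \<le> 2 * v\<close> by simp
  qed
  then show False using assms(1) by simp
qed

section \<open>Specifications of the stack operations\<close>

definition env :: "st \<Rightarrow> bool" where
  "env s \<longleftrightarrow> vs s Dim = d \<and> vs s Reds = nr \<and> vs s MaxV = v \<and> holds_params s \<and> (\<forall>p<n. rw s p = val p)"

definition stack :: "st \<Rightarrow> tasks \<Rightarrow> bool" where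
  "stack s ts \<longleftrightarrow> stack_holds (ar s ATI) (ar s ATM) (ar s AG) (vs s Stop) (vs s Gtop) ts"

lemma env_unchanged:
  assumes "env s" "unchanged c s s'"
    and "\<not> writes_raw c" "\<And>x. x \<in> {Dim, Reds, MaxV, Len, Grid, Scale} \<Longrightarrow> \<not> writes_var c x"
    and "\<And>a. a \<in> {FW, BW} \<Longrightarrow> \<not> writes_arr c a"
  shows "env s'"
  using assms by (simp add: env_def holds_params_def unchanged_def)

lemma pop_correct:
  assumes st: "stack s (ts @ [(i, g)])" and M: "total ts + length g + 2 < M" "length ts + 2 < M"
  shows "wp pop_task (\<lambda>t s'. t \<le> 3 * length g + 6 \<and> stack s' ts \<and> vs s' CurI = i \<and> vs s' CurM = length g \<and>
     map (ar s' AS) [0..<length g] = g) s"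
proof -
  note p = stack_pop[OF st[unfolded stack_def]]
  let ?body = "AS[Var J] ::= Arr AG (Var Gtop \<oplus> Var J)"
  let ?s = "s\<lparr>vs := (vs s)(Stop := length ts, CurI := i, CurM := length g, Gtop := total ts)\<rparr>"
  have "wp (For J (Var CurM) ?body) (\<lambda>t u. t \<le> length g * (1 + 2) + 2 \<and> (\<forall>x<length g. ar u AS x = g ! x) \<and> vs u J = length g) ?s"
  proof (rule wp_for[where N = "length g" and T = 1 and I = "\<lambda>k u. \<forall>x<k. ar u AS x = g ! x"])
    fix k and u :: st
    assume "k < length g" "\<forall>x<k. ar u AS x = g ! x" "unchanged (For J (Var CurM) ?body) ?s u" "vs u J = k"
    then show "wp ?body (\<lambda>t s'. t \<le> 1 \<and> (\<forall>x<Suc k. ar (set_var s' J (Suc k)) AS x = g ! x)) u"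
      using p(6) M by (auto simp: unchanged_def less_Suc_eq)
  qed (use M in \<open>auto simp: unchanged_def\<close>)
  then have "wp (For J (Var CurM) ?body) (\<lambda>t s'. 1 + (1 + (1 + (1 + t))) \<le> 3 * length g + 6 \<and> stack s' ts \<and> vs s' CurI = i \<and> vs s' CurM = length g \<and>
     map (ar s' AS) [0..<length g] = g) ?s"
  proof (rule wp_mono)
    fix t u
    assume un: "unchanged (For J (Var CurM) ?body) ?s u" and h: "t \<le> length g * (1 + 2) + 2 \<and> (\<forall>x<length g. ar u AS x = g ! x) \<and> vs u J = length g"
    have "map (ar u AS) [0..<length g] = g" using h by (intro nth_equalityI) auto
    moreover have "stack u ts" "vs u CurI = i" "vs u CurM = length g"
      using un p(5) by (auto simp: unchanged_def stack_def)
    ultimately show "1 + (1 + (1 + (1 + t))) \<le> 3 * length g + 6 \<and> stack u ts \<and> vs u CurI = i \<and> vs u CurM = length g \<and>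
     map (ar u AS) [0..<length g] = g" using h by auto
  qed
  then show ?thesis unfolding pop_task_def using p(1-4) M by (simp add: eval_nat_numeral)
qed

lemma split_correct:
  assumes st: "stack s ts" and g: "map (ar s AS) [0..<m] = g" "vs s CurM = m" "vs s Reds = nr" "vs s CurI = i"
    and M: "total ts + 2 * m + 2 < M" "length ts + 4 < M" "i + 2 < M"
  defines "low \<equiv> take (m div 2) g" and "high \<equiv> drop (m div 2) g"
  shows "wp split_group (\<lambda>t s'. t \<le> 10 * m + 24 \<and>
     stack s' (ts @ [(i, low), (i, high)] @ (if cross low high = [] then [] else [(Suc i, cross low high)]))) s"
proof -
  define h where "h = m div 2"
  have len: "length g = m" using g(1) by auto
  have S: "ar s AS x = g ! x" if "x < m" for x using g(1) that by auto
  have hm: "h \<le> m" by (simp add: h_def)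
  have lens: "length low = h" "length high = m - h" unfolding low_def high_def using len hm by (auto simp: h_def)
  let ?gt = "total ts" let ?st = "length ts"
  have top: "vs s Gtop = ?gt" "vs s Stop = ?st" using st by (auto simp: stack_def stack_holds_def)
  let ?b1 = "AG[Var Gtop \<oplus> Var J] ::= Arr AS (Var J)"
  let ?s = "set_var s Half h"
  have w1: "wp (For J (Var CurM) ?b1) (\<lambda>t u. t \<le> m * (1 + 2) + 2 \<and>
     ((\<forall>x<m. ar u AG (?gt + x) = g ! x) \<and> (\<forall>x<?gt. ar u AG x = ar s AG x)) \<and> vs u J = m) ?s"
  proof (rule wp_for[where N = m and T = 1 and
        I = "\<lambda>k u. (\<forall>x<k. ar u AG (?gt + x) = g ! x) \<and> (\<forall>x<?gt. ar u AG x = ar s AG x)"])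
    fix k and u :: st
    assume "k < m" "(\<forall>x<k. ar u AG (?gt + x) = g ! x) \<and> (\<forall>x<?gt. ar u AG x = ar s AG x)"
      "unchanged (For J (Var CurM) ?b1) ?s u" "vs u J = k"
    then show "wp ?b1 (\<lambda>t s'. t \<le> 1 \<and> (\<forall>x<Suc k. ar (set_var s' J (Suc k)) AG (?gt + x) = g ! x) \<and>
       (\<forall>x<?gt. ar (set_var s' J (Suc k)) AG x = ar s AG x)) u"
      using S M top by (auto simp: unchanged_def less_Suc_eq)
  qed (use M g in \<open>auto simp: unchanged_def\<close>)
  \<comment> \<open>\<open>C k\<close> is the part of the cross group found among the first
    \<open>k\<close> points: colour and half have to match, red with lower and blue with
    upper.\<close>
  define C where "C = (\<lambda>k. concat (map (\<lambda>x. if (g ! x < nr) = (x < h) then [g ! x] else []) [0..<k]))"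
  have CS: "C (Suc k) = C k @ (if (g ! k < nr) = (k < h) then [g ! k] else [])" for k
    by (simp add: C_def)
  have Clen: "length (C k) \<le> k" for k by (induction k) (auto simp: CS, simp add: C_def)
  have Cm: "C m = cross low high"
  proof -
    have up: "[0..<m] = [0..<h] @ [h..<m]" using hm upt_add_eq_append[of 0 h "m - h"] by simp
    have a: "concat (map (\<lambda>x. if P x then [f x] else []) xs) = map f (filter P xs)" for P and f :: "nat \<Rightarrow> nat" and xs
      by (induction xs) auto
    have "C m = map ((!) g) (filter (\<lambda>x. g ! x < nr) [0..<h]) @ map ((!) g) (filter (\<lambda>x. \<not> g ! x < nr) [h..<m])"
      unfolding C_def a up filter_append map_append
      by (intro arg_cong2[of _ _ _ _ "(@)"] arg_cong[of _ _ "map ((!) g)"] filter_cong refl) auto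
    moreover have "low = map ((!) g) [0..<h]" "high = map ((!) g) [h..<m]"
      unfolding low_def high_def h_def[symmetric] using hm len
      by (auto intro!: nth_equalityI simp: h_def[symmetric])
    ultimately show ?thesis by (simp add: cross_def filter_map o_def)
  qed
  let ?b2 = "Pt ::= Arr AS (Var J) ;;
         IfLess (Var Pt) (Var Reds)
           (IfLess (Var J) (Var Half) push_cross Skip)
           (IfLess (Var J) (Var Half) Skip push_cross)"
  have w2: "wp (For J (Var CurM) ?b2) (\<lambda>t u. t \<le> m * (5 + 2) + 2 \<and>
     (vs u Cr = length (C m) \<and> (\<forall>x<length (C m). ar u AG (?gt + m + x) = C m ! x) \<and> (\<forall>x<?gt + m. ar u AG x = ar y AG x)) \<and> vs u J = m) y"
    if y: "vs y Cr = 0" "vs y Gtop = ?gt + m" "vs y CurM = m" "vs y Reds = nr" "vs y Half = h" "ar y AS = ar s AS" for y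
  proof (rule wp_for[where N = m and T = 5 and
        I = "\<lambda>k u. vs u Cr = length (C k) \<and> (\<forall>x<length (C k). ar u AG (?gt + m + x) = C k ! x) \<and> (\<forall>x<?gt + m. ar u AG x = ar y AG x)"])
    fix k and u :: st
    assume k: "k < m" and IH: "vs u Cr = length (C k) \<and> (\<forall>x<length (C k). ar u AG (?gt + m + x) = C k ! x) \<and> (\<forall>x<?gt + m. ar u AG x = ar y AG x)"
      and un: "unchanged (For J (Var CurM) ?b2) y u" and uk: "vs u J = k"
    have e: "vs u Gtop = ?gt + m" "vs u Reds = nr" "vs u Half = h" "ar u AS = ar s AS"
      using un y by (simp_all add: unchanged_def)
    have bd: "k < M" "?gt + m + length (C k) < M" "Suc (length (C k)) < M" "0 < M" "1 < M"
      using Clen[of k] k M by linarith+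
    show "wp ?b2 (\<lambda>t s'. t \<le> 5 \<and> vs (set_var s' J (Suc k)) Cr = length (C (Suc k)) \<and>
       (\<forall>x<length (C (Suc k)). ar (set_var s' J (Suc k)) AG (?gt + m + x) = C (Suc k) ! x) \<and>
       (\<forall>x<?gt + m. ar (set_var s' J (Suc k)) AG x = ar y AG x)) u"
    proof (cases "(g ! k < nr) = (k < h)")
      case True
      then show ?thesis using IH e uk bd S[OF k]
        by (cases "k < h") (auto simp: CS push_cross_def nth_append less_Suc_eq)
    next
      case False
      then show ?thesis using IH e uk bd S[OF k]
        by (cases "k < h") (auto simp: CS push_cross_def)
    qed
  qed (use y M in \<open>auto simp: unchanged_def C_def\<close>)
  let ?b3 = "IfLess (Num 0) (Var Cr)
        (push_task (Var CurI \<oplus> Num 1) (Var Cr) ;; Gtop ::= Var Gtop \<oplus> Var Cr) Skip"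
  let ?c2 = "Gtop ::= Var Gtop \<oplus> Var CurM ;;
      push_task (Var CurI) (Var Half) ;;
      push_task (Var CurI) (Var CurM \<ominus> Var Half) ;; Cr ::= Num 0"
  have main: "wp ?c2 (\<lambda>t2 y. t2 = 8 \<and> vs y Cr = 0 \<and> vs y CurM = m \<and> vs y Reds = nr \<and> vs y Half = h \<and> vs y CurI = i \<and>
       ar y AS = ar s AS \<and> stack y (ts @ [(i, low), (i, high)])) u"
    if u: "unchanged (For J (Var CurM) ?b1) ?s u" "\<forall>x<m. ar u AG (?gt + x) = g ! x" "\<forall>x<?gt. ar u AG x = ar s AG x" for u
  proof -
    have e: "vs u Gtop = ?gt" "vs u Stop = ?st" "vs u CurM = m" "vs u Reds = nr" "vs u Half = h" "vs u CurI = i"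
      "ar u AS = ar s AS" "ar u ATI = ar s ATI" "ar u ATM = ar s ATM"
      using u(1) g top by (simp_all add: unchanged_def)
    have "stack_holds (ar s ATI) (ar s ATM) (ar s AG) ?st ?gt ts" using st top by (simp add: stack_def)
    then have "stack_holds ((ar s ATI)(?st := i)) ((ar s ATM)(?st := length low)) (ar u AG) (Suc ?st) (?gt + length low) (ts @ [(i, low)])"
      by (rule stack_push) (use u lens hm len in \<open>auto simp: low_def\<close>)
    then have "stack_holds ((ar s ATI)(?st := i, Suc ?st := i)) ((ar s ATM)(?st := length low, Suc ?st := length high)) (ar u AG)
        (Suc (Suc ?st)) (?gt + length low + length high) ((ts @ [(i, low)]) @ [(i, high)])"
      by (rule stack_push) (use u lens hm len in \<open>auto simp: high_def h_def[symmetric] add.assoc\<close>)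
    then have "stack_holds ((ar s ATI)(?st := i, Suc ?st := i)) ((ar s ATM)(?st := h, Suc ?st := m - h)) (ar u AG)
        (Suc (Suc ?st)) (?gt + m) (ts @ [(i, low), (i, high)])"
      using lens hm by simp
    then show ?thesis
      using e M hm by (simp add: push_task_def stack_def eval_nat_numeral)
  qed
  have fin: "wp ?b3 (\<lambda>t4 z. t4 \<le> 5 \<and>
     stack z (ts @ [(i, low), (i, high)] @ (if cross low high = [] then [] else [(Suc i, cross low high)]))) x"
    if un: "unchanged (For J (Var CurM) ?b2) y x" and y: "vs y Reds = nr" "vs y CurI = i" "stack y (ts @ [(i, low), (i, high)])"
      and x: "vs x Cr = length (C m)" "\<forall>z<length (C m). ar x AG (?gt + m + z) = C m ! z" "\<forall>z<?gt + m. ar x AG z = ar y AG z" for x y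
  proof -
    have ty: "vs y Stop = ?st + 2" "vs y Gtop = ?gt + m"
      using y(3) lens hm by (auto simp: stack_def stack_holds_def)
    have ex: "vs x Stop = ?st + 2" "vs x Gtop = ?gt + m" "ar x ATI = ar y ATI" "ar x ATM = ar y ATM" "vs x CurI = i"
      using un y ty by (simp_all add: unchanged_def)
    have sy: "stack_holds (ar y ATI) (ar y ATM) (ar y AG) (?st + 2) (?gt + m) (ts @ [(i, low), (i, high)])"
      using y(3) ty by (simp add: stack_def)
    show ?thesis
    proof (cases "C m = []")
      case True
      have "stack_holds (ar x ATI) (ar x ATM) (ar x AG) (?st + 2) (?gt + m) (ts @ [(i, low), (i, high)])"
        using sy x ex unfolding stack_holds_def by simp
      then show ?thesis using True ex x M Cm by (simp add: stack_def)
    next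
      case False
      have "stack_holds ((ar x ATI)(?st + 2 := Suc i)) ((ar x ATM)(?st + 2 := length (C m))) (ar x AG) (Suc (?st + 2)) (?gt + m + length (C m))
         ((ts @ [(i, low), (i, high)]) @ [(Suc i, C m)])"
        unfolding ex by (rule stack_push[OF sy]) (use x in auto)
      then show ?thesis using False ex x M Cm Clen[of m] by (simp add: push_task_def stack_def)
    qed
  qed
  \<comment> \<open>Regroups the four statements between the two loops into the block
    \<open>?c2\<close> that \<open>main\<close> describes.\<close>
  have assoc: "wp (Gtop ::= Var Gtop \<oplus> Var CurM ;; push_task (Var CurI) (Var Half) ;;
      push_task (Var CurI) (Var CurM \<ominus> Var Half) ;; Cr ::= Num 0 ;; c) Q u =
      wp ?c2 (\<lambda>t u. wp c (\<lambda>t'. Q (t + t')) u) u" for c Q u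
    by (simp add: add.assoc)
  have "wp split_group (\<lambda>t s'. t \<le> 10 * m + 24 \<and>
     stack s' (ts @ [(i, low), (i, high)] @ (if cross low high = [] then [] else [(Suc i, cross low high)]))) s"
    unfolding split_group_def wp_Seq[of "Half ::= _"] wp_Assign[of Half]
  proof (intro conjI)
    show "chk (Op Div (Var CurM) (Num 2)) s" using M by simp
    have ev: "ev (Op Div (Var CurM) (Num 2)) s = h" using g by (simp add: h_def)
    show "wp (For J (Var CurM) ?b1 ;; Gtop ::= Var Gtop \<oplus> Var CurM ;; push_task (Var CurI) (Var Half) ;;
      push_task (Var CurI) (Var CurM \<ominus> Var Half) ;; Cr ::= Num 0 ;; For J (Var CurM) ?b2 ;; ?b3)
      (\<lambda>t' s'. 1 + t' \<le> 10 * m + 24 \<and>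
     stack s' (ts @ [(i, low), (i, high)] @ (if cross low high = [] then [] else [(Suc i, cross low high)])))
      (s\<lparr>vs := (vs s)(Half := ev (Op Div (Var CurM) (Num 2)) s)\<rparr>)"
      unfolding ev wp_Seq[of "For J (Var CurM) ?b1"]
    proof (rule wp_mono[OF w1])
      fix t u
      assume un1: "unchanged (For J (Var CurM) ?b1) ?s u"
        and h1: "t \<le> m * (1 + 2) + 2 \<and> ((\<forall>x<m. ar u AG (?gt + x) = g ! x) \<and> (\<forall>x<?gt. ar u AG x = ar s AG x)) \<and> vs u J = m"
      show "wp (Gtop ::= Var Gtop \<oplus> Var CurM ;; push_task (Var CurI) (Var Half) ;;
         push_task (Var CurI) (Var CurM \<ominus> Var Half) ;; Cr ::= Num 0 ;; For J (Var CurM) ?b2 ;; ?b3)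
         (\<lambda>t' s'. 1 + (t + t') \<le> 10 * m + 24 \<and>
           stack s' (ts @ [(i, low), (i, high)] @ (if cross low high = [] then [] else [(Suc i, cross low high)]))) u"
        unfolding assoc
      proof (rule wp_mono[OF main[OF un1]])
        fix t2 :: nat and y :: st
        assume h2: "t2 = 8 \<and> vs y Cr = 0 \<and> vs y CurM = m \<and> vs y Reds = nr \<and> vs y Half = h \<and> vs y CurI = i \<and>
          ar y AS = ar s AS \<and> stack y (ts @ [(i, low), (i, high)])"
        have yG: "vs y Gtop = ?gt + m" using h2 lens hm by (auto simp: stack_def stack_holds_def)
        show "wp (For J (Var CurM) ?b2 ;; ?b3) (\<lambda>t' s'. 1 + (t + (t2 + t')) \<le> 10 * m + 24 \<and>
           stack s' (ts @ [(i, low), (i, high)] @ (if cross low high = [] then [] else [(Suc i, cross low high)]))) y"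
          unfolding wp_Seq[of "For J (Var CurM) ?b2"]
        proof (rule wp_mono[OF w2])
          fix t3 x
          assume un3: "unchanged (For J (Var CurM) ?b2) y x" and h3: "t3 \<le> m * (5 + 2) + 2 \<and>
             (vs x Cr = length (C m) \<and> (\<forall>z<length (C m). ar x AG (?gt + m + z) = C m ! z) \<and> (\<forall>z<?gt + m. ar x AG z = ar y AG z)) \<and> vs x J = m"
          show "wp ?b3 (\<lambda>t' s'. 1 + (t + (t2 + (t3 + t'))) \<le> 10 * m + 24 \<and>
           stack s' (ts @ [(i, low), (i, high)] @ (if cross low high = [] then [] else [(Suc i, cross low high)]))) x"
            by (rule wp_mono[OF fin[OF un3]]) (use h1 h2 h3 in auto)
        qed (use h2 yG in auto)
      qed (use h1 in auto)
    qed
  qed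
  then show ?thesis .
qed

end

lemma writes_process:
  "writes_var (process r q) x \<Longrightarrow> x \<notin> {Dim, Reds, Blues, Pts, MaxV, Len, Pow, Grid, Scale, CurI, CurM}"
  "writes_arr (process r q) a \<Longrightarrow> a \<notin> {FW, BW}" "\<not> writes_raw (process r q)"
  by (auto simp: process_def)

text \<open>Here \<open>pot i m\<close> bounds the time for a task with \<open>m\<close> points and coordinates \<open>i, \<dots>, d - 1\<close> left.\<close>

locale timed = problem +
  fixes pot :: "nat \<Rightarrow> nat \<Rightarrow> real"
  assumes pot_nonneg: "0 \<le> pot i m"
    and pot_one: "i < d \<Longrightarrow> 20 \<le> pot i 1"
    and pot_split: "i < d \<Longrightarrow> 2 \<le> m \<Longrightarrow> m \<le> n \<Longrightarrow> \<exists>P. m \<le> 2 ^ P \<and> (\<forall>c\<le>m.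
      real (13 * m + 40 + P * (8 + 27 * m)) + pot i (m div 2) + pot i (m - m div 2) +
      pot (Suc i) c \<le> pot i m)"
    and pot_pairs: "1 \<le> m \<Longrightarrow> m \<le> n \<Longrightarrow> m * m \<le> v \<Longrightarrow> real (3 * m + 20 + m * (m * 10 + 5)) \<le> pot d m"
    and pot_conv: "1 \<le> m \<Longrightarrow> m \<le> n \<Longrightarrow> v < m * m \<Longrightarrow>
      real (3 * m + 20 + (q ^ L + m) * (L + 1) * (9 * q + 80)) \<le> pot d m"
begin

definition tot :: "nat \<Rightarrow> nat" where
  "tot = count 0 [0..<n]"

definition tasks_ok :: "tasks \<Rightarrow> bool" where
  "tasks_ok ts \<longleftrightarrow> bounded_stack n ts \<and>
     (\<forall>(i, g) \<in> set ts. i \<le> d \<and> g \<noteq> [] \<and> set g \<subseteq> {..<n} \<and> length g \<le> n)"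

definition pending :: "tasks \<Rightarrow> nat \<Rightarrow> nat" where
  "pending ts e = (\<Sum>(i, g)\<leftarrow>ts. count i g e)"

definition potential :: "tasks \<Rightarrow> real" where
  "potential ts = (\<Sum>(i, g)\<leftarrow>ts. pot i (length g))"

text \<open>A conservation law: what has been accumulated plus what the tasks still owe is the final
  result. With an empty stack the accumulator is therefore complete.\<close>

definition inv :: "tasks \<Rightarrow> st \<Rightarrow> bool" where
  "inv ts s \<longleftrightarrow> env s \<and> stack s ts \<and> tasks_ok ts \<and>
     (\<exists>f. acc_holds s f \<and> (\<forall>e. f e + pending ts e = tot e))"

lemma tot_le: "tot e \<le> n * n"
  using count_le[of 0 "[0..<n]" e] by (simp add: tot_def)

lemma tot_support: "tot e \<noteq> 0 \<Longrightarrow> e \<le> 2 * v"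
  unfolding tot_def by (rule count_support) auto

lemma pending_simps [simp]:
  "pending [] e = 0" "pending ((i, g) # ts) e = count i g e + pending ts e"
  "pending (ts @ us) e = pending ts e + pending us e"
  by (auto simp: pending_def)

lemma potential_simps [simp]:
  "potential [] = 0" "potential ((i, g) # ts) = pot i (length g) + potential ts"
  "potential (ts @ us) = potential ts + potential us"
  by (auto simp: potential_def)

lemma potential_nonneg: "0 \<le> potential ts"
  by (induction ts) (auto simp: pot_nonneg)

lemma tasks_ok_snoc:
  "tasks_ok (ts @ [(i, g)]) \<longleftrightarrow> tasks_ok ts \<and> total ts + length g \<le> (i + 1) * n \<and>
     i \<le> d \<and> g \<noteq> [] \<and> set g \<subseteq> {..<n} \<and> length g \<le> n"
  by (auto simp: tasks_ok_def bounded_stack_snoc)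

text \<open>Groups are non-empty, so the bound on the points in the stack also bounds the number of
  tasks, and with it the indices into \<open>ATI\<close> and \<open>ATM\<close>.\<close>

lemma length_le_total: "tasks_ok ts \<Longrightarrow> length ts \<le> total ts"
proof (induction ts rule: rev_induct)
  case (snoc x ts)
  obtain i g where x: "x = (i, g)" by (cases x)
  have "length ts \<le> total ts" "1 \<le> length g"
    using snoc by (auto simp: x tasks_ok_snoc Suc_le_eq)
  then show ?case by (simp add: x)
qed simp

text \<open>The budget of the popped task also pays \<open>3 * length g + 7\<close>, the cost of
  popping it and of the loop test. What remains goes to the tasks pushed in its place.\<close>

lemma process_correct:
  assumes e: "env s" "stack s ts" "tasks_ok (ts @ [(i, g)])" "acc_holds s f"
    and f: "\<And>e. f e + pending (ts @ [(i, g)]) e = tot e"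
    and cur: "vs s CurI = i" "vs s CurM = length g" "map (ar s AS) [0..<length g] = g"
  shows "wp (process r q) (\<lambda>t s'. \<exists>ts'. inv ts' s' \<and>
     real (3 * length g + 7 + t) + potential ts' \<le> potential (ts @ [(i, g)])) s"
proof -
  define m where "m = length g"
  define S where "S = ar s AS"
  have ok: "tasks_ok ts" "total ts + m \<le> (i + 1) * n" "i \<le> d" "g \<noteq> []" "set g \<subseteq> {..<n}" "m \<le> n"
    using e(3) by (auto simp: tasks_ok_snoc m_def)
  have m1: "1 \<le> m" using ok(4) by (simp add: m_def Suc_le_eq)
  have g: "g = map S [0..<m]" using cur by (simp add: S_def m_def)
  have Sn: "S x < n" if "x < m" for x
  proof -
    have "S x \<in> set g" using that by (simp add: g)
    then show ?thesis using ok(5) by blast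
  qed
  have i1: "(i + 1) * n \<le> (d + 1) * n" using ok(3) by (intro mult_le_mono1) simp
  have M: "total ts + 3 * m + 4 < M" "length ts + 4 < M" "i + 2 < M" "m < M" "2 * m < M" "1 < M" "m * m < M" "v + 1 < M"
  proof -
    have "total ts + m \<le> (d + 1) * n" using ok(2) i1 by linarith
    moreover have "(d + 4) * n = (d + 1) * n + 3 * n" by (simp add: algebra_simps)
    ultimately show "total ts + 3 * m + 4 < M" using stack_M ok(6) by linarith
    then show "length ts + 4 < M" "m < M" "2 * m < M" "1 < M" using length_le_total[OF ok(1)] by linarith+
    show "i + 2 < M" using d_M ok(3) by simp
    have "m * m \<le> n * n" using ok(6) by (intro mult_le_mono)
    then show "m * m < M" using nn_M by simp
    show "v + 1 < M" using v_less by simp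
  qed
  have ev: "vs s Dim = d" "vs s Reds = nr" "vs s MaxV = v" "holds_params s" "\<And>p. p < n \<Longrightarrow> rw s p = val p"
    using e(1) by (auto simp: env_def)
  have hg: "holds_group s S m"
    using ev cur Sn M by (simp add: holds_group_def S_def m_def)
  have ft: "f e' + pending ts e' + count i g e' = tot e'" for e' using f[of e'] by simp
  have fs: "e' \<le> 2 * v" if "f e' \<noteq> 0" for e'
    using tot_support[of e'] ft[of e'] that by linarith
  have fM: "f e' + count i g e' < M" for e'
    using ft[of e'] tot_le[of e'] nn_M by linarith
  show ?thesis
  proof (cases "i < d")
    case i: True
    show ?thesis
    proof (cases "1 < m")
      case False
      then have m: "m = 1" using m1 by simp
      have "count i g e' = 0" for e' by (rule count_single) (use m m_def in simp)
      then have "inv ts s"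
        using e ok ft unfolding inv_def by auto
      moreover have "real (3 * length g + 7 + 2) + potential ts \<le> potential (ts @ [(i, g)])"
        using pot_one[OF i] m by (simp add: m_def[symmetric])
      ultimately show ?thesis
        unfolding process_def using i False ev cur M by (auto simp: m_def[symmetric] intro!: exI[of _ ts])
    next
      case True
      define low where "low = (\<lambda>g :: nat list. take (m div 2) g)"
      define high where "high = (\<lambda>g :: nat list. drop (m div 2) g)"
      \<comment> \<open>The new stack is a function of the sorted list, which is only known to be
        some sorted permutation of \<open>g\<close>.\<close>
      define new where "new = (\<lambda>g. ts @ [(i, low g), (i, high g)] @
         (if cross (low g) (high g) = [] then [] else [(Suc i, cross (low g) (high g))]))"
      have clen: "length (cross (low h) (high h)) \<le> m" if "length h = m" for h
      proof -
        have "length (filter (\<lambda>p. p < nr) (low h)) \<le> m div 2" "length (filter (\<lambda>p. \<not> p < nr) (high h)) \<le> m - m div 2"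
          using length_filter_le[of _ "low h"] length_filter_le[of _ "high h"] that
          by (fastforce simp: low_def high_def intro: order_trans)+
        then show ?thesis by (simp add: cross_def)
      qed
      define c where "c = (\<lambda>h. length (cross (low h) (high h)))"
      have idx: "ar s AS x * vs s Dim + vs s CurI < M" if "x < vs s CurM" for x
      proof -
        have "S x < n" using Sn that cur by (simp add: m_def)
        then have "S x * d \<le> n * d" by (intro mult_le_mono1) simp
        then have "S x * d + i < M" using nd_M i by linarith
        then show ?thesis using ev cur by (simp add: S_def)
      qed
      have new_inv: "inv (new h) s'"
        if un: "env s'" "acc_holds s' f" "stack s' (new h)" and h: "mset h = mset g"
          and srt: "sorted_seg (le_at d nr i) ((!) h) 0 m" for s' h
      proof -
        have lh: "length h = m" using h by (metis m_def size_mset)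
        have sh: "set h = set g" using h by (rule mset_eq_setD)
        have gl: "low h @ high h = h" by (simp add: low_def high_def)
        have sub: "set (low h) \<subseteq> set g" "set (high h) \<subseteq> set g" "set (cross (low h) (high h)) \<subseteq> set g"
          using sh set_take_subset[of "m div 2" h] set_drop_subset[of "m div 2" h]
          by (auto simp: low_def high_def cross_def)
        have ll: "length (low h) = m div 2" "length (high h) = m - m div 2" using lh by (auto simp: low_def high_def)
        have ne: "low h \<noteq> []" "high h \<noteq> []" using ll True by auto
        have "count i g e' = count i (low h @ high h) e'" for e' using count_mset[OF h] gl by metis
        also have "\<And>e'. count i (low h @ high h) e' = count i (low h) e' + count i (high h) e' + count (Suc i) (cross (low h) (high h)) e'"
        proof (rule count_split[OF i])
          fix p u assume "p \<in> set (low h)" "u \<in> set (high h)"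
          then obtain x y where xy: "x < length (low h)" "low h ! x = p" "y < length (high h)" "high h ! y = u"
            by (metis in_set_conv_nth)
          have "p = h ! x" "u = h ! (m div 2 + y)" using xy lh by (auto simp: low_def high_def)
          moreover have "x < m div 2 + y" "m div 2 + y < m" using xy ll by auto
          ultimately show "le_at d nr i p u" using srt by (simp add: sorted_seg_def)
        qed
        finally have "pending (new h) e' = pending (ts @ [(i, g)]) e'" for e'
          unfolding new_def by (auto simp: count_def pair_count_def)
        moreover have "tasks_ok (new h)"
        proof -
          have t1: "tasks_ok (ts @ [(i, low h)])"
            unfolding tasks_ok_snoc using ok ll ne sub by auto
          have t2: "tasks_ok ((ts @ [(i, low h)]) @ [(i, high h)])"
            unfolding tasks_ok_snoc[of "ts @ [(i, low h)]"] using t1 ok ll ne sub by auto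
          show ?thesis
          proof (cases "cross (low h) (high h) = []")
            case True
            then show ?thesis using t2 by (simp add: new_def)
          next
            case False
            have "tasks_ok (((ts @ [(i, low h)]) @ [(i, high h)]) @ [(Suc i, cross (low h) (high h))])"
              unfolding tasks_ok_snoc[of "(ts @ [(i, low h)]) @ [(i, high h)]"] 
              using t2 ok ll False sub clen[OF lh] i by auto
            then show ?thesis using False by (simp add: new_def)
          qed
        qed
        ultimately show ?thesis unfolding inv_def using that f by auto
      qed
      obtain P where P: "m \<le> 2 ^ P" and Pc: "\<And>c. c \<le> m \<Longrightarrow> real (13 * m + 40 + P * (8 + 27 * m)) +
          pot i (m div 2) + pot i (m - m div 2) + pot (Suc i) c \<le> pot i m"
        using pot_split[OF i, of m] True ok(6) by auto
      have Pp: "real (13 * m + 40 + P * (8 + 27 * m)) + potential (new h) \<le> potential (ts @ [(i, g)])"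
        if lh: "length h = m" for h
      proof -
        have "potential (new h) \<le> potential ts + pot i (m div 2) + pot i (m - m div 2) + pot (Suc i) (length (cross (low h) (high h)))"
          using pot_nonneg[of "Suc i"] lh by (auto simp: new_def low_def high_def)
        then show ?thesis using Pc[OF clen[OF lh]] by (simp add: m_def[symmetric])
      qed
      have len_sorted: "length (map (ar u AS) [0..<m]) = m" for u :: st by simp
      have "wp (sort ;; split_group) (\<lambda>t s'. \<exists>h. t \<le> 26 + P * (8 + 27 * m) + 10 * m \<and> inv (new h) s' \<and> length h = m) s"
        unfolding wp_Seq
      proof (rule wp_mono[OF sort_correct[of s P]])
        fix t u
        assume un: "unchanged sort s u" and "t \<le> 2 + P * (8 + 27 * vs s CurM) \<and>
          sorted_seg (le_at (vs s Dim) (vs s Reds) (vs s CurI)) (ar u AS) 0 (vs s CurM) \<and>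
          mset (map (ar u AS) [0..<vs s CurM]) = mset (map (ar s AS) [0..<vs s CurM])"
        then have h: "t \<le> 2 + P * (8 + 27 * m)" "sorted_seg (le_at d nr i) (ar u AS) 0 m"
          "mset (map (ar u AS) [0..<m]) = mset g" using cur ev unfolding m_def by simp_all
        define h where "h = map (ar u AS) [0..<m]"
        have eu: "vs u CurM = m" "vs u Reds = nr" "vs u CurI = i" "stack u ts"
          using un ev cur e(2) by (simp_all add: unchanged_def m_def stack_def)
        have envu: "env u" by (rule env_unchanged[OF e(1) un]) auto
        have accu: "acc_holds u f" by (rule acc_holds_cong[OF e(4)]) (use un in \<open>auto simp: unchanged_def\<close>)
        have "wp split_group (\<lambda>t s'. t \<le> 10 * m + 24 \<and> stack s' (new h)) u"
          unfolding new_def low_def high_def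
          by (rule split_correct) (use eu M in \<open>auto simp: h_def\<close>)
        then show "wp split_group (\<lambda>t' s'. \<exists>h. t + t' \<le> 26 + P * (8 + 27 * m) + 10 * m \<and> inv (new h) s' \<and> length h = m) u"
        proof (rule wp_mono)
          fix t' s'
          assume un': "unchanged split_group u s'" and h': "t' \<le> 10 * m + 24 \<and> stack s' (new h)"
          have "env s'" by (rule env_unchanged[OF envu un']) auto
          moreover have "acc_holds s' f" by (rule acc_holds_cong[OF accu]) (use un' in \<open>auto simp: unchanged_def\<close>)
          moreover have "sorted_seg (le_at d nr i) ((!) h) 0 m" using h(2) by (auto simp: sorted_seg_def h_def)
          ultimately have "inv (new h) s'" by (intro new_inv) (use h' h(3) in \<open>auto simp: h_def\<close>)
          then show "\<exists>h. t + t' \<le> 26 + P * (8 + 27 * m) + 10 * m \<and> inv (new h) s' \<and> length h = m"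
            using h(1) h' by (intro exI[of _ h]) (auto simp: h_def)
        qed
      qed (use M P cur idx m_def in auto)
      then have "wp (sort ;; split_group) (\<lambda>t s'. \<exists>ts'. inv ts' s' \<and>
        real (3 * length g + 7 + Suc (Suc t)) + potential ts' \<le> potential (ts @ [(i, g)])) s"
      proof (rule wp_mono)
        fix t s'
        assume "\<exists>h. t \<le> 26 + P * (8 + 27 * m) + 10 * m \<and> inv (new h) s' \<and> length h = m"
        then obtain h where h: "t \<le> 26 + P * (8 + 27 * m) + 10 * m" "inv (new h) s'" "length h = m" by blast
        have "real (3 * length g + 7 + Suc (Suc t)) \<le> real (13 * m + 40 + P * (8 + 27 * m))"
          using h(1) unfolding of_nat_le_iff m_def[symmetric] by linarith
        then have "real (3 * length g + 7 + Suc (Suc t)) + potential (new h) \<le> potential (ts @ [(i, g)])"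
          using Pp[OF h(3)] by linarith
        then show "\<exists>ts'. inv ts' s' \<and> real (3 * length g + 7 + Suc (Suc t)) + potential ts' \<le> potential (ts @ [(i, g)])"
          using h(2) by blast
      qed
      moreover have "ev (Var CurI) s < ev (Var Dim) s" "chk (Num 1) s" "ev (Num 1) s < ev (Var CurM) s"
        using ev cur i True M m_def by simp_all
      ultimately show ?thesis unfolding process_def
        by (simp only: wp_If if_True simp_thms chk.simps)
    qed
  next
    case False
    then have i: "i = d" using ok(3) by simp
    define f' where "f' = (\<lambda>e. f e + contribs S m e)"
    have cl: "count i g e' = contribs S m e'" for e'
      unfolding g i by (rule count_leaf)
    have fin: "inv ts s'" if "unchanged (process r q) s s'" "acc_holds s' f'" "stack s' ts" for s'
    proof -
      have "env s'"
        by (rule env_unchanged[OF e(1) that(1)]) (use writes_process in blast)+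
      moreover have "f' e' + pending ts e' = tot e'" for e'
        using ft[of e'] cl[of e'] by (simp add: f'_def)
      ultimately show ?thesis using that ok(1) unfolding inv_def by blast
    qed
    show ?thesis
    proof (cases "m * m < v + 1")
      case True
      have "wp pairs (\<lambda>t s'. t \<le> m * (m * 10 + 5) + 2 \<and> acc_holds s' f') s"
        unfolding f'_def by (rule pairs_correct[OF hg e(4) fs]) (assumption | rule fM[unfolded cl])+
      then have "wp pairs (\<lambda>t s'. t \<le> m * (m * 10 + 5) + 2 \<and> acc_holds s' f' \<and> stack s' ts) s"
        by (rule wp_mono) (use e(2) in \<open>auto simp: unchanged_def stack_def\<close>)
      then have "wp (process r q) (\<lambda>t s'. t \<le> m * (m * 10 + 5) + 4 \<and> acc_holds s' f' \<and> stack s' ts) s"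
        unfolding process_def using i True cur ev M by (simp add: m_def[symmetric])
      then show ?thesis
      proof (rule wp_mono)
        fix t s' assume un: "unchanged (process r q) s s'" and h: "t \<le> m * (m * 10 + 5) + 4 \<and> acc_holds s' f' \<and> stack s' ts"
        have "real (3 * m + 7 + t) \<le> real (3 * m + 20 + m * (m * 10 + 5))"
          using h by (simp only: of_nat_le_iff) linarith
        also have "\<dots> \<le> pot d m" using pot_pairs[OF m1 ok(6)] True by simp
        finally have "real (3 * m + 7 + t) + potential ts \<le> potential (ts @ [(i, g)])"
          by (simp add: i m_def)
        then show "\<exists>ts'. inv ts' s' \<and> real (3 * length g + 7 + t) + potential ts' \<le> potential (ts @ [(i, g)])"
          using fin[OF un] h unfolding m_def by blast
      qed
    next
      case False
      have "wp (convolve r q) (\<lambda>t s'. t \<le> (q ^ L + m) * (L + 1) * (9 * q + 80) \<and> acc_holds s' f') s"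
        unfolding f'_def by (rule convolve_correct[OF hg ev(4) e(4) fs]) (assumption | rule fM[unfolded cl] M)+
      then have "wp (convolve r q) (\<lambda>t s'. t \<le> (q ^ L + m) * (L + 1) * (9 * q + 80) \<and> acc_holds s' f' \<and> stack s' ts) s"
        by (rule wp_mono) (use e(2) in \<open>auto simp: unchanged_def stack_def\<close>)
      then have "wp (convolve r q) (\<lambda>t s'. Suc (Suc t) \<le> (q ^ L + m) * (L + 1) * (9 * q + 80) + 2 \<and> acc_holds s' f' \<and> stack s' ts) s"
        by (rule wp_mono) auto
      then have "wp (process r q) (\<lambda>t s'. t \<le> (q ^ L + m) * (L + 1) * (9 * q + 80) + 2 \<and> acc_holds s' f' \<and> stack s' ts) s"
        unfolding process_def using i False cur ev M by (simp add: m_def[symmetric])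
      then show ?thesis
      proof (rule wp_mono)
        fix t s' assume un: "unchanged (process r q) s s'" and h: "t \<le> (q ^ L + m) * (L + 1) * (9 * q + 80) + 2 \<and> acc_holds s' f' \<and> stack s' ts"
        have "real (3 * m + 7 + t) \<le> real (3 * m + 20 + (q ^ L + m) * (L + 1) * (9 * q + 80))"
          using h by (simp only: of_nat_le_iff) linarith
        also have "\<dots> \<le> pot d m" using pot_conv[OF m1 ok(6)] False by simp
        finally have "real (3 * m + 7 + t) + potential ts \<le> potential (ts @ [(i, g)])"
          by (simp add: i m_def)
        then show "\<exists>ts'. inv ts' s' \<and> real (3 * length g + 7 + t) + potential ts' \<le> potential (ts @ [(i, g)])"
          using fin[OF un] h unfolding m_def by blast
      qed
    qed
  qed
qed

lemma main_loop_correct: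
  assumes "inv ts s"
  shows "wp (main_loop r q) (\<lambda>t s'. real t \<le> potential ts + 1 \<and> acc_holds s' tot) s"
proof -
  let ?body = "pop_task ;; process r q"
  have "wp (While (Num 0) (Var Stop) ?body) (\<lambda>t s'. real t \<le> potential ts + 1 \<and> (\<exists>ts. inv ts s') \<and> \<not> ev (Num 0) s' < ev (Var Stop) s') s"
  proof (rule wp_while[where I = inv and pot = potential])
    fix ts u
    assume I: "inv ts u" and un: "unchanged ?body s u"
    have 0: "0 < M" using d_M by simp
    show "chk (Num 0) u \<and> chk (Var Stop) u \<and> (ev (Num 0) u < ev (Var Stop) u \<longrightarrow>
      wp ?body (\<lambda>t s'. \<exists>ts'. inv ts' s' \<and> real t + 1 + potential ts' \<le> potential ts) u)"
    proof (intro conjI impI)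
      assume "ev (Num 0) u < ev (Var Stop) u"
      then have "ts \<noteq> []" using I by (auto simp: inv_def stack_def stack_holds_def)
      then obtain ts0 i g where ts: "ts = ts0 @ [(i, g)]"
        by (metis rev_exhaust surj_pair)
      obtain f where f: "acc_holds u f" "\<And>e. f e + pending ts e = tot e" using I unfolding inv_def by blast
      have ok: "env u" "stack u (ts0 @ [(i, g)])" "tasks_ok (ts0 @ [(i, g)])" using I by (auto simp: inv_def ts)
      have k: "tasks_ok ts0" "total ts0 + length g \<le> (i + 1) * n" "i \<le> d" "length g \<le> n" "g \<noteq> []"
        using ok(3) by (auto simp: tasks_ok_snoc)
      have "(i + 1) * n \<le> (d + 1) * n" using k(3) by (intro mult_le_mono1) simp
      moreover have "(d + 4) * n = (d + 1) * n + 3 * n" by (simp add: algebra_simps)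
      ultimately have M: "total ts0 + length g + 2 < M" "length ts0 + 2 < M"
        using stack_M k(2) length_le_total[OF k(1)] by linarith+
      show "wp ?body (\<lambda>t s'. \<exists>ts'. inv ts' s' \<and> real t + 1 + potential ts' \<le> potential ts) u"
        unfolding wp_Seq
      proof (rule wp_mono[OF pop_correct[OF ok(2) M]])
        fix t x
        assume un': "unchanged pop_task u x" and h: "t \<le> 3 * length g + 6 \<and> stack x ts0 \<and> vs x CurI = i \<and>
          vs x CurM = length g \<and> map (ar x AS) [0..<length g] = g"
        have "env x" by (rule env_unchanged[OF ok(1) un']) auto
        moreover have "acc_holds x f" by (rule acc_holds_cong[OF f(1)]) (use un' in \<open>auto simp: unchanged_def\<close>)
        ultimately have "wp (process r q) (\<lambda>t s'. \<exists>ts'. inv ts' s' \<and>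
           real (3 * length g + 7 + t) + potential ts' \<le> potential (ts0 @ [(i, g)])) x"
          by (intro process_correct) (use ok(3) f(2) h in \<open>auto simp: ts\<close>)
        then show "wp (process r q) (\<lambda>t' s'. \<exists>ts'. inv ts' s' \<and> real (t + t') + 1 + potential ts' \<le> potential ts) x"
        proof (rule wp_mono)
          fix t' s' assume "\<exists>ts'. inv ts' s' \<and> real (3 * length g + 7 + t') + potential ts' \<le> potential (ts0 @ [(i, g)])"
          then obtain ts' where ts': "inv ts' s'" "real (3 * length g + 7 + t') + potential ts' \<le> potential (ts0 @ [(i, g)])" by blast
          have "t + t' + 1 \<le> 3 * length g + 7 + t'" using h by simp
          then have "real (t + t' + 1) \<le> real (3 * length g + 7 + t')" by (simp only: of_nat_le_iff)
          then have "real (t + t') + 1 + potential ts' \<le> potential ts"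
            using ts'(2) unfolding ts by linarith
          then show "\<exists>ts'. inv ts' s' \<and> real (t + t') + 1 + potential ts' \<le> potential ts" using ts'(1) by blast
        qed
      qed
    qed (use 0 in auto)
  qed (use assms potential_nonneg in auto)
  then show ?thesis unfolding main_loop_def
  proof (rule wp_mono)
    fix t u assume h: "real t \<le> potential ts + 1 \<and> (\<exists>ts. inv ts u) \<and> \<not> ev (Num 0) u < ev (Var Stop) u"
    then obtain us f where us: "stack u us" "acc_holds u f" "\<And>e. f e + pending us e = tot e" unfolding inv_def by blast
    have "us = []" using h us(1) by (simp add: stack_def stack_holds_def)
    then have "f = tot" using us(3) by auto
    then show "real t \<le> potential ts + 1 \<and> acc_holds u tot" using h us(2) by simp
  qed
qed

end

section \<open>The whole program\<close>

abbreviation written :: "st \<Rightarrow> nat \<Rightarrow> (nat \<times> nat) list" where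
  "written s n \<equiv> map (\<lambda>i. (rw s (n + 2 * i), rw s (n + 2 * i + 1))) [0..<vs s Cnt]"

text \<open>Constants of the language are natural numbers; a negative entry is produced as a residue
  modulo \<open>2 ^ w\<close> by a modular subtraction from 0.\<close>

primrec table :: "arr \<Rightarrow> nat \<Rightarrow> int list \<Rightarrow> com" where
  "table a k [] = Skip"
| "table a k (c # cs) =
     (a[Num k] ::= (if 0 \<le> c then Num (nat c) else Op MMinus (Num 0) (Num (nat (- c)))) ;;
      table a (Suc k) cs)"

text \<open>The bound on the values is not part of the machine's input, so the largest value is
  computed. Starting from 1 guarantees at least one digit and a positive square root.\<close>

definition read_max :: com where
  "read_max =
     (Pts ::= Var Reds \<oplus> Var Blues ;;
      MaxV ::= Num 1 ;;
      For J (Var Pts) (IfLess (Var MaxV) (Raw (Var J)) (MaxV ::= Raw (Var J)) Skip))"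

definition grid_size :: "nat \<Rightarrow> nat \<Rightarrow> nat \<Rightarrow> com" where
  "grid_size r q D =
     (Len ::= Num 0 ;; Pow ::= Num 1 ;; Grid ::= Num 1 ;; Scale ::= Num 1 ;;
      While (Var Pow) (Var MaxV \<oplus> Num 1)
        (Pow ::= Var Pow \<otimes> Num r ;; Grid ::= Var Grid \<otimes> Num q ;;
         Scale ::= Var Scale \<otimes> Num D ;; Len ::= Var Len \<oplus> Num 1))"

definition init_stack :: com where
  "init_stack =
     (For J (Var Pts) (AG[Var J] ::= Var J) ;;
      Gtop ::= Var Pts ;;
      IfLess (Num 0) (Var Pts)
        (ATI[Num 0] ::= Num 0 ;; ATM[Num 0] ::= Var Pts ;; Stop ::= Num 1) Skip)"

definition write_output :: com where
  "write_output =
     For J (Var Cnt)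
       (Out (Var Pts \<oplus> Num 2 \<otimes> Var J) (Arr LST (Var J)) ;;
        Out (Var Pts \<oplus> Num 2 \<otimes> Var J \<oplus> Num 1) (Arr ACC (Arr LST (Var J))))"

definition algorithm :: "nat \<Rightarrow> nat \<Rightarrow> nat \<Rightarrow> int list \<Rightarrow> int list \<Rightarrow> com" where
  "algorithm r q D fw bw =
     (read_max ;; grid_size r q D ;; table FW 0 fw ;; table BW 0 bw ;; init_stack ;;
      main_loop r q ;; write_output)"

lemma writes_table [simp]:
  "\<not> writes_var (table a k cs) x" "\<not> writes_raw (table a k cs)" "a' \<noteq> a \<Longrightarrow> \<not> writes_arr (table a k cs) a'"
  by (induction cs arbitrary: k) auto

lemma writes_read_max [simp]:
  "writes_var read_max x \<longleftrightarrow> x \<in> {Pts, MaxV, J}" "\<not> writes_raw read_max" "\<not> writes_arr read_max a"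
  by (auto simp: read_max_def)

lemma writes_grid_size [simp]:
  "writes_var (grid_size r q D) x \<longleftrightarrow> x \<in> {Len, Pow, Grid, Scale}" "\<not> writes_raw (grid_size r q D)"
  "\<not> writes_arr (grid_size r q D) a"
  by (auto simp: grid_size_def)

lemma writes_init_stack [simp]:
  "writes_var init_stack x \<longleftrightarrow> x \<in> {J, Gtop, Stop}" "\<not> writes_raw init_stack"
  "writes_arr init_stack a \<longleftrightarrow> a \<in> {AG, ATI, ATM}"
  by (auto simp: init_stack_def)

lemma writes_main_loop:
  "writes_var (main_loop r q) x \<Longrightarrow> x \<noteq> Pts" "writes_raw (main_loop r q) \<Longrightarrow> False"
  using writes_process[of r q] by (auto simp: main_loop_def)

lemma (in ram) table_correct:
  assumes "k + length cs < M" "\<And>c. c \<in> set cs \<Longrightarrow> nat \<bar>c\<bar> < M"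
  shows "wp (table a k cs) (\<lambda>t s'. t = length cs \<and>
     (\<forall>j<length cs. int (ar s' a (k + j)) = cs ! j mod 2 ^ w) \<and> (\<forall>x<k. ar s' a x = ar s a x)) s"
  using assms
proof (induction cs arbitrary: k s)
  case (Cons c cs)
  define e where "e = (if 0 \<le> c then Num (nat c) else Op MMinus (Num 0) (Num (nat (- c))))"
  have c: "nat \<bar>c\<bar> < M" using Cons.prems(2) by simp
  have chk: "chk e u" for u using c by (auto simp: e_def)
  have ev: "int (ev e u) = c mod 2 ^ w" for u
  proof (cases "0 \<le> c")
    case True
    have "int (nat c) < int (2 ^ w)" using c M_less[of "nat c"] True by (simp only: of_nat_less_iff abs_of_nonneg)
    then show ?thesis using True by (simp add: e_def)
  next
    case False
    then show ?thesis by (simp add: e_def)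
  qed
  let ?s = "s\<lparr>ar := (ar s)(a := (ar s a)(k := ev e s))\<rparr>"
  have "wp (table a (Suc k) cs) (\<lambda>t s'. t = length cs \<and>
     (\<forall>j<length cs. int (ar s' a (Suc k + j)) = cs ! j mod 2 ^ w) \<and> (\<forall>x<Suc k. ar s' a x = ar ?s a x)) ?s"
    by (rule Cons.IH) (use Cons.prems in auto)
  then have "wp (table a (Suc k) cs) (\<lambda>t s'. 1 + t = length (c # cs) \<and>
     (\<forall>j<length (c # cs). int (ar s' a (k + j)) = (c # cs) ! j mod 2 ^ w) \<and> (\<forall>x<k. ar s' a x = ar s a x)) ?s"
  proof (rule wp_mono)
    fix t and s' :: st
    assume h: "t = length cs \<and>
     (\<forall>j<length cs. int (ar s' a (Suc k + j)) = cs ! j mod 2 ^ w) \<and> (\<forall>x<Suc k. ar s' a x = ar ?s a x)"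
    have "int (ar s' a (k + j)) = (c # cs) ! j mod 2 ^ w" if "j < length (c # cs)" for j
      using h that ev[of s] by (cases j) auto
    then show "1 + t = length (c # cs) \<and>
     (\<forall>j<length (c # cs). int (ar s' a (k + j)) = (c # cs) ! j mod 2 ^ w) \<and> (\<forall>x<k. ar s' a x = ar s a x)"
      using h by auto
  qed
  then show ?case
    unfolding table.simps e_def[symmetric] wp_Seq wp_Store using chk Cons.prems(1) by simp
qed simp

context timed
begin

lemma n_M: "n < M" "1 < M"
proof -
  have "n \<le> (d + 4) * n" by simp
  then show "n < M" "1 < M" using stack_M by linarith+
qed

lemma read_max_correct:
  assumes s: "vs s Reds = nr" "vs s Blues = nb" "\<And>p. p < n \<Longrightarrow> rw s p = val p"
    and n: "n = nr + nb" and v: "v = fold max (map val [0..<n]) 1"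
  shows "wp read_max (\<lambda>t s'. t \<le> 4 * n + 4 \<and> vs s' Pts = n \<and> vs s' MaxV = v) s"
proof -
  note M = n_M
  let ?body = "IfLess (Var MaxV) (Raw (Var J)) (MaxV ::= Raw (Var J)) Skip"
  let ?s = "s\<lparr>vs := (vs s)(Pts := n, MaxV := 1)\<rparr>"
  have "wp (For J (Var Pts) ?body) (\<lambda>t u. t \<le> n * (2 + 2) + 2 \<and> vs u MaxV = fold max (map val [0..<n]) 1 \<and> vs u J = n) ?s"
  proof (rule wp_for[where N = n and T = 2 and I = "\<lambda>k u. vs u MaxV = fold max (map val [0..<k]) 1"])
    fix k and u :: st
    assume k: "k < n" "vs u MaxV = fold max (map val [0..<k]) 1" "unchanged (For J (Var Pts) ?body) ?s u" "vs u J = k"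
    have "rw u k = val k" "k < base" using k s n_base by (auto simp: unchanged_def)
    then show "wp ?body (\<lambda>t s'. t \<le> 2 \<and> vs (set_var s' J (Suc k)) MaxV = fold max (map val [0..<Suc k]) 1) u"
      using k by auto
  qed (use M in \<open>auto simp: unchanged_def\<close>)
  then have "wp (For J (Var Pts) ?body) (\<lambda>t u. Suc (Suc t) \<le> 4 * n + 4 \<and> vs u Pts = n \<and> vs u MaxV = v) ?s"
    by (rule wp_mono) (auto simp: unchanged_def v)
  then show ?thesis unfolding read_max_def using s M n by simp
qed

text \<open>A round starts with \<open>Len < L\<close> by minimality, so the powers it produces are
  at most the final ones, whose bounds are assumed.\<close>

lemma grid_size_correct:
  assumes s: "vs s MaxV = v" and L: "L = (LEAST t. v < r ^ t)" and D: "D < M"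
  shows "wp (grid_size r q D) (\<lambda>t s'. t \<le> 5 * L + 5 \<and> vs s' Len = L \<and> vs s' Grid = q ^ L \<and> vs s' Scale = D ^ L) s"
proof -
  let ?body = "Pow ::= Var Pow \<otimes> Num r ;; Grid ::= Var Grid \<otimes> Num q ;;
         Scale ::= Var Scale \<otimes> Num D ;; Len ::= Var Len \<oplus> Num 1"
  let ?s = "s\<lparr>vs := (vs s)(Len := 0, Pow := 1, Grid := 1, Scale := 1)\<rparr>"
  define I where "I = (\<lambda>u :: st. vs u Len \<le> L \<and> vs u Pow = r ^ vs u Len \<and> vs u Grid = q ^ vs u Len \<and> vs u Scale = D ^ vs u Len)"
  have "wp (While (Var Pow) (Var MaxV \<oplus> Num 1) ?body)
     (\<lambda>t u. t \<le> 5 * (L - vs ?s Len) + 1 \<and> I u \<and> \<not> ev (Var Pow) u < ev (Var MaxV \<oplus> Num 1) u) ?s"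
  proof (rule wp_while_measure[where m = "\<lambda>u. 5 * (L - vs u Len)"])
    fix u
    assume I: "I u" and un: "unchanged ?body ?s u"
    have mv: "vs u MaxV = v" using un s by (simp add: unchanged_def)
    show "chk (Var Pow) u \<and> chk (Var MaxV \<oplus> Num 1) u \<and> (ev (Var Pow) u < ev (Var MaxV \<oplus> Num 1) u \<longrightarrow>
      wp ?body (\<lambda>t s'. I s' \<and> t + 1 + 5 * (L - vs s' Len) \<le> 5 * (L - vs u Len)) u)"
    proof (intro conjI impI)
      assume "ev (Var Pow) u < ev (Var MaxV \<oplus> Num 1) u"
      then have "\<not> v < r ^ vs u Len" using I mv by (simp add: I_def)
      then have "vs u Len \<noteq> L" using v_L by metis
      then have lt: "vs u Len < L" using I by (simp add: I_def)
      then obtain x where x: "L = Suc (vs u Len + x)" using less_iff_Suc_add by blast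
      have pw: "a ^ vs u Len * a < M" if "a ^ L < M" "0 < a" for a
      proof -
        have "a ^ Suc (vs u Len) \<le> a ^ L" using lt that by (intro power_increasing) auto
        then show ?thesis using that by (simp add: mult.commute)
      qed
      have rL: "r ^ L < M" using rL_M q_ge by (metis le_less_trans mult_le_mono1 nat_mult_1 One_nat_def Suc_leI)
      show "wp ?body (\<lambda>t s'. I s' \<and> t + 1 + 5 * (L - vs s' Len) \<le> 5 * (L - vs u Len)) u"
        using I pw[OF rL] pw[OF Q_M] pw[OF D_M] r_ge q_ge q_M D_pos D lt L_M
        by (auto simp: I_def x mult.commute)
    qed (use mv v_less in auto)
  qed (auto simp: I_def)
  then have "wp (While (Var Pow) (Var MaxV \<oplus> Num 1) ?body)
     (\<lambda>t u. Suc (Suc (Suc (Suc t))) \<le> 5 * L + 5 \<and> vs u Len = L \<and> vs u Grid = q ^ L \<and> vs u Scale = D ^ L) ?s"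
  proof (rule wp_mono)
    fix t u
    assume un: "unchanged (While (Var Pow) (Var MaxV \<oplus> Num 1) ?body) ?s u"
      and h: "t \<le> 5 * (L - vs ?s Len) + 1 \<and> I u \<and> \<not> ev (Var Pow) u < ev (Var MaxV \<oplus> Num 1) u"
    have "vs u MaxV = v" using un s by (simp add: unchanged_def)
    then have "v < r ^ vs u Len" using h by (simp add: I_def)
    then have "L \<le> vs u Len" unfolding L by (rule Least_le)
    then have "vs u Len = L" using h by (simp add: I_def)
    then show "Suc (Suc (Suc (Suc t))) \<le> 5 * L + 5 \<and> vs u Len = L \<and> vs u Grid = q ^ L \<and> vs u Scale = D ^ L"
      using h by (simp add: I_def)
  qed
  then show ?thesis unfolding grid_size_def using q_M by simp
qed

lemma init_stack_correct:
  assumes s: "vs s Pts = n" "vs s Stop = 0"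
  shows "wp init_stack (\<lambda>t s'. t \<le> 3 * n + 7 \<and> stack s' (if n = 0 then [] else [(0, [0..<n])])) s"
proof -
  note M = n_M
  let ?body = "AG[Var J] ::= Var J"
  have "wp (For J (Var Pts) ?body) (\<lambda>t u. t \<le> n * (1 + 2) + 2 \<and> (\<forall>x<n. ar u AG x = x) \<and> vs u J = n) s"
  proof (rule wp_for[where N = n and T = 1 and I = "\<lambda>k u. \<forall>x<k. ar u AG x = x"])
    fix k and u :: st
    assume "k < n" "\<forall>x<k. ar u AG x = x" "vs u J = k"
    then show "wp ?body (\<lambda>t s'. t \<le> 1 \<and> (\<forall>x<Suc k. ar (set_var s' J (Suc k)) AG x = x)) u"
      using M by (auto simp: less_Suc_eq)
  qed (use s M in \<open>auto simp: unchanged_def\<close>)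
  then have "wp (For J (Var Pts) ?body) (\<lambda>t u. t \<le> 3 * n + 2 \<and> (\<forall>x<n. ar u AG x = x) \<and> vs u Pts = n \<and> vs u Stop = 0) s"
    by (rule wp_mono) (use s in \<open>auto simp: unchanged_def\<close>)
  then show ?thesis unfolding init_stack_def wp_Seq[of "For _ _ _"]
  proof (rule wp_mono)
    fix t and u :: st
    assume h: "t \<le> 3 * n + 2 \<and> (\<forall>x<n. ar u AG x = x) \<and> vs u Pts = n \<and> vs u Stop = 0"
    then show "wp (Gtop ::= Var Pts ;; IfLess (Num 0) (Var Pts)
        (ATI[Num 0] ::= Num 0 ;; ATM[Num 0] ::= Var Pts ;; Stop ::= Num 1) Skip)
        (\<lambda>t' s'. t + t' \<le> 3 * n + 7 \<and> stack s' (if n = 0 then [] else [(0, [0..<n])])) u"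
      using M by (auto simp: stack_def stack_holds_def total_def)
  qed
qed

lemma write_output_correct:
  assumes acc: "acc_holds s f" and n: "vs s Pts = n" and f: "\<And>e. f e \<noteq> 0 \<Longrightarrow> e < M"
    and b: "n + 2 * vs s Cnt \<le> base" "n + 2 * vs s Cnt + 2 < M"
  shows "wp write_output (\<lambda>t s'. t \<le> 4 * card {e. f e \<noteq> 0} + 2 \<and> vs s' Pts = n \<and>
     distinct (written s' n) \<and>
     set (written s' n) = {(e, f e) | e. f e \<noteq> 0}) s"
proof -
  define m where "m = vs s Cnt"
  let ?l = "map (ar s LST) [0..<m]"
  have l: "distinct ?l" "set ?l = {e. f e \<noteq> 0}" "ar s ACC = f" using acc unfolding acc_holds_def m_def by auto
  let ?body = "Out (Var Pts \<oplus> Num 2 \<otimes> Var J) (Arr LST (Var J)) ;;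
        Out (Var Pts \<oplus> Num 2 \<otimes> Var J \<oplus> Num 1) (Arr ACC (Arr LST (Var J)))"
  define I where "I = (\<lambda>k (u :: st). \<forall>x<k. rw u (n + 2 * x) = ar s LST x \<and> rw u (n + 2 * x + 1) = f (ar s LST x))"
  have "wp (For J (Var Cnt) ?body) (\<lambda>t u. t \<le> m * (2 + 2) + 2 \<and> I m u \<and> vs u J = m) s"
  proof (rule wp_for[where N = m and T = 2 and I = I])
    fix k and u :: st
    assume k: "k < m" and IH: "I k u" and un: "unchanged (For J (Var Cnt) ?body) s u" and uk: "vs u J = k"
    have e: "vs u Pts = n" "ar u = ar s" using un n by (auto simp: unchanged_def)
    have "ar s LST k \<in> set ?l" using k by simp
    then have "ar s LST k < M" using l(2) f by blast
    moreover have "2 * k + 2 \<le> 2 * m" using k by simp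
    moreover have "n + 2 * m \<le> base" "n + 2 * m + 2 < M" using b by (auto simp: m_def)
    ultimately show "wp ?body (\<lambda>t s'. t \<le> 2 \<and> I (Suc k) (set_var s' J (Suc k))) u"
      using IH e uk l(3) by (auto simp: I_def less_Suc_eq)
  qed (use b in \<open>auto simp: I_def m_def unchanged_def\<close>)
  then show ?thesis unfolding write_output_def
  proof (rule wp_mono)
    fix t u
    assume un: "unchanged (For J (Var Cnt) ?body) s u" and h: "t \<le> m * (2 + 2) + 2 \<and> I m u \<and> vs u J = m"
    have e: "vs u Cnt = m" "vs u Pts = n" using un n by (auto simp: unchanged_def m_def)
    have mp: "written u n = map (\<lambda>e. (e, f e)) ?l"
      unfolding e using h by (simp add: I_def)
    have "distinct (map (\<lambda>e. (e, f e)) ?l)" using l(1) by (simp add: distinct_map inj_on_def)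
    moreover have "set (map (\<lambda>e. (e, f e)) ?l) = {(e, f e) | e. f e \<noteq> 0}"
      unfolding set_map[of _ ?l] l(2) by auto
    moreover have "card {e. f e \<noteq> 0} = m" using acc_holds_card[OF acc] m_def by simp
    ultimately show "t \<le> 4 * card {e. f e \<noteq> 0} + 2 \<and> vs u Pts = n \<and>
     distinct (written u n) \<and>
     set (written u n) = {(e, f e) | e. f e \<noteq> 0}"
      unfolding mp using h e(2) by auto
  qed
qed

section \<open>The matrix tables and the complete algorithm\<close>

definition forward_table :: "int list" where
  "forward_table = map (\<lambda>i. int (i div q) ^ (i mod q)) [0..<q * q]"

definition backward_table :: "int list" where
  "backward_table = map (\<lambda>i. Bm (i div q) (i mod q)) [0..<q * q]"

lemma table_index: "y < q \<Longrightarrow> e < q \<Longrightarrow> y * q + e < q * q"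
proof -
  assume "y < q" "e < q"
  then have "y * q + e < Suc y * q" by simp
  also have "\<dots> \<le> q * q" using \<open>y < q\<close> by (intro mult_le_mono1) simp
  finally show ?thesis .
qed

theorem algorithm_correct:
  assumes s: "vs s = (\<lambda>_. 0)(Dim := d, Reds := nr, Blues := nb)" "ar s = (\<lambda>_ _. 0)" "\<And>p. p < n \<Longrightarrow> rw s p = val p"
    and n: "n = nr + nb" and v: "v = fold max (map val [0..<n]) 1" and L: "L = (LEAST t. v < r ^ t)"
    and D: "D < M" and tabs: "\<And>c. c \<in> set (forward_table @ backward_table) \<Longrightarrow> nat \<bar>c\<bar> < M"
    and base: "base = n + 2 * nr * nb" "n + 2 * nr * nb + 2 < M"
    and support: "card {e. tot e \<noteq> 0} \<le> nr * nb"
  shows "wp (algorithm r q D forward_table backward_table) (\<lambda>t s'.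
     real t \<le> real (7 * n + 5 * L + 2 * (q * q) + 20 + 4 * card {e. tot e \<noteq> 0}) + pot 0 n \<and> vs s' Pts = n \<and>
     distinct (written s' n) \<and>
     set (written s' n) = {(e, tot e) | e. tot e \<noteq> 0}) s"
proof -
  have s': "vs s Reds = nr" "vs s Blues = nb" using s(1) by simp_all
  have len: "length forward_table = q * q" "length backward_table = q * q"
    by (simp_all add: forward_table_def backward_table_def)
  define ts where "ts = (if n = 0 then [] else [(0, [0..<n])] :: tasks)"
  note nM = n_M
  \<comment> \<open>\<open>G1\<close> to \<open>G4\<close> accumulate what the initialisation phases
    establish, together with the zeros of the initial state that later phases rely on.\<close>
  define G1 where "G1 = (\<lambda>u :: st. vs u Dim = d \<and> vs u Reds = nr \<and> vs u Pts = n \<and> vs u MaxV = v \<and> vs u Stop = 0 \<and> vs u Cnt = 0 \<and>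
     ar u ACC = (\<lambda>_. 0) \<and> rw u = rw s)"
  define G2 where "G2 = (\<lambda>u :: st. G1 u \<and> vs u Len = L \<and> vs u Grid = q ^ L \<and> vs u Scale = D ^ L)"
  define G3 where "G3 = (\<lambda>u :: st. G2 u \<and> (\<forall>j<q * q. int (ar u FW j) = forward_table ! j mod 2 ^ w))"
  define G4 where "G4 = (\<lambda>u :: st. G3 u \<and> (\<forall>j<q * q. int (ar u BW j) = backward_table ! j mod 2 ^ w))"
  have w1: "wp read_max (\<lambda>t u. t \<le> 4 * n + 4 \<and> G1 u) s"
    by (rule wp_mono[OF read_max_correct[OF s' s(3) n v]]) (use s in \<open>auto simp: unchanged_def G1_def\<close>)
  have w2: "wp (grid_size r q D) (\<lambda>t x. t \<le> 5 * L + 5 \<and> G2 x) u" if "G1 u" for u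
    by (rule wp_mono[OF grid_size_correct[OF _ L D]]) (use that in \<open>auto simp: unchanged_def G1_def G2_def\<close>)
  have w3: "wp (table FW 0 forward_table) (\<lambda>t x. t \<le> q * q \<and> G3 x) u" if u: "G2 u" for u
  proof (rule wp_mono[OF table_correct])
    fix t x
    assume un: "unchanged (table FW 0 forward_table) u x" and h: "t = length forward_table \<and>
     (\<forall>j<length forward_table. int (ar x FW (0 + j)) = forward_table ! j mod 2 ^ w) \<and> (\<forall>z<0. ar x FW z = ar u FW z)"
    have "G2 x" using u un by (simp add: unchanged_def G2_def G1_def)
    then show "t \<le> q * q \<and> G3 x" using h by (simp add: G3_def len)
  qed (use qq_M len tabs in auto)
  have w4: "wp (table BW 0 backward_table) (\<lambda>t x. t \<le> q * q \<and> G4 x) u" if u: "G3 u" for u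
  proof (rule wp_mono[OF table_correct])
    fix t x
    assume un: "unchanged (table BW 0 backward_table) u x" and h: "t = length backward_table \<and>
     (\<forall>j<length backward_table. int (ar x BW (0 + j)) = backward_table ! j mod 2 ^ w) \<and> (\<forall>z<0. ar x BW z = ar u BW z)"
    have "G3 x" using u un by (simp add: unchanged_def G3_def G2_def G1_def)
    then show "t \<le> q * q \<and> G4 x" using h by (simp add: G4_def len)
  qed (use qq_M len tabs in auto)
  have G4_env: "env u" if "G4 u" for u
  proof -
    have "int (ar u FW (y * q + e)) = int y ^ e mod 2 ^ w" "int (ar u BW (y * q + e)) = Bm y e mod 2 ^ w"
      if "y < q" "e < q" for y e
      using \<open>G4 u\<close> table_index[OF that] that by (simp_all add: G4_def G3_def forward_table_def backward_table_def)
    then show ?thesis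
      using that s(3) by (simp add: env_def holds_params_def G4_def G3_def G2_def G1_def)
  qed
  have w5: "wp init_stack (\<lambda>t x. t \<le> 3 * n + 7 \<and> inv ts x \<and> vs x Pts = n) u" if u: "G4 u" for u
  proof (rule wp_mono[OF init_stack_correct])
    fix t x
    assume un: "unchanged init_stack u x" and h: "t \<le> 3 * n + 7 \<and> stack x (if n = 0 then [] else [(0, [0..<n])])"
    have "env x" by (rule env_unchanged[OF G4_env[OF u] un]) auto
    moreover have "acc_holds x (\<lambda>_. 0)" "vs x Pts = n" using u un
      by (simp_all add: acc_holds_def unchanged_def G4_def G3_def G2_def G1_def)
    moreover have "tasks_ok ts" by (auto simp: ts_def tasks_ok_def bounded_stack_def)
    moreover have "pending ts e = tot e" for e
      by (auto simp: ts_def tot_def) (simp add: count_def pair_count_def)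
    ultimately show "t \<le> 3 * n + 7 \<and> inv ts x \<and> vs x Pts = n" using h by (auto simp: inv_def ts_def)
  qed (use u in \<open>auto simp: G4_def G3_def G2_def G1_def\<close>)
  have pts: "potential ts \<le> pot 0 n" by (simp add: ts_def pot_nonneg)
  have w6: "wp (main_loop r q) (\<lambda>t x. real t \<le> pot 0 n + 1 \<and> acc_holds x tot \<and> vs x Pts = n) u"
    if u: "inv ts u \<and> vs u Pts = n" for u
  proof (rule wp_mono[OF main_loop_correct[of ts u]])
    fix t x
    assume un: "unchanged (main_loop r q) u x" and h: "real t \<le> potential ts + 1 \<and> acc_holds x tot"
    have "vs x Pts = n" using unchanged_var[OF un, of Pts] writes_main_loop u by blast
    then show "real t \<le> pot 0 n + 1 \<and> acc_holds x tot \<and> vs x Pts = n" using h pts by linarith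
  qed (use u in blast)
  let ?Q = "\<lambda>s'. vs s' Pts = n \<and>
     distinct (written s' n) \<and>
     set (written s' n) = {(e, tot e) | e. tot e \<noteq> 0}"
  have w7: "wp write_output (\<lambda>t x. t \<le> 4 * card {e. tot e \<noteq> 0} + 2 \<and> ?Q x) u"
    if u: "acc_holds u tot \<and> vs u Pts = n" for u
  proof (rule write_output_correct)
    have c: "vs u Cnt \<le> nr * nb" using acc_holds_card[of u tot] u support by simp
    then have "2 * vs u Cnt \<le> 2 * nr * nb" by simp
    then show "n + 2 * vs u Cnt \<le> base" "n + 2 * vs u Cnt + 2 < M" using base by linarith+
    show "e < M" if "tot e \<noteq> 0" for e using tot_support[OF that] v_less by linarith
  qed (use u in auto)
  have tm: "real (t1 + (t2 + (t3 + (t4 + (t5 + (t6 + t7)))))) \<le>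
      real (7 * n + 5 * L + 2 * (q * q) + 20 + 4 * card {e. tot e \<noteq> 0}) + pot 0 n"
    if "t1 \<le> 4 * n + 4" "t2 \<le> 5 * L + 5" "t3 \<le> q * q" "t4 \<le> q * q" "t5 \<le> 3 * n + 7"
      "real t6 \<le> pot 0 n + 1" "t7 \<le> 4 * card {e. tot e \<noteq> 0} + 2" for t1 t2 t3 t4 t5 t6 t7 :: nat
  proof -
    have "t1 + t2 + t3 + t4 + t5 + t7 \<le> 7 * n + 5 * L + 2 * (q * q) + 18 + 4 * card {e. tot e \<noteq> 0}"
      using that by linarith
    then have "real (t1 + t2 + t3 + t4 + t5 + t7) \<le> real (7 * n + 5 * L + 2 * (q * q) + 18 + 4 * card {e. tot e \<noteq> 0})"
      by (simp only: of_nat_le_iff)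
    then show ?thesis using that(6) by simp
  qed
  show ?thesis
    unfolding algorithm_def wp_Seq[of read_max] wp_Seq[of "grid_size _ _ _"] wp_Seq[of "table _ _ _"]
      wp_Seq[of init_stack] wp_Seq[of "main_loop _ _"]
    apply (rule wp_mono[OF w1])
    apply (rule wp_mono[OF w2], blast)
    apply (rule wp_mono[OF w3], blast)
    apply (rule wp_mono[OF w4], blast)
    apply (rule wp_mono[OF w5], blast)
    apply (rule wp_mono[OF w6], blast)
    apply (rule wp_mono[OF w7], blast)
    apply (elim conjE)
    apply (intro conjI)
       apply (rule tm; assumption)
      apply assumption+
    done
qed

end

text \<open>Saves the input registers and sets register 1 to \<open>base\<close>, that is
  \<open>nr + nb + 2 * nr * nb\<close>: the input values, followed by room for
  \<open>nr * nb\<close> output pairs, as many as there can be non-zero coefficients.\<close>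

definition prologue :: "instr list" where
  "prologue =
     [BinOp OpOr (vreg Dim) 0 0, BinOp OpOr (vreg Reds) 1 1, BinOp OpOr (vreg Blues) 2 2,
      BinOp OpMul 3 1 2, BinOp OpAdd 1 1 2, BinOp OpAdd 1 1 3, BinOp OpAdd 1 1 3]"

definition epilogue :: "instr list" where
  "epilogue = [BinOp OpOr 0 (vreg Pts) (vreg Pts), BinOp OpOr 1 (vreg Cnt) (vreg Cnt)]"

definition machine_code :: "com \<Rightarrow> program" where
  "machine_code c = prologue @ ccom c (length prologue) @ epilogue"

definition initial :: "nat \<Rightarrow> valued_point list \<Rightarrow> valued_point list \<Rightarrow> st" where
  "initial d R B = \<lparr>vs = (\<lambda>_. 0)(Dim := d, Reds := length R, Blues := length B), ar = (\<lambda>_ _. 0),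
     rw = (\<lambda>i. if i < length (R @ B) then snd ((R @ B) ! i) else 0)\<rparr>"

lemma (in ram) machine_code_correct:
  assumes wp: "wp c Q (initial d R B)" and base: "base = length R + length B + 2 * length R * length B"
  shows "\<exists>t s t' s'. Q t' s' \<and> runs_to w X (machine_code c) (red_blue_init d R B) t s \<and>
     t \<le> length (machine_code c) * (t' + 1) \<and> reg s 0 = vs s' Pts \<and> reg s 1 = vs s' Cnt \<and>
     (\<forall>i<base. mem s i = rw s' i)"
proof -
  let ?P = "machine_code c" let ?s0 = "red_blue_init d R B" let ?N = "length (machine_code c)"
  obtain t' s' where b: "big c (initial d R B) t' s'" and Q: "Q t' s'" using wp unfolding wp_def by blast
  define \<sigma> where "\<sigma> = fold (exec_instr w X) prologue ?s0"
  have c1: "code_at ?P 0 prologue" "code_at ?P (length prologue) (ccom c (length prologue))"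
    "code_at ?P (length prologue + length (ccom c (length prologue))) epilogue"
    using code_at_append[of ?P 0 prologue "ccom c (length prologue) @ epilogue"]
      code_at_append[of ?P "length prologue" "ccom c (length prologue)" epilogue]
    by (auto simp: machine_code_def code_at_def)
  have r1: "reach w X ?P ?s0 (length prologue) \<sigma> \<and> pc \<sigma> = 0 + length prologue"
    using reach_straight[of ?P ?s0 prologue w X] c1(1) by (simp add: \<sigma>_def red_blue_init_def prologue_def)
  \<comment> \<open>Every intermediate value of the prologue is at most \<open>base\<close>, so its
    arithmetic does not wrap.\<close>
  have m0: "length R * length B < 2 ^ w" "length R + length B < 2 ^ w"
    "length R + length B + length R * length B < 2 ^ w"
    "length R + length B + length R * length B + length R * length B < 2 ^ w"
    using base_le base by auto
  have mem: "mem \<sigma> = mem ?s0" by (simp add: \<sigma>_def prologue_def)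
  have "rel (initial d R B) \<sigma>"
    unfolding rel_def
  proof (intro conjI allI impI)
    show "reg \<sigma> (vreg x) = vs (initial d R B) x" for x
      by (cases x) (simp_all add: \<sigma>_def prologue_def red_blue_init_def initial_def)
    show "reg \<sigma> 1 = base"
      using m0 by (simp add: \<sigma>_def prologue_def red_blue_init_def base)
    show "mem \<sigma> (base + (16 * i + anum a)) = ar (initial d R B) a i" for i a
      unfolding mem by (simp add: red_blue_init_def initial_def base)
    show "mem \<sigma> i = rw (initial d R B) i" for i
      unfolding mem by (simp add: red_blue_init_def initial_def)
  qed
  from compile_correct[OF b this, of ?P "length (ccom c (length prologue))"]
  obtain k \<tau> where \<tau>: "reach w X ?P \<sigma> k \<tau>" "rel s' \<tau>"
    "pc \<tau> = length prologue + length (ccom c (length prologue))" "k \<le> length (ccom c (length prologue)) * t'"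
    using c1(2) r1 by auto
  define \<rho> where "\<rho> = fold (exec_instr w X) epilogue \<tau>"
  have r3: "reach w X ?P \<tau> (length epilogue) \<rho> \<and> pc \<rho> = pc \<tau> + length epilogue"
    unfolding \<rho>_def by (rule reach_straight) (use c1(3) \<tau>(3) in \<open>auto simp: epilogue_def\<close>)
  have "pc \<rho> \<ge> length ?P" using r3 \<tau>(3) by (simp add: machine_code_def)
  then have "runs_to w X ?P \<rho> 0 \<rho>" by (rule runs_to.halt)
  then have "runs_to w X ?P ?s0 (length prologue + k + length epilogue + 0) \<rho>"
    using reach_trans[OF reach_trans[OF conjunct1[OF r1] \<tau>(1)] conjunct1[OF r3]] unfolding reach_def by blast
  moreover have "length prologue + k + length epilogue + 0 \<le> ?N * (t' + 1)"
    using \<tau>(4) by (simp add: machine_code_def algebra_simps)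
  moreover have "reg \<rho> 0 = vs s' Pts" "reg \<rho> 1 = vs s' Cnt" "mem \<rho> = mem \<tau>"
    using \<tau>(2) by (auto simp: \<rho>_def epilogue_def rel_def) (metis vreg.simps(4), metis vreg.simps(10))
  ultimately show ?thesis using Q \<tau>(2) unfolding rel_def by metis
qed

section \<open>The polynomial\<close>

lemma nth_concat_same_length:
  assumes "\<And>x. x \<in> set xss \<Longrightarrow> length x = d" "p < length xss" "c < d"
  shows "p * d + c < length (concat xss) \<and> concat xss ! (p * d + c) = xss ! p ! c"
  using assms
proof (induction xss arbitrary: p)
  case (Cons x xss)
  have x: "length x = d" using Cons.prems(1) by simp
  show ?case
  proof (cases p)
    case 0
    then show ?thesis using x Cons.prems(3) by (simp add: nth_append)
  next
    case (Suc p')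
    then show ?thesis using Cons.IH[of p'] Cons.prems x by (simp add: nth_append)
  qed
qed simp

lemma coeff_red_blue_poly:
  "coeff (red_blue_poly R B) e = (\<Sum>p<length R. \<Sum>q<length B.
     of_bool (point_less (fst (R ! p)) (fst (B ! q)) \<and> snd (R ! p) + snd (B ! q) = e))"
proof -
  let ?A = "{..<length R} \<times> {..<length B}"
  let ?l = "\<lambda>x. point_less (fst (R ! fst x)) (fst (B ! snd x))"
  have S: "{(p, q). p < length R \<and> q < length B \<and> point_less (fst (R ! p)) (fst (B ! q))} = {x \<in> ?A. ?l x}" by auto
  have "coeff (red_blue_poly R B) e = (\<Sum>x\<in>{x \<in> ?A. ?l x}. of_bool (snd (R ! fst x) + snd (B ! snd x) = e))"
    unfolding red_blue_poly_def S coeff_sum by (intro sum.cong refl) (auto simp: coeff_monom)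
  also have "\<dots> = (\<Sum>x\<in>?A. if ?l x then of_bool (snd (R ! fst x) + snd (B ! snd x) = e) else 0)"
    by (rule sum.inter_filter) simp
  also have "\<dots> = (\<Sum>x\<in>?A. of_bool (?l x \<and> snd (R ! fst x) + snd (B ! snd x) = e))"
    by (intro sum.cong refl) auto
  also have "\<dots> = (\<Sum>p<length R. \<Sum>q<length B.
     of_bool (point_less (fst (R ! p)) (fst (B ! q)) \<and> snd (R ! p) + snd (B ! q) = e))"
    unfolding sum.cartesian_product by (intro sum.cong refl) auto
  finally show ?thesis .
qed

lemma card_support_le: "card {e. coeff (red_blue_poly R B) e \<noteq> 0} \<le> length R * length B"
proof -
  let ?A = "{..<length R} \<times> {..<length B}"
  have "{e. coeff (red_blue_poly R B) e \<noteq> 0} \<subseteq> (\<lambda>(p, q). snd (R ! p) + snd (B ! q)) ` ?A"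
  proof
    fix e assume "e \<in> {e. coeff (red_blue_poly R B) e \<noteq> 0}"
    then obtain p q where "p < length R" "q < length B" "snd (R ! p) + snd (B ! q) = e"
      unfolding coeff_red_blue_poly by (auto split: if_splits)
    then show "e \<in> (\<lambda>(p, q). snd (R ! p) + snd (B ! q)) ` ?A" by force
  qed
  then have "card {e. coeff (red_blue_poly R B) e \<noteq> 0} \<le> card ((\<lambda>(p, q). snd (R ! p) + snd (B ! q)) ` ?A)"
    by (intro card_mono) auto
  also have "\<dots> \<le> card ?A" by (rule card_image_le) simp
  finally show ?thesis by simp
qed

text \<open>The count is bounded by both \<open>n * n\<close> and \<open>3 * v\<close>, hence by the
  root of their product. This keeps the time for writing the output within the budget.\<close>

lemma card_le_mult_sqrt:
  assumes "c \<le> a * b" "a + b \<le> n" "c \<le> 2 * v + 1" "1 \<le> v"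
  shows "real c \<le> 2 * real n * sqrt (real v)"
proof -
  have "a * b \<le> n * n" using assms(2) by (intro mult_le_mono) auto
  then have "real c \<le> real n * real n" using assms(1) by (metis le_trans of_nat_le_iff of_nat_mult)
  moreover have "real c \<le> 3 * real v" using assms(3,4) by linarith
  ultimately have "real c * real c \<le> (real n * real n) * (3 * real v)" by (intro mult_mono) auto
  also have "\<dots> \<le> (real n * real n) * (4 * real v)" by (intro mult_left_mono) auto
  also have "\<dots> = (2 * real n * sqrt (real v))\<^sup>2" by (simp add: power_mult_distrib power2_eq_square)
  finally show ?thesis
    by (intro power2_le_imp_le[of "real c"]) (auto simp: power2_eq_square)
qed

text \<open>As red indices come first, \<open>pair_ok\<close> restricts the count over all index
  pairs to the block of red first and blue second components, which is the double sum of
  \<open>coeff_red_blue_poly\<close>.\<close>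

lemma (in timed) tot_eq_coeff:
  assumes R: "nr = length R" "n = length R + length B"
    and X: "X = red_blue_coords R B" and val: "val = (\<lambda>p. snd ((R @ B) ! p))"
    and len: "\<And>x a. (x, a) \<in> set (R @ B) \<Longrightarrow> length x = d"
  shows "tot = coeff (red_blue_poly R B)"
proof
  fix e
  have Xp: "X (p * d + c) = fst ((R @ B) ! p) ! c" if "p < n" "c < d" for p c
  proof -
    let ?l = "map fst (R @ B)"
    have l: "length x = d" if "x \<in> set ?l" for x using len that by force
    have "p < length ?l" using that R by simp
    from nth_concat_same_length[OF l this that(2)] show ?thesis
      using \<open>p < length ?l\<close> by (simp add: X red_blue_coords_def Let_def del: map_append concat_append)
  qed
  have up: "[0..<n] = [0..<nr] @ map (\<lambda>y. nr + y) [0..<length B]"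
  proof -
    have "[0..<n] = [0..<nr] @ [nr..<n]" using R upt_add_eq_append[of 0 nr "n - nr"] by simp
    moreover have "[nr..<n] = map (\<lambda>y. nr + y) [0..<length B]" using R by (auto intro!: nth_equalityI)
    ultimately show ?thesis by simp
  qed
  have z: "pair_count (pair_ok 0 e) (map (\<lambda>y. nr + y) [0..<length B]) h = 0"
    "pair_count (pair_ok 0 e) g [0..<nr] = 0" for g h
    by (auto intro!: pair_count_zero simp: pair_ok_def)
  have "tot e = pair_count (pair_ok 0 e) [0..<nr] (map (\<lambda>y. nr + y) [0..<length B])"
    unfolding tot_def count_def up pair_count_append by (simp add: z)
  also have "\<dots> = (\<Sum>p<nr. \<Sum>b<length B. of_bool (pair_ok 0 e p (nr + b)))"
    using sum_list_map_upt[where S = "\<lambda>x. x" and m = nr and 'b = nat]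
    by (simp only: pair_count_def sum_list_map_upt list.map_ident)
  also have "\<dots> = coeff (red_blue_poly R B) e"
    unfolding coeff_red_blue_poly R(1)[symmetric]
  proof (intro sum.cong refl arg_cong[of _ _ of_bool])
    fix p b assume "p \<in> {..<nr}" "b \<in> {..<length B}"
    then have pb: "p \<in> {..<length R}" "b \<in> {..<length B}" using R(1) by auto
    have n: "(R @ B) ! p = R ! p" "(R @ B) ! (length R + b) = B ! b" using pb by (auto simp: nth_append)
    have "length (fst (R ! p)) = d" "length (fst (B ! b)) = d"
      using pb len[of "fst (R ! p)" "snd (R ! p)"] len[of "fst (B ! b)" "snd (B ! b)"] by auto
    moreover have "X (p * d + c) = fst (R ! p) ! c" "X ((length R + b) * d + c) = fst (B ! b) ! c" if "c < d" for c
      using Xp[of p c] Xp[of "length R + b" c] pb that R n by auto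
    moreover have valv: "val p = snd (R ! p)" "val (length R + b) = snd (B ! b)"
      by (simp_all add: val n)
    ultimately have "point_less (fst (R ! p)) (fst (B ! b)) \<longleftrightarrow> (\<forall>c<d. X (p * d + c) < X ((length R + b) * d + c))"
      by (auto simp: point_less_def list_all2_conv_all_nth)
    then show "pair_ok 0 e p (nr + b) \<longleftrightarrow> point_less (fst (R ! p)) (fst (B ! b)) \<and> snd (R ! p) + snd (B ! b) = e"
      unfolding pair_ok_def using pb valv R(1) by simp
  qed
  finally show "tot e = coeff (red_blue_poly R B) e" .
qed

section \<open>Running time\<close>

text \<open>For \<open>m >= 2\<close> each part has at most \<open>3 / 4 * m\<close> points; the
  most uneven case is 2 out of 3. One factor of each power is kept, so these add up to
  \<open>m\<close>, and the factors with exponent \<open>\<epsilon>\<close> are estimated by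
  \<open>3 / 4 * m\<close>.\<close>

lemma halves_powr:
  fixes \<epsilon> :: real
  assumes "2 \<le> m" "0 < \<epsilon>"
  shows "real (m div 2) powr (1 + \<epsilon>) + real (m - m div 2) powr (1 + \<epsilon>) \<le> (3 / 4) powr \<epsilon> * real m powr (1 + \<epsilon>)"
proof -
  have part: "real a powr (1 + \<epsilon>) \<le> real a * (3 / 4 * real m) powr \<epsilon>" if "1 \<le> a" "4 * a \<le> 3 * m" for a
  proof -
    have "real a \<le> 3 / 4 * real m" using that(2) by linarith
    then have "real a powr \<epsilon> \<le> (3 / 4 * real m) powr \<epsilon>" using assms by (intro powr_mono2) auto
    then show ?thesis using that(1) by (simp add: powr_add mult_left_mono)
  qed
  have "1 \<le> m div 2" "4 * (m div 2) \<le> 3 * m" "1 \<le> m - m div 2" "4 * (m - m div 2) \<le> 3 * m"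
    using assms(1) by auto
  then have "real (m div 2) powr (1 + \<epsilon>) + real (m - m div 2) powr (1 + \<epsilon>) \<le>
     real (m div 2) * (3 / 4 * real m) powr \<epsilon> + real (m - m div 2) * (3 / 4 * real m) powr \<epsilon>"
    by (intro add_mono part)
  also have "\<dots> = (real (m div 2) + real (m - m div 2)) * (3 / 4 * real m) powr \<epsilon>" by (simp only: distrib_right)
  also have "real (m div 2) + real (m - m div 2) = real m" by (simp flip: of_nat_add)
  also have "real m * (3 / 4 * real m) powr \<epsilon> = (3 / 4) powr \<epsilon> * real m powr (1 + \<epsilon>)"
    using assms(1) by (simp add: powr_mult powr_add powr_divide)
  finally show ?thesis .
qed

lemma log2_le_powr:
  fixes \<delta> x :: real
  assumes "0 < \<delta>" "1 \<le> x"
  shows "log 2 x \<le> 1 / (\<delta> * ln 2) * x powr \<delta>"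
proof -
  have "ln x \<le> x powr \<delta> / \<delta>" using ln_powr_bound assms by blast
  then have "ln x / ln 2 \<le> x powr \<delta> / \<delta> / ln 2" by (intro divide_right_mono) auto
  then show ?thesis by (simp add: log_def)
qed

lemma exponent_le_powr:
  assumes "0 < \<delta>" "1 \<le> m"
  shows "\<exists>P. m \<le> 2 ^ P \<and> real P \<le> (1 / (\<delta> * ln 2) + 1) * real m powr \<delta>"
proof -
  define P where "P = nat \<lceil>log 2 (real m)\<rceil>"
  have l0: "0 \<le> log 2 (real m)" using assms(2) by simp
  have P: "log 2 (real m) \<le> real P" "real P \<le> log 2 (real m) + 1" using l0 by (simp_all add: P_def)
  have "real m = 2 powr (log 2 (real m))" using assms(2) by simp
  also have "\<dots> \<le> 2 powr real P" using P(1) by simp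
  also have "\<dots> = real (2 ^ P)" by (simp add: powr_realpow)
  finally have "m \<le> 2 ^ P" by (simp only: of_nat_le_iff)
  moreover have "1 \<le> real m powr \<delta>" using assms by (simp add: ge_one_powr_ge_zero)
  then have "real P \<le> (1 / (\<delta> * ln 2) + 1) * real m powr \<delta>"
    using P(2) log2_le_powr[OF assms(1), of "real m"] assms(2) by (simp add: distrib_right)
  ultimately show ?thesis by blast
qed

lemma least_power:
  fixes r v :: nat
  assumes "2 \<le> r" "1 \<le> v"
  defines "L \<equiv> (LEAST t. v < r ^ t)"
  shows "v < r ^ L" "1 \<le> L" "r ^ (L - 1) \<le> v"
proof -
  have "v < 2 ^ v" by (rule less_exp)
  also have "\<dots> \<le> r ^ v" using assms(1) by (intro power_mono) auto
  finally show 1: "v < r ^ L" unfolding L_def by (rule LeastI)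
  show 2: "1 \<le> L" using 1 assms(2) by (cases L) auto
  have "\<not> v < r ^ (L - 1)" using 2 unfolding L_def by (intro not_less_Least) auto
  then show "r ^ (L - 1) \<le> v" by simp
qed

lemma digits_le_powr:
  fixes r v :: nat and \<delta> :: real
  assumes r: "2 \<le> r" and \<delta>: "0 < \<delta>" and v: "1 \<le> v"
  defines "L \<equiv> (LEAST t. v < r ^ t)"
  shows "real (L + 1) \<le> (1 / (\<delta> * ln 2) + 2) * real v powr \<delta>"
proof -
  note l = least_power[OF r v, folded L_def]
  have "2 ^ (L - 1) \<le> r ^ (L - 1)" using r by (intro power_mono) auto
  then have "2 ^ (L - 1) \<le> v" using l(3) by (rule le_trans)
  then have "real (2 ^ (L - 1)) \<le> real v" by (simp only: of_nat_le_iff)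
  then have "2 powr real (L - 1) \<le> real v" by (simp add: powr_realpow)
  then have "real (L - 1) \<le> log 2 (real v)" using v by (simp add: le_log_iff)
  then have "real (L + 1) \<le> log 2 (real v) + 2" using l(2) by simp
  moreover have "1 \<le> real v powr \<delta>" using v \<delta> by (simp add: ge_one_powr_ge_zero)
  ultimately show ?thesis
    using log2_le_powr[OF \<delta>, of "real v"] v by (simp add: distrib_right)
qed

text \<open>Minimality of \<open>L\<close> gives \<open>r ^ (L - 1) <= v\<close>, and the choice of
  \<open>r\<close> gives \<open>q <= r powr (1 + \<delta>)\<close>. Only \<open>L - 1\<close>
  factors are traded for \<open>v\<close>; the last one remains as the constant
  \<open>q\<close>.\<close>

lemma grid_le_powr:
  fixes r v :: nat and \<delta> :: real
  assumes r: "2 \<le> r" "2 \<le> real r powr \<delta>" and \<delta>: "0 < \<delta>" and v: "1 \<le> v"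
  defines "L \<equiv> (LEAST t. v < r ^ t)" and "q \<equiv> 2 * r - 1"
  shows "real (q ^ L) \<le> real q * real v powr (1 + \<delta>)"
proof -
  note l = least_power[OF r(1) v, folded L_def]
  have "real q \<le> real r * 2" using r by (simp add: q_def)
  also have "\<dots> \<le> real r * real r powr \<delta>" using r by (intro mult_left_mono) auto
  also have "\<dots> = real r powr (1 + \<delta>)" using r by (simp add: powr_add)
  finally have "real q ^ (L - 1) \<le> (real r powr (1 + \<delta>)) ^ (L - 1)" by (intro power_mono) auto
  also have "\<dots> = (real r ^ (L - 1)) powr (1 + \<delta>)"
    using r by (simp add: powr_realpow[symmetric] powr_powr mult.commute)
  also have "\<dots> \<le> real v powr (1 + \<delta>)"
    using l(3) \<delta> by (intro powr_mono2) (auto simp: of_nat_power[symmetric] simp del: of_nat_power)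
  finally have "real q * real q ^ (L - 1) \<le> real q * real v powr (1 + \<delta>)" by (intro mult_left_mono) auto
  moreover have "real q * real q ^ (L - 1) = real (q ^ L)" using l(2) by (cases L) auto
  ultimately show ?thesis by simp
qed

text \<open>With \<open>\<delta> = \<epsilon> / 4\<close> the main term is
  \<open>v powr (1 + 2 * \<delta>)\<close>, that is \<open>sqrt v\<close> times
  \<open>v powr (1 / 2 + 2 * \<delta>)\<close>, and \<open>v < m * m\<close> turns the second factor
  into \<open>m powr (1 + \<epsilon>)\<close>.\<close>

lemma conv_cost:
  fixes r v m :: nat and \<epsilon> :: real
  assumes r: "2 \<le> r" "2 \<le> real r powr (\<epsilon> / 4)" and \<epsilon>: "0 < \<epsilon>" and v: "1 \<le> v" "v < m * m"
  defines "L \<equiv> (LEAST t. v < r ^ t)" and "q \<equiv> 2 * r - 1" and "A \<equiv> 1 / (\<epsilon> / 4 * ln 2) + 2"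
  shows "real ((q ^ L + m) * (L + 1)) \<le> (real q + 1) * A * (real m powr (1 + \<epsilon>) * sqrt (real v))"
proof -
  define \<delta> where "\<delta> = \<epsilon> / 4"
  have \<delta>: "0 < \<delta>" "\<epsilon> = 4 * \<delta>" using \<epsilon> by (auto simp: \<delta>_def)
  note g = grid_le_powr[OF r[folded \<delta>_def] \<delta>(1) v(1), folded L_def q_def]
    digits_le_powr[OF r(1) \<delta>(1) v(1), folded L_def]
  have A: "A = 1 / (\<delta> * ln 2) + 2" by (simp add: A_def \<delta>_def)
  have A0: "0 \<le> A" using \<delta> by (simp add: A)
  have m1: "1 \<le> real m" using v by (cases m) auto
  have v1: "1 \<le> real v" using v by simp
  have vm: "real v \<le> real m powr 2"
    using v m1 by (simp add: powr_numeral power2_eq_square flip: of_nat_mult)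
  have vd: "real v powr a \<le> real m powr (2 * a)" if "0 \<le> a" for a
  proof -
    have "real v powr a \<le> (real m powr 2) powr a" using that vm by (intro powr_mono2) auto
    then show ?thesis by (simp only: powr_powr)
  qed
  have s1: "1 \<le> sqrt (real v)" using v1 by simp
  have sv: "sqrt (real v) = real v powr (1 / 2)" using v1 by (simp add: powr_half_sqrt)
  have "real v powr (1 + \<delta>) * real v powr \<delta> = real v powr (1 / 2 + 2 * \<delta>) * sqrt (real v)"
    unfolding sv powr_add[symmetric] by (rule arg_cong[of _ _ "(powr) (real v)"]) simp
  also have "\<dots> \<le> real m powr (2 * (1 / 2 + 2 * \<delta>)) * sqrt (real v)"
    using vd[of "1 / 2 + 2 * \<delta>"] \<delta> by (intro mult_right_mono) auto
  also have "2 * (1 / 2 + 2 * \<delta>) = 1 + \<epsilon>" using \<delta> by simp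
  finally have b1: "real v powr (1 + \<delta>) * real v powr \<delta> \<le> real m powr (1 + \<epsilon>) * sqrt (real v)" .
  have "real m * real v powr \<delta> \<le> real m * real m powr (2 * \<delta>)"
    using vd[of \<delta>] \<delta> by (intro mult_left_mono) auto
  also have "\<dots> = real m powr (1 + 2 * \<delta>)" using m1 by (simp add: powr_add)
  also have "\<dots> \<le> real m powr (1 + \<epsilon>)" using m1 \<delta> by (intro powr_mono) auto
  also have "\<dots> \<le> real m powr (1 + \<epsilon>) * sqrt (real v)" using s1 mult_left_mono[OF s1, of "real m powr (1 + \<epsilon>)"] by simp
  finally have b2: "real m * real v powr \<delta> \<le> real m powr (1 + \<epsilon>) * sqrt (real v)" .
  have "real ((q ^ L + m) * (L + 1)) \<le> (real q * real v powr (1 + \<delta>) + real m) * (A * real v powr \<delta>)"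
    using g A unfolding of_nat_mult of_nat_add[of "q ^ L"] by (intro mult_mono add_mono) auto
  also have "\<dots> = A * (real q * (real v powr (1 + \<delta>) * real v powr \<delta>) + real m * real v powr \<delta>)"
    by (simp add: algebra_simps)
  also have "\<dots> \<le> A * (real q * (real m powr (1 + \<epsilon>) * sqrt (real v)) + real m powr (1 + \<epsilon>) * sqrt (real v))"
    using b1 b2 A0 by (intro mult_left_mono add_mono) auto
  finally show ?thesis by (simp add: algebra_simps)
qed

section \<open>Word length\<close>

text \<open>\<open>r ^ L <= r * v\<close>, and constants can be absorbed into exponents:
  \<open>q <= r ^ 2\<close> and \<open>D <= r ^ D\<close> make \<open>q ^ L\<close> and
  \<open>D ^ L\<close> at most fixed powers of \<open>r ^ L\<close>. So all quantities stay below
  one power of \<open>N\<close>, whose generous exponent \<open>\<kappa>\<close> depends on the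
  program only; \<open>E\<close> bounds its constants.\<close>

lemma word_bounds:
  fixes N n nr nb d v r q D L E \<kappa> M w :: nat
  assumes N: "n + d + 2 \<le> N" "v + 1 \<le> N" and n: "n = nr + nb" and v: "1 \<le> v"
    and r: "2 \<le> r" and q: "q = 2 * r - 1" and D: "0 < D"
    and L: "L = (LEAST t. v < r ^ t)" and E: "q * q + D \<le> E"
    and \<kappa>: "\<kappa> = (D + 3) * (r + 1) + E + 10" and M: "M = N ^ \<kappa>" and w: "N ^ (2 * \<kappa> + 12) \<le> 2 ^ w"
  shows "n + 2 * nr * nb + 16 * M + 16 \<le> 2 ^ w" "2 * v + 2 < M" "L < M" "q * q < M" "q ^ L < M"
    "q * r ^ L < M" "D ^ L < M" "D ^ L * M \<le> 2 ^ w" "n * d + d < M" "n * n < M" "(d + 4) * n + 4 < M"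
    "d + 2 < M" "D < M" "n + 2 * nr * nb + 2 < M" "E < M"
proof -
  have N2: "2 \<le> N" using N by linarith
  note l = least_power[OF r v, folded L]
  have mono: "N ^ a \<le> N ^ b" if "a \<le> b" for a b using that N2 by (intro power_increasing) auto
  have ltM: "x < M" if "x \<le> N ^ a" "a < \<kappa>" for x a
  proof -
    have "N ^ a < N ^ \<kappa>" using that(2) N2 by (intro power_strict_increasing) auto
    then show ?thesis using that(1) M by simp
  qed
  have self: "x \<le> N ^ x" for x
  proof -
    have "x \<le> 2 ^ x" using less_exp[of x] by simp
    also have "\<dots> \<le> N ^ x" using N2 by (intro power_mono) auto
    finally show ?thesis .
  qed
  have "r ^ L = r * r ^ (L - 1)" using l(2) by (cases L) auto
  also have "\<dots> \<le> N ^ r * N" using self[of r] l(3) N(2) by (intro mult_le_mono) auto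
  finally have rL: "r ^ L \<le> N ^ (r + 1)" by (simp add: mult.commute)
  have pw: "(r ^ L) ^ a \<le> N ^ ((r + 1) * a)" for a
    using power_mono[OF rL, of a] by (simp only: power_mult zero_le)
  have "q \<le> r ^ 2"
  proof -
    obtain u where "r = u + 1" using r by (cases r) auto
    then show ?thesis by (simp add: q power2_eq_square)
  qed
  then have "q ^ L \<le> (r ^ 2) ^ L" by (intro power_mono) auto
  also have "\<dots> = (r ^ L) ^ 2" by (simp only: power_mult[symmetric] mult.commute)
  finally have qL: "q ^ L \<le> N ^ ((r + 1) * 2)" using pw[of 2] by linarith
  have "D \<le> r ^ D"
  proof -
    have "D \<le> 2 ^ D" using less_exp[of D] by simp
    also have "\<dots> \<le> r ^ D" using r by (intro power_mono) auto
    finally show ?thesis .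
  qed
  then have "D ^ L \<le> (r ^ D) ^ L" by (intro power_mono) auto
  also have "\<dots> = (r ^ L) ^ D" by (simp only: power_mult[symmetric] mult.commute)
  finally have DL: "D ^ L \<le> N ^ ((r + 1) * D)" using pw[of D] by linarith
  have e1: "(r + 1) * a < \<kappa>" if "a \<le> D + 3" for a
  proof -
    have "(r + 1) * a \<le> (r + 1) * (D + 3)" using that by (intro mult_le_mono) auto
    then show ?thesis by (simp add: \<kappa> mult.commute)
  qed
  have EN: "E \<le> N ^ E" by (rule self)
  define Y where "Y = (D + 3) * (r + 1)"
  have "r + 1 \<le> Y" using mult_le_mono1[of 1 "D + 3" "r + 1"] by (simp add: Y_def)
  then have E\<kappa>: "E < \<kappa>" "E + (r + 1) < \<kappa>" "6 < \<kappa>" unfolding \<kappa> Y_def[symmetric] by linarith+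
  show "E < M" using ltM[OF EN E\<kappa>(1)] .
  then show "q * q < M" "D < M" using E by linarith+
  show "q ^ L < M" using ltM[OF qL] e1[of 2] by simp
  show "D ^ L < M" using ltM[OF DL] e1[of D] by simp
  have "L \<le> 2 ^ L" using less_exp[of L] by simp
  also have "\<dots> \<le> r ^ L" using r by (intro power_mono) auto
  finally have "L \<le> N ^ (r + 1)" using rL by linarith
  then show "L < M" by (rule ltM) (use e1[of 1] in simp)
  have "q \<le> N ^ E" using EN E le_square[of q] by linarith
  then have "q * r ^ L \<le> N ^ E * N ^ (r + 1)" using rL by (intro mult_le_mono)
  then show "q * r ^ L < M" using ltM[of _ "E + (r + 1)"] E\<kappa>(2) by (simp only: power_add)
  have P2: "N * N \<le> N ^ 2" "2 * N \<le> N * N" "4 \<le> N * N" "N \<le> N * N"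
    using N2 mult_le_mono[OF N2 N2] by (auto simp: power2_eq_square)
  have P4: "4 * (N * N) \<le> N ^ 4"
    using mult_le_mono1[OF P2(3), of "N * N"] by (simp add: eval_nat_numeral)
  have nn: "n * n \<le> N * N" "n * d \<le> N * N" "nr * nb \<le> N * N" using N n by (auto intro!: mult_le_mono)
  have f: "x < M" if "x \<le> 4 * (N * N)" for x using ltM[of x 4] that P4 E\<kappa>(3) by linarith
  show "n * d + d < M" by (rule f) (use nn P2 N in linarith)
  show "n * n < M" by (rule f) (use nn in linarith)
  show "d + 2 < M" by (rule f) (use P2 N in linarith)
  show "2 * v + 2 < M" by (rule f) (use P2 N in linarith)
  have dn: "(d + 4) * n + 4 = n * d + 4 * n + 4" by (simp add: algebra_simps)
  have N4: "4 * n + 4 \<le> 2 * (N * N) + (N * N)"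
  proof -
    have "4 * n \<le> 4 * N" using N by simp
    then show ?thesis using P2 by linarith
  qed
  show "(d + 4) * n + 4 < M" unfolding dn by (rule f) (use nn N4 in linarith)
  have b: "n + 2 * nr * nb + 2 \<le> 4 * (N * N)"
  proof -
    have "2 * nr * nb = 2 * (nr * nb)" by simp
    then show ?thesis using nn(3) P2 N by linarith
  qed
  then show "n + 2 * nr * nb + 2 < M" by (rule f)
  \<comment> \<open>One factor \<open>M\<close> is for \<open>D ^ L\<close> and one for the
    coefficients; \<open>N ^ 12\<close> leaves room for the multiple of \<open>M\<close> in the
    address bound.\<close>
  have "N ^ (2 * \<kappa> + 12) = M * M * N ^ 12" by (simp only: M power_add[symmetric] mult_2)
  then have w': "M * M * N ^ 12 \<le> 2 ^ w" using w by simp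
  have "D ^ L \<le> M" using \<open>D ^ L < M\<close> by simp
  then have "D ^ L * M \<le> M * M * 1" by (simp add: mult_le_mono)
  also have "\<dots> \<le> M * M * N ^ 12" using N2 by (intro mult_le_mono2) simp
  finally show "D ^ L * M \<le> 2 ^ w" using w' by linarith
  have "2 ^ 12 \<le> N ^ 12" using N2 by (intro power_mono) auto
  then have "M * 33 \<le> M * N ^ 12" by (intro mult_le_mono2) simp
  also have "\<dots> \<le> M * (M * N ^ 12)" using \<open>E < M\<close> by (intro mult_le_mono2) simp
  finally have "M * 33 \<le> M * M * N ^ 12" unfolding mult.assoc .
  then have "33 * M \<le> 2 ^ w" using w' by linarith
  moreover have "n + 2 * nr * nb + 2 < M" "16 \<le> M"
  proof -
    show "n + 2 * nr * nb + 2 < M" using b by (rule f)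
    have "N ^ 4 < M" using ltM[of "N ^ 4" 4] E\<kappa>(3) by simp
    moreover have "4 * 4 \<le> 4 * (N * N)" using P2 by simp
    ultimately show "16 \<le> M" using P4 by linarith
  qed
  ultimately show "n + 2 * nr * nb + 16 * M + 16 \<le> 2 ^ w" by linarith
qed

text \<open>\<open>max 1\<close> keeps the bound positive when there are no points or all values are
  0, as even then the program takes some steps. The factor exponential in the dimension is
  \<open>g ^ d\<close>, written with \<open>c = log 2 g\<close>, and \<open>k\<close> is the
  exponent that \<open>word_bounds\<close> asks of the word length.\<close>

theorem theorem25:
  fixes \<epsilon> :: real
  assumes "\<epsilon> > 0"
  shows "\<exists>(P :: program) (k :: real) (C :: real) (c :: real).
           \<forall>(d :: nat) (v :: nat) (R :: valued_point list) (B :: valued_point list) (n :: nat) (w :: nat).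
             valued_points d v R \<longrightarrow> valued_points d v B \<longrightarrow> n = length R + length B \<longrightarrow>
             real w \<ge> k * log 2 (real (n + d + v + 2)) \<longrightarrow>
             solves_red_blue_within w P d R B
               (C * 2 powr (c * real d) * real (max 1 n) powr (1 + \<epsilon>) * sqrt (real (max 1 v)))"
proof -
  \<comment> \<open>Chosen to make \<open>r powr (\<epsilon> / 4)\<close> at least 2, as
    \<open>conv_cost\<close> demands.\<close>
  define r where "r = nat \<lceil>2 powr (4 / \<epsilon>)\<rceil>"
  define q where "q = 2 * r - 1"
  have r1: "2 powr (4 / \<epsilon>) \<le> real r" unfolding r_def by simp
  have "1 < (2 :: real) powr (4 / \<epsilon>)" using assms by simp
  then have r: "2 \<le> r" using r1 by linarith
  have "2 = (2 powr (4 / \<epsilon>)) powr (\<epsilon> / 4)" using assms by (simp add: powr_powr)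
  also have "\<dots> \<le> real r powr (\<epsilon> / 4)" using r1 assms by (intro powr_mono2) auto
  finally have r2: "2 \<le> real r powr (\<epsilon> / 4)" .
  obtain D Bm where D: "0 < D"
    and Bm: "\<And>g e. g < q \<Longrightarrow> e < q \<Longrightarrow> (\<Sum>y<q. Bm g y * int y ^ e) = (if g = e then int D else 0)"
    using vandermonde_inverse[of q] by blast
  define fw where "fw = map (\<lambda>i. int (i div q) ^ (i mod q)) [0..<q * q]"
  define bw where "bw = map (\<lambda>i. Bm (i div q) (i mod q)) [0..<q * q]"
  define P where "P = machine_code (algorithm r q D fw bw)"
  \<comment> \<open>The sum over both tables makes every table entry smaller than
    \<open>M\<close>.\<close>
  define E where "E = q * q + D + (\<Sum>c\<leftarrow>fw @ bw. nat \<bar>c\<bar>)"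
  define \<kappa> where "\<kappa> = (D + 3) * (r + 1) + E + 10"
  define \<gamma> where "\<gamma> = 1 - (3 / 4) powr \<epsilon>"
  have \<gamma>: "0 < \<gamma>" "\<gamma> < 1" using assms powr_less_mono2[of \<epsilon> "3 / 4" 1] by (auto simp: \<gamma>_def)
  define g where "g = 2 / \<gamma>"
  have g: "1 \<le> g" "0 < g" "\<gamma> * g = 2" using \<gamma> by (auto simp: g_def field_simps)
  \<comment> \<open>\<open>A1\<close> is for sorting and splitting, with the logarithm estimated by
    a multiple of \<open>m powr \<epsilon>\<close>; \<open>A2\<close> is the constant of
    \<open>conv_cost\<close>.\<close>
  define A1 where "A1 = 33 + 35 * (1 / (\<epsilon> * ln 2) + 1)"
  define A2 where "A2 = (real q + 1) * (1 / (\<epsilon> / 4 * ln 2) + 2)"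
  have A: "0 \<le> A1" "0 \<le> A2" using assms by (auto simp: A1_def A2_def)
  \<comment> \<open>The sum of the demands of splitting, direct pairing and convolution. As
    \<open>1 <= m\<close>, the coefficients of the leaf costs can be added up: 38 = 3 + 20 + 10 + 5
    and 23 = 3 + 20.\<close>
  define H where "H = g * A1 + 38 + 23 + A2 * real (9 * q + 80)"
  have H: "38 \<le> H" "g * A1 \<le> H" "23 + A2 * real (9 * q + 80) \<le> H" "0 \<le> H" 
    using A g by (auto simp: H_def)
  define C0 where "C0 = 7 + 5 * (1 / (1 / 2 * ln 2) + 2) + real (2 * (q * q) + 20) + 8 + H"
  define C where "C = real (length P) * (C0 + 1)"
  have C0: "0 \<le> C0" using H by (auto simp: C0_def)
  show ?thesis
  proof (rule exI[of _ P], rule exI[of _ "real (2 * \<kappa> + 12)"], rule exI[of _ C], rule exI[of _ "log 2 g"],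
      intro allI impI)
    fix d v n w and R B :: "valued_point list"
    assume vR: "valued_points d v R" and vB: "valued_points d v B" and n: "n = length R + length B"
      and w: "real (2 * \<kappa> + 12) * log 2 (real (n + d + v + 2)) \<le> real w"
    define N where "N = n + d + v + 2"
    define M where "M = N ^ \<kappa>"
    define nr where "nr = length R"
    define nb where "nb = length B"
    define base where "base = n + 2 * nr * nb"
    define X where "X = red_blue_coords R B"
    define val where "val = (\<lambda>p. snd ((R @ B) ! p))"
    \<comment> \<open>The maximum that the program computes; it takes the place of \<open>v\<close>
      in the analysis and is at most \<open>max 1 v\<close>.\<close>
    define u where "u = fold max (map val [0..<n]) 1"
    define L where "L = (LEAST t. u < r ^ t)"
    have nrb: "n = nr + nb" using n by (simp add: nr_def nb_def)
    have pts: "length x = d \<and> a \<le> v" if "(x, a) \<in> set (R @ B)" for x a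
      using vR vB that by (auto simp: valued_points_def)
    have val_v: "val p \<le> v" if "p < n" for p
    proof -
      have "(R @ B) ! p \<in> set (R @ B)" using that n by (intro nth_mem) simp
      then show ?thesis using pts[of "fst ((R @ B) ! p)" "snd ((R @ B) ! p)"] by (simp add: val_def)
    qed
    have u: "u = Max (insert 1 (val ` {..<n}))"
      unfolding u_def using Max.set_eq_fold[of 1 "map val [0..<n]"] by (simp add: atLeast0LessThan)
    have uval: "val p \<le> u" if "p < n" for p
      unfolding u using that by (auto intro: Max_ge)
    have u1: "1 \<le> u" unfolding u by (rule Max_ge) auto
    have uv: "u \<le> max 1 v" unfolding u by (subst Max_le_iff) (auto dest: val_v simp: le_max_iff_disj)
    have Nr: "0 < real N" by (simp add: N_def)
    have "real N ^ (2 * \<kappa> + 12) = 2 powr (real (2 * \<kappa> + 12) * log 2 (real N))"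
    proof -
      have "2 powr (real (2 * \<kappa> + 12) * log 2 (real N)) = (2 powr log 2 (real N)) powr real (2 * \<kappa> + 12)"
        by (simp only: powr_powr mult.commute)
      also have "2 powr log 2 (real N) = real N" using Nr by simp
      also have "real N powr real (2 * \<kappa> + 12) = real N ^ (2 * \<kappa> + 12)" using Nr by (rule powr_realpow)
      finally show ?thesis by simp
    qed
    also have "\<dots> \<le> 2 powr real w" using w by (intro powr_mono) (simp_all only: N_def one_le_numeral)
    also have "\<dots> = 2 ^ w" by (simp add: powr_realpow)
    finally have "real (N ^ (2 * \<kappa> + 12)) \<le> real (2 ^ w)" by simp
    then have Nw: "N ^ (2 * \<kappa> + 12) \<le> 2 ^ w" by (simp only: of_nat_le_iff)
    have N1: "n + d + 2 \<le> N" "u + 1 \<le> N" using uv by (auto simp: N_def)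
    have wb: "base + 16 * M + 16 \<le> 2 ^ w" "2 * u + 2 < M" "L < M" "q * q < M" "q ^ L < M"
      "q * r ^ L < M" "D ^ L < M" "D ^ L * M \<le> 2 ^ w" "n * d + d < M" "n * n < M" "(d + 4) * n + 4 < M"
      "d + 2 < M" "D < M" "n + 2 * nr * nb + 2 < M" "E < M"
      using word_bounds[OF N1 nrb u1 r q_def D L_def _ \<kappa>_def M_def Nw] by (auto simp: base_def E_def)
    define pot where "pot = (\<lambda>i m. H * g ^ (d - i) * (real m powr (1 + \<epsilon>) * sqrt (real u)))"
    have su: "1 \<le> sqrt (real u)" using u1 by simp
    have gp: "1 \<le> g ^ i" for i using g by simp
    have Hg: "H \<le> H * g ^ i" for i using mult_left_mono[OF gp[of i] H(4)] by simp
    have mle: "real m \<le> real m powr (1 + \<epsilon>)" if "1 \<le> m" for m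
      using powr_mono[of 1 "1 + \<epsilon>" "real m"] that assms by simp
    have mS: "real m \<le> real m powr (1 + \<epsilon>) * sqrt (real u)" if "1 \<le> m" for m
      using mult_mono[OF mle[OF that] su] by simp
    interpret T: timed w X M base n nr u val r q L D Bm d pot
    proof unfold_locales
      show "base + 16 * M + 16 \<le> 2 ^ w" by (rule wb)
      show "n \<le> base" by (simp add: base_def)
      show "val p \<le> u" if "p < n" for p using uval that .
      show "q = 2 * r - 1" by (rule q_def)
      show "(\<Sum>y<q. Bm i y * int y ^ e) = (if i = e then int D else 0)" if "i < q" "e < q" for i e
        using Bm that .
      show "u < r ^ L" unfolding L_def by (rule least_power(1)[OF r u1])
      show "0 \<le> pot i m" for i m unfolding pot_def using H g by (intro mult_nonneg_nonneg) auto
      show "20 \<le> pot i 1" if "i < d" for i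
      proof -
        have "H * g ^ (d - i) * 1 \<le> H * g ^ (d - i) * sqrt (real u)"
          using su H g by (intro mult_left_mono) auto
        then have "20 \<le> H * g ^ (d - i) * sqrt (real u)" using Hg[of "d - i"] H(1) by linarith
        then show ?thesis by (simp add: pot_def)
      qed
      show "real (3 * m + 20 + m * (m * 10 + 5)) \<le> pot d m" if m: "1 \<le> m" "m \<le> n" "m * m \<le> u" for m
      proof -
        have "3 * m + 20 + m * (m * 10 + 5) \<le> 38 * (m * m)"
        proof -
          obtain x where "m = Suc x" using m(1) by (cases m) auto
          then show ?thesis by (simp add: algebra_simps)
        qed
        then have "real (3 * m + 20 + m * (m * 10 + 5)) \<le> real (38 * (m * m))" by (simp only: of_nat_le_iff)
        also have "\<dots> = 38 * (real m * real m)" by simp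
        also have "real m \<le> sqrt (real u)"
          using m(3) by (intro real_le_rsqrt) (simp add: power2_eq_square flip: of_nat_mult)
        then have "38 * (real m * real m) \<le> H * (real m powr (1 + \<epsilon>) * sqrt (real u))"
          using mle[OF m(1)] H by (intro mult_mono) auto
        finally show ?thesis by (simp add: pot_def)
      qed
      show "real (3 * m + 20 + (q ^ L + m) * (L + 1) * (9 * q + 80)) \<le> pot d m"
        if m: "1 \<le> m" "m \<le> n" "u < m * m" for m
      proof -
        let ?S = "real m powr (1 + \<epsilon>) * sqrt (real u)"
        have "real ((q ^ L + m) * (L + 1)) \<le> A2 * ?S"
          unfolding A2_def L_def q_def by (rule conv_cost[OF r r2 assms u1 m(3)])
        then have "real ((q ^ L + m) * (L + 1)) * real (9 * q + 80) \<le> A2 * ?S * real (9 * q + 80)"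
          by (intro mult_right_mono) auto
        moreover have "real (3 * m + 20) \<le> 23 * ?S" using mS[OF m(1)] m(1) by simp
        ultimately have "real (3 * m + 20 + (q ^ L + m) * (L + 1) * (9 * q + 80)) \<le> (23 + A2 * real (9 * q + 80)) * ?S"
          unfolding of_nat_add[of "3 * m + 20"] of_nat_mult[of "(q ^ L + m) * (L + 1)"]
          by (simp only: distrib_right) (simp only: mult.assoc mult.left_commute mult.commute)
        also have "\<dots> \<le> H * ?S" using H(3) by (intro mult_right_mono) auto
        finally show ?thesis by (simp add: pot_def)
      qed
      show "\<exists>P. m \<le> 2 ^ P \<and> (\<forall>c\<le>m. real (13 * m + 40 + P * (8 + 27 * m)) + pot i (m div 2) +
          pot i (m - m div 2) + pot (Suc i) c \<le> pot i m)" if i: "i < d" and m: "2 \<le> m" "m \<le> n" for i m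
      proof -
        let ?m = "real m powr (1 + \<epsilon>)"
        have m1: "1 \<le> m" using m by simp
        obtain P where P: "m \<le> 2 ^ P" "real P \<le> (1 / (\<epsilon> * ln 2) + 1) * real m powr \<epsilon>"
          using exponent_le_powr[OF assms m1] by blast
        \<comment> \<open>40 is at most \<open>20 * m\<close> because \<open>2 <= m\<close>, and
          \<open>8 * P\<close> is at most \<open>8 * (P * m)\<close>.\<close>
        have "13 * m + 40 + P * (8 + 27 * m) \<le> 33 * m + 35 * (P * m)"
        proof -
          have "P * 1 \<le> P * m" using m1 by (intro mult_le_mono2) simp
          moreover have "P * (8 + 27 * m) = 8 * P + 27 * (P * m)" by (simp add: algebra_simps)
          ultimately show ?thesis using m by linarith
        qed
        then have "real (13 * m + 40 + P * (8 + 27 * m)) \<le> real (33 * m + 35 * (P * m))" by (simp only: of_nat_le_iff)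
        also have "\<dots> = 33 * real m + 35 * (real P * real m)" by simp
        also have "\<dots> \<le> 33 * ?m + 35 * ((1 / (\<epsilon> * ln 2) + 1) * real m powr \<epsilon> * real m)"
          using mle[OF m1] P(2) by (intro add_mono mult_left_mono mult_right_mono) auto
        also have "\<dots> = A1 * ?m" using m1 by (simp add: A1_def powr_add algebra_simps)
        finally have c1: "real (13 * m + 40 + P * (8 + 27 * m)) \<le> A1 * ?m" .
        let ?K = "H * g ^ (d - i)"
        have gi: "g ^ (d - i) = g * g ^ (d - Suc i)" using i by (metis Suc_diff_Suc power_Suc)
        have K2: "\<gamma> * ?K = 2 * (H * g ^ (d - Suc i))" unfolding gi using g(3) by (metis mult.assoc mult.commute)
        have A1K: "2 * A1 \<le> \<gamma> * ?K"
        proof -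
          have "2 * A1 = \<gamma> * (g * A1)" using g(3) by (simp add: mult.assoc[symmetric])
          also have "\<dots> \<le> \<gamma> * ?K" using H(2) Hg[of "d - i"] \<gamma> by (intro mult_left_mono) linarith+
          finally show ?thesis .
        qed
        have K0: "0 \<le> ?K" using H g by simp
        have m0: "0 \<le> ?m" by simp
        have c2: "pot i (m div 2) + pot i (m - m div 2) \<le> ?K * ((1 - \<gamma>) * ?m * sqrt (real u))"
        proof -
          have "pot i (m div 2) + pot i (m - m div 2) =
             ?K * ((real (m div 2) powr (1 + \<epsilon>) + real (m - m div 2) powr (1 + \<epsilon>)) * sqrt (real u))"
            by (simp only: pot_def distrib_left distrib_right)
          also have "\<dots> \<le> ?K * ((1 - \<gamma>) * ?m * sqrt (real u))"
            using halves_powr[OF m(1) assms] K0 by (intro mult_left_mono mult_right_mono) (auto simp: \<gamma>_def)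
          finally show ?thesis .
        qed
        have "real (13 * m + 40 + P * (8 + 27 * m)) + pot i (m div 2) + pot i (m - m div 2) + pot (Suc i) c \<le> pot i m"
          if c: "c \<le> m" for c
        proof -
          define Z where "Z = ?m * sqrt (real u)"
          have mZ: "?m \<le> Z" using mult_left_mono[OF su m0] by (simp add: Z_def)
          have "A1 * ?m \<le> A1 * Z" using mZ A by (intro mult_left_mono) auto
          also have "\<dots> \<le> \<gamma> / 2 * ?K * Z" using A1K order_trans[OF m0 mZ] by (intro mult_right_mono) auto
          finally have a: "real (13 * m + 40 + P * (8 + 27 * m)) \<le> \<gamma> / 2 * ?K * Z" using c1 by linarith
          have "real c powr (1 + \<epsilon>) \<le> ?m" using c assms by (intro powr_mono2) auto
          then have "pot (Suc i) c \<le> H * g ^ (d - Suc i) * Z"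
            unfolding pot_def Z_def using H g by (intro mult_left_mono mult_right_mono) auto
          also have "H * g ^ (d - Suc i) = \<gamma> / 2 * ?K" using K2 by linarith
          finally have b: "pot (Suc i) c \<le> \<gamma> / 2 * ?K * Z" .
          have "pot i (m div 2) + pot i (m - m div 2) \<le> (1 - \<gamma>) * ?K * Z"
            using c2 by (simp add: Z_def mult.assoc mult.left_commute)
          moreover have "\<gamma> / 2 * ?K * Z + \<gamma> / 2 * ?K * Z + (1 - \<gamma>) * ?K * Z = ?K * Z" by (simp add: field_simps)
          moreover have "pot i m = ?K * Z" by (simp add: pot_def Z_def)
          ultimately show ?thesis using a b by linarith
        qed
        then show ?thesis using P(1) by blast
      qed
    qed (use wb r D in auto)
    have tot: "T.tot = coeff (red_blue_poly R B)"
      by (rule T.tot_eq_coeff) (use n pts in \<open>auto simp: nr_def X_def val_def\<close>)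
    let ?S = "{e. T.tot e \<noteq> 0}"
    have supp: "card ?S \<le> nr * nb" unfolding tot unfolding nr_def nb_def by (rule card_support_le)
    have "?S \<subseteq> {..2 * u}" using T.tot_support by auto
    then have "card ?S \<le> card {..2 * u}" by (intro card_mono) auto
    then have supp2: "card ?S \<le> 2 * u + 1" by simp
    have tabs: "T.forward_table = fw" "T.backward_table = bw"
      by (simp_all add: T.forward_table_def T.backward_table_def fw_def bw_def)
    have tab_less: "nat \<bar>c\<bar> < M" if "c \<in> set (T.forward_table @ T.backward_table)" for c
    proof -
      have "nat \<bar>c\<bar> \<le> (\<Sum>c\<leftarrow>fw @ bw. nat \<bar>c\<bar>)"
        using that unfolding tabs by (intro member_le_sum_list) auto
      then show ?thesis using wb(15) by (simp add: E_def)
    qed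
    have "T.wp (algorithm r q D T.forward_table T.backward_table) (\<lambda>t s'.
     real t \<le> real (7 * n + 5 * L + 2 * (q * q) + 20 + 4 * card ?S) + pot 0 n \<and> vs s' Pts = n \<and>
     distinct (written s' n) \<and>
     set (written s' n) = {(e, T.tot e) | e. T.tot e \<noteq> 0})
     (initial d R B)"
      by (rule T.algorithm_correct[of _ nb])
        (use wb tab_less supp nrb in \<open>auto simp: initial_def nr_def nb_def u_def L_def base_def val_def n\<close>)
    then have alg: "T.wp (algorithm r q D fw bw) (\<lambda>t s'.
     real t \<le> real (7 * n + 5 * L + 2 * (q * q) + 20 + 4 * card ?S) + pot 0 n \<and> vs s' Pts = n \<and>
     distinct (written s' n) \<and>
     set (written s' n) = {(e, T.tot e) | e. T.tot e \<noteq> 0})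
     (initial d R B)"
      unfolding tabs .
    have base': "base = length R + length B + 2 * length R * length B"
      by (simp add: base_def n nr_def nb_def)
    from T.machine_code_correct[OF alg base']
    obtain t s t' and s' :: st where h: "(real t' \<le> real (7 * n + 5 * L + 2 * (q * q) + 20 + 4 * card ?S) + pot 0 n \<and> vs s' Pts = n \<and>
      distinct (written s' n) \<and>
      set (written s' n) = {(e, T.tot e) | e. T.tot e \<noteq> 0}) \<and>
      runs_to w X P (red_blue_init d R B) t s \<and> t \<le> length P * (t' + 1) \<and> reg s 0 = vs s' Pts \<and> reg s 1 = vs s' Cnt \<and>
      (\<forall>i<base. mem s i = rw s' i)"
      unfolding P_def[symmetric] by (elim exE) (rule that)
    note h1 = conjunct1[OF h] and h2 = conjunct2[OF h]
    note s' = h1[THEN conjunct1] h1[THEN conjunct2, THEN conjunct1]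
      h1[THEN conjunct2, THEN conjunct2, THEN conjunct1] h1[THEN conjunct2, THEN conjunct2, THEN conjunct2]
    note s = h2[THEN conjunct1] h2[THEN conjunct2, THEN conjunct1]
      h2[THEN conjunct2, THEN conjunct2, THEN conjunct1]
      h2[THEN conjunct2, THEN conjunct2, THEN conjunct2, THEN conjunct1]
      h2[THEN conjunct2, THEN conjunct2, THEN conjunct2, THEN conjunct2]
    have cnt: "vs s' Cnt \<le> nr * nb"
    proof -
      have "vs s' Cnt = card {(e, T.tot e) | e. T.tot e \<noteq> 0}"
        using distinct_card[OF s'(3)] unfolding s'(4) by simp
      also have "{(e, T.tot e) | e. T.tot e \<noteq> 0} = (\<lambda>e. (e, T.tot e)) ` ?S" by auto
      also have "card \<dots> = card ?S" by (rule card_image) (simp add: inj_on_def)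
      finally show ?thesis using supp by simp
    qed
    have out: "output_pairs s = written s' n"
      unfolding output_pairs_def s(3,4) s'(2)
    proof (intro map_cong refl)
      fix i assume "i \<in> set [0..<vs s' Cnt]"
      then have "2 * i + 2 \<le> 2 * (nr * nb)" using cnt by simp
      then have "n + 2 * i < base" "n + 2 * i + 1 < base" by (auto simp: base_def)
      then show "(mem s (n + 2 * i), mem s (n + 2 * i + 1)) = (rw s' (n + 2 * i), rw s' (n + 2 * i + 1))"
        using s(5) by simp
    qed
    have lists: "lists_nonzero_coeffs (output_pairs s) (red_blue_poly R B)"
      unfolding lists_nonzero_coeffs_def out using s'(3,4) by (simp only: tot simp_thms)
    \<comment> \<open>The common unit of the final estimate: every summand of the time bound is at
      most a constant times \<open>Z\<close>, and \<open>C0\<close> adds up the constants.\<close>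
    define Z where "Z = g ^ d * (real (max 1 n) powr (1 + \<epsilon>) * sqrt (real u))"
    have n1: "1 \<le> real (max 1 n) powr (1 + \<epsilon>)" using assms by (intro ge_one_powr_ge_zero) auto
    have nZ: "real (max 1 n) * sqrt (real u) \<le> Z"
    proof -
      have "real (max 1 n) * sqrt (real u) \<le> real (max 1 n) powr (1 + \<epsilon>) * sqrt (real u)"
        using mle[of "max 1 n"] by (intro mult_right_mono) auto
      also have "\<dots> \<le> Z" unfolding Z_def using gp[of d] n1 mult_right_mono[OF gp[of d], of "real (max 1 n) powr (1 + \<epsilon>) * sqrt (real u)"] by simp
      finally show ?thesis .
    qed
    have uZ: "sqrt (real u) \<le> Z" using nZ mult_right_mono[of 1 "real (max 1 n)" "sqrt (real u)"] by simp
    have Z1: "1 \<le> Z" using uZ su by linarith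
    have nZ1: "real n \<le> Z" using nZ mult_mono[of "real n" "real (max 1 n)" 1 "sqrt (real u)"] su by simp
    have LZ: "5 * real L \<le> 5 * (1 / (1 / 2 * ln 2) + 2) * Z"
    proof -
      \<comment> \<open>For the set-up phase the crude exponent 1/2 suffices, since
        \<open>sqrt u\<close> is a factor of the bound anyway.\<close>
      have "real (L + 1) \<le> (1 / (1 / 2 * ln 2) + 2) * real u powr (1 / 2)"
        unfolding L_def using digits_le_powr[OF r _ u1, of "1 / 2"] by simp
      also have "real u powr (1 / 2) = sqrt (real u)" by (simp add: powr_half_sqrt)
      also have "(1 / (1 / 2 * ln 2) + 2) * sqrt (real u) \<le> (1 / (1 / 2 * ln 2) + 2) * Z" using uZ by (intro mult_left_mono) auto
      finally have "real L \<le> (1 / (1 / 2 * ln 2) + 2) * Z" by linarith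
      then have "5 * real L \<le> 5 * ((1 / (1 / 2 * ln 2) + 2) * Z)" by (rule mult_left_mono) simp
      then show ?thesis by (simp only: mult.assoc)
    qed
    have cZ: "4 * real (card ?S) \<le> 8 * Z"
    proof -
      have "real (card ?S) \<le> 2 * real n * sqrt (real u)"
        by (rule card_le_mult_sqrt[OF supp _ supp2 u1]) (use nrb in simp)
      also have "\<dots> \<le> 2 * (real (max 1 n) * sqrt (real u))" by (simp add: mult_right_mono)
      finally show ?thesis using nZ by linarith
    qed
    have pZ: "pot 0 n \<le> H * Z"
    proof -
      have "real n powr (1 + \<epsilon>) \<le> real (max 1 n) powr (1 + \<epsilon>)" using assms by (intro powr_mono2) auto
      then have "H * g ^ d * (real n powr (1 + \<epsilon>) * sqrt (real u)) \<le> H * g ^ d * (real (max 1 n) powr (1 + \<epsilon>) * sqrt (real u))"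
        using H g by (intro mult_left_mono mult_right_mono) auto
      then show ?thesis by (simp add: pot_def Z_def mult.assoc)
    qed
    have qZ: "real (2 * (q * q) + 20) \<le> real (2 * (q * q) + 20) * Z" 
      using mult_left_mono[OF Z1, of "real (2 * (q * q) + 20)"] by simp
    have tick: "real t' \<le> C0 * Z"
    proof -
      have "real (7 * n + 5 * L + 2 * (q * q) + 20 + 4 * card ?S) + pot 0 n =
         7 * real n + 5 * real L + real (2 * (q * q) + 20) + 4 * real (card ?S) + pot 0 n" by simp
      also have "\<dots> \<le> 7 * Z + 5 * (1 / (1 / 2 * ln 2) + 2) * Z + real (2 * (q * q) + 20) * Z + 8 * Z + H * Z"
        using nZ1 LZ qZ cZ pZ by linarith
      also have "\<dots> = C0 * Z" by (simp only: C0_def distrib_right)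
      finally show ?thesis using s'(1) by linarith
    qed
    have "real t \<le> real (length P * (t' + 1))" using s(2) by (simp only: of_nat_le_iff)
    also have "\<dots> = real (length P) * (real t' + 1)" by (simp add: distrib_left)
    also have "\<dots> \<le> real (length P) * (C0 * Z + Z)" using tick Z1 by (intro mult_left_mono add_mono) auto
    also have "\<dots> = C * Z" by (simp add: C_def algebra_simps)
    also have "\<dots> \<le> C * (g ^ d * (real (max 1 n) powr (1 + \<epsilon>) * sqrt (real (max 1 v))))"
      unfolding Z_def using uv g C0 by (intro mult_left_mono) (auto simp: C_def)
    also have "g ^ d = 2 powr (log 2 g * real d)"
    proof -
      have "2 powr (log 2 g * real d) = (2 powr log 2 g) powr real d" by (simp only: powr_powr)
      also have "\<dots> = g ^ d" using g by (simp add: powr_realpow)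
      finally show ?thesis by simp
    qed
    finally have "real t \<le> C * 2 powr (log 2 g * real d) * real (max 1 n) powr (1 + \<epsilon>) * sqrt (real (max 1 v))"
      by (simp only: mult.assoc)
    then show "solves_red_blue_within w P d R B
       (C * 2 powr (log 2 g * real d) * real (max 1 n) powr (1 + \<epsilon>) * sqrt (real (max 1 v)))"
      unfolding solves_red_blue_within_def X_def[symmetric] using s(1) lists by blast
  qed
qed

end
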